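(* Assume $T\ge C\frac{n}{m}$ for a sufficiently large constant $C$. There exists a choice of the parameters $k$ and $T_0<T_1<\dots<T_{k-1}<T_k=T$ for the hierarchical baseline algorithm described in the context such that, with high probability in $T$, its regret is $$\tilde O\!\left(\frac{T}{m}+\sqrt{\frac{Tn}{m}}\right).$$
   Context: Setting: online experts problem with $n$ experts over $T$ days, losses $\ell_t\in[0,1]^n$ fixed in advance by an oblivious adversary; the algorithm picks an expert $i_t$ each day; regret is $\sum_t\ell_t(i_t)-\min_{i\in[n]}\sum_t\ell_t(i)$. $\tilde O$ hides logarithmic factors in $T$; $n,T$ polynomially related. Hierarchical baseline algorithm. Inputs: integers $T_0<T_1<\dots<T_k=T$ with $T_{i-1}\mid T_i$, $n$, and a space parameter $m$; set $\epsilon=\log(T)/m$. It keeps buckets $B_0,\dots,B_{k-1}$, each a multiset of entries (expert, arrival time, loss accumulated since arrival, weight). An entry $e'$ $\epsilon$-dominates an entry $e$ if $e'$ arrived earlier than $e$ and the accumulated loss of $e'$ (since its own arrival) is at most $(1+\epsilon)$ times the accumulated loss of $e$ (since its own arrival). Predictions: each day, for each level $i$, an entry $e_i$ of $B_i$ is drawn proportionally to its weight (MWU over $B_i$ with learning rate $\sqrt{\log(|B_i|)/T_i}$, weights reset every $T_i$ days). Set $y_0=e_0$ and for $i\ge1$ choose $y_i$ between $e_i$ and $y_{i-1}$ by a two-option MWU (learning rate $\sqrt{2/T_i}$, restarted every $T_i$ days); play $y_{k-1}$. Each day all losses of entries in the buckets are observed, accumulated losses incremented, MWU weights updated. Bucket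 updates at each $t$ that is a multiple of $T_0$ (and at $t=0$): let $k'$ be the largest $i\in\{0,\dots,k-1\}$ with $T_i\mid t$, and $\tau$ the largest multiple of $T_{k'+1}$ that is $\le t$. (1) Eviction: for each $i\le k'$, remove from $B_i$ each entry with arrival time at least $\tau+0.5$ that is $\epsilon$-dominated by some entry of $B_i$; reset the remaining weights in $B_i$ and the level-$i$ between-level weights to $1$. (2) Forwarding: for $i=k',\dots,1$, add to $B_i$ copies of all entries of $B_0,\dots,B_{i-1}$ with distinct arrival times in $[t,t+0.5)$, loss $0$, weight $1$. (3) Sampling: for each $i\le k'$, sample $m$ experts uniformly with replacement from $[n]$ and add them to $B_i$ with distinct arrival times in $[t+0.5,t+1)$, loss $0$, weight $1$.
   Formalization: T_k = T is kept when all prime factors of T are below a fixed constant; other T allow T ≤ T_k < 2T, stopping after T days (for prime T the only chain is 1, T, giving linear regret). Also m ≤ n is assumed, as for m far above n the bound would beat √T. *)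

theory Defs
  imports "HOL-Probability.Probability" "HOL-Computational_Algebra.Primes"
begin

text \<open>
  Experts are the numbers below \<open>n\<close>, days are \<open>0, \<dots>, T - 1\<close>, and \<open>l t i\<close> is the loss of expert
  \<open>i\<close> on day \<open>t\<close>. The bucket update at time \<open>t\<close> takes place immediately before day \<open>t\<close>.
\<close>

definition loss_sequence :: "nat \<Rightarrow> nat \<Rightarrow> (nat \<Rightarrow> nat \<Rightarrow> real) \<Rightarrow> bool" where
  "loss_sequence T n l \<longleftrightarrow> (\<forall>t<T. \<forall>i<n. 0 \<le> l t i \<and> l t i \<le> 1)"

definition regret :: "nat \<Rightarrow> nat \<Rightarrow> (nat \<Rightarrow> nat \<Rightarrow> real) \<Rightarrow> nat list \<Rightarrow> real" where
  "regret T n l plays =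
     (\<Sum>t<T. l t (plays ! t)) - Min ((\<lambda>i. \<Sum>t<T. l t i) ` {..<n})"

record entry =
  expert :: nat
  arrival :: real
  acc_loss :: real
  entry_weight :: real

text \<open>
  A bucket is a list of entries. The position in the list only serves to name the entries when new
  arrival times are handed out; which entry is the earlier one is decided by \<open>arrival\<close> alone.
  The pair \<open>mix_weights s i\<close> holds the between-level weights of \<open>e\<^sub>i\<close> and of \<open>y\<^bsub>i-1\<^esub>\<close>.
\<close>

record state =
  bucket :: "nat \<Rightarrow> entry list"
  mix_weights :: "nat \<Rightarrow> real \<times> real"

text \<open>
  The algorithm only asks that arrival times be distinct elements of \<open>[t, t + 1/2)\<close> (forwarding) and
  of \<open>[t + 1/2, t + 1)\<close> (sampling). The rule that chooses them is a parameter: the \<open>j\<close>-th of \<open>N\<close>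
  entries forwarded to level \<open>i\<close> at time \<open>t\<close> gets the arrival time \<open>t + fwd_slot p t i N j\<close>, the
  \<open>j\<close>-th of the \<open>N\<close> samples gets \<open>t + 1/2 + smp_slot p t i N j\<close>.
\<close>

record params =
  levels :: nat
  period :: "nat \<Rightarrow> nat"
  num_experts :: nat
  space_param :: nat
  fwd_slot :: "nat \<Rightarrow> nat \<Rightarrow> nat \<Rightarrow> nat \<Rightarrow> real"
  smp_slot :: "nat \<Rightarrow> nat \<Rightarrow> nat \<Rightarrow> nat \<Rightarrow> real"

definition valid_periods :: "nat \<Rightarrow> (nat \<Rightarrow> nat) \<Rightarrow> bool" where
  "valid_periods k Ts \<longleftrightarrow>
     1 \<le> k \<and> 0 < Ts 0 \<and> (\<forall>i<k. Ts i < Ts (Suc i) \<and> Ts i dvd Ts (Suc i))"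

definition valid_slots :: "(nat \<Rightarrow> nat \<Rightarrow> nat \<Rightarrow> nat \<Rightarrow> real) \<Rightarrow> bool" where
  "valid_slots slot \<longleftrightarrow>
     (\<forall>t i N. inj_on (slot t i N) {..<N} \<and> (\<forall>j<N. 0 \<le> slot t i N j \<and> slot t i N j < 1/2))"

definition eps :: "params \<Rightarrow> real" where
  "eps p = ln (real (period p (levels p))) / real (space_param p)"

definition dominates :: "real \<Rightarrow> entry \<Rightarrow> entry \<Rightarrow> bool" where
  "dominates \<epsilon> e' e \<longleftrightarrow> arrival e' < arrival e \<and> acc_loss e' \<le> (1 + \<epsilon>) * acc_loss e"


subsection \<open>Bucket updates\<close>

definition top_level :: "params \<Rightarrow> nat \<Rightarrow> nat" where
  "top_level p t = Max {i. i < levels p \<and> period p i dvd t}"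

definition epoch_start :: "params \<Rightarrow> nat \<Rightarrow> nat" where
  "epoch_start p t =
     (let T' = period p (Suc (top_level p t)) in Max {s. s \<le> t \<and> T' dvd s})"

definition evict :: "params \<Rightarrow> nat \<Rightarrow> entry list \<Rightarrow> entry list" where
  "evict p t B =
     map (entry_weight_update (\<lambda>_. 1))
       (filter (\<lambda>e. \<not> (real (epoch_start p t) + 1/2 \<le> arrival e \<and>
                       (\<exists>e'\<in>set B. dominates (eps p) e' e))) B)"

definition fresh_entry :: "nat \<Rightarrow> real \<Rightarrow> entry" where
  "fresh_entry x a = \<lparr>expert = x, arrival = a, acc_loss = 0, entry_weight = 1\<rparr>"

definition forwarded :: "params \<Rightarrow> nat \<Rightarrow> nat \<Rightarrow> entry list \<Rightarrow> entry list" where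
  "forwarded p t i es =
     map (\<lambda>j. fresh_entry (expert (es ! j)) (real t + fwd_slot p t i (length es) j))
       [0..<length es]"

definition sampled :: "params \<Rightarrow> nat \<Rightarrow> nat \<Rightarrow> nat list \<Rightarrow> entry list" where
  "sampled p t i xs =
     map (\<lambda>j. fresh_entry (xs ! j) (real t + 1/2 + smp_slot p t i (length xs) j))
       [0..<length xs]"

text \<open>
  Forwarding runs through the levels downwards, so level \<open>i\<close> receives the lower buckets as they are
  after eviction and before anything has been forwarded to them or sampled into them; hence all
  levels can be updated simultaneously from the evicted buckets. The sampled experts of level \<open>i\<close> are
  the list \<open>xss ! i\<close>.
\<close>

definition update_with :: "params \<Rightarrow> nat \<Rightarrow> state \<Rightarrow> nat list list \<Rightarrow> state" where
  "update_with p t s xss =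
     (let k' = top_level p t; E = (\<lambda>i. evict p t (bucket s i)) in
      \<lparr>bucket = (\<lambda>i. if i \<le> k'
                     then E i @ forwarded p t i (concat (map E [0..<i])) @ sampled p t i (xss ! i)
                     else bucket s i),
       mix_weights = (\<lambda>i. if i \<le> k' then (1, 1) else mix_weights s i)\<rparr>)"

definition update_step :: "params \<Rightarrow> nat \<Rightarrow> state \<Rightarrow> state pmf" where
  "update_step p t s =
     (if period p 0 dvd t
      then map_pmf (update_with p t s)
             (replicate_pmf (Suc (top_level p t))
               (replicate_pmf (space_param p) (pmf_of_set {..<num_experts p})))
      else return_pmf s)"


subsection \<open>Predictions\<close>

definition draw_expert :: "entry list \<Rightarrow> nat pmf" where
  "draw_expert B =
     pmf_of_list (map (\<lambda>e. (expert e, entry_weight e / (\<Sum>e\<leftarrow>B. entry_weight e))) B)"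

lemma draw_expert_wf:
  fixes B :: "entry list"
  assumes "B \<noteq> []" "\<And>e. e \<in> set B \<Longrightarrow> 0 < entry_weight e"
  shows "pmf_of_list_wf (map (\<lambda>e. (expert e, entry_weight e / (\<Sum>e\<leftarrow>B. entry_weight e))) B)"
proof -
  have pos: "0 < (\<Sum>e\<leftarrow>C. entry_weight e)" if "C \<noteq> []" "set C \<subseteq> set B" for C
    using that
  proof (induction C)
    case (Cons a C)
    then show ?case using assms(2)[of a] by (cases "C = []") auto
  qed simp
  have div: "(\<Sum>e\<leftarrow>C. entry_weight e / W) = (\<Sum>e\<leftarrow>C. entry_weight e) / W"
    for C :: "entry list" and W :: real
    by (induction C) (auto simp: add_divide_distrib)
  have "(\<Sum>e\<leftarrow>B. entry_weight e) \<noteq> 0" using pos[of B] assms(1) by simp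
  then have "(\<Sum>x\<leftarrow>B. entry_weight x / (\<Sum>e\<leftarrow>B. entry_weight e)) = 1" by (simp add: div)
  then show ?thesis
    using pos[of B] assms by (auto intro!: pmf_of_list_wfI divide_nonneg_nonneg less_imp_le simp: o_def)
qed

text \<open>\<open>final_choice e c i\<close> is \<open>y\<^sub>i\<close>; the coin \<open>c i\<close> says whether \<open>e\<^sub>i\<close> is preferred to \<open>y\<^bsub>i-1\<^esub>\<close>.\<close>

primrec final_choice :: "(nat \<Rightarrow> nat) \<Rightarrow> (nat \<Rightarrow> bool) \<Rightarrow> nat \<Rightarrow> nat" where
  "final_choice e c 0 = e 0"
| "final_choice e c (Suc i) = (if c (Suc i) then e (Suc i) else final_choice e c i)"

text \<open>
  Multiplicative weights are used in exponential form: an option with loss \<open>x\<close> has its weight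
  multiplied by \<open>exp (- \<eta> * x)\<close>. (The learning rates may exceed 1, so the factor \<open>1 - \<eta> * x\<close> could
  be negative.)
\<close>

definition bucket_rate :: "params \<Rightarrow> nat \<Rightarrow> entry list \<Rightarrow> real" where
  "bucket_rate p i B = sqrt (ln (real (length B)) / real (period p i))"

definition mix_rate :: "params \<Rightarrow> nat \<Rightarrow> real" where
  "mix_rate p i = sqrt (2 / real (period p i))"

definition observe ::
  "params \<Rightarrow> (nat \<Rightarrow> real) \<Rightarrow> (nat \<Rightarrow> nat) \<Rightarrow> (nat \<Rightarrow> bool) \<Rightarrow> state \<Rightarrow> state" where
  "observe p lt e c s =
     \<lparr>bucket = (\<lambda>i. map (\<lambda>x. x\<lparr>acc_loss := acc_loss x + lt (expert x),
                               entry_weight := entry_weight x *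
                                 exp (- bucket_rate p i (bucket s i) * lt (expert x))\<rparr>)
                         (bucket s i)),
      mix_weights = (\<lambda>i. (fst (mix_weights s i) * exp (- mix_rate p i * lt (e i)),
                          snd (mix_weights s i) *
                            exp (- mix_rate p i * lt (final_choice e c (i - 1)))))\<rparr>"

text \<open>
  All draws of a day are independent. The between-level MWU of level \<open>i\<close> is charged the losses of the
  two experts \<open>e\<^sub>i\<close> and \<open>y\<^bsub>i-1\<^esub>\<close> actually drawn; the between-level weights of level 0 play no role.
\<close>

definition day_step :: "params \<Rightarrow> (nat \<Rightarrow> real) \<Rightarrow> state \<Rightarrow> (nat \<times> state) pmf" where
  "day_step p lt s =
     do {
       e \<leftarrow> Pi_pmf {..<levels p} 0 (\<lambda>i. draw_expert (bucket s i));
       c \<leftarrow> Pi_pmf {1..<levels p} False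
              (\<lambda>i. bernoulli_pmf (fst (mix_weights s i) /
                                    (fst (mix_weights s i) + snd (mix_weights s i))));
       return_pmf (final_choice e c (levels p - 1), observe p lt e c s)
     }"


subsection \<open>The algorithm\<close>

definition init_state :: state where
  "init_state = \<lparr>bucket = (\<lambda>_. []), mix_weights = (\<lambda>_. (1, 1))\<rparr>"

primrec run :: "params \<Rightarrow> (nat \<Rightarrow> nat \<Rightarrow> real) \<Rightarrow> nat \<Rightarrow> (nat list \<times> state) pmf" where
  "run p l 0 = return_pmf ([], init_state)"
| "run p l (Suc t) =
     do {
       (plays, s) \<leftarrow> run p l t;
       s' \<leftarrow> update_step p t s;
       (x, s'') \<leftarrow> day_step p (l t) s';
       return_pmf (plays @ [x], s'')
     }"

definition plays :: "params \<Rightarrow> (nat \<Rightarrow> nat \<Rightarrow> real) \<Rightarrow> nat \<Rightarrow> nat list pmf" where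
  "plays p l T = map_pmf fst (run p l T)"


subsection \<open>Parameter range\<close>

text \<open>
  \<open>n\<close> and \<open>T\<close> are polynomially related with exponent \<open>d\<close>. A space parameter above \<open>n\<close> would ask for
  regret below \<open>sqrt T\<close>, which no algorithm attains.
\<close>

definition admissible :: "nat \<Rightarrow> real \<Rightarrow> nat \<Rightarrow> nat \<Rightarrow> nat \<Rightarrow> bool" where
  "admissible d C T n m \<longleftrightarrow>
     n \<le> T ^ d \<and> T \<le> n ^ d \<and> 1 \<le> m \<and> m \<le> n \<and> real T \<ge> C * (real n / real m)"

text \<open>
  The divisibility chain \<open>T\<^sub>0 | \<dots> | T\<^sub>k\<close> with \<open>T\<^sub>k = T\<close> can only be fine enough if \<open>T\<close> has enough
  divisors (for prime \<open>T\<close> the only chain is \<open>1, T\<close>). The horizon is therefore exactly \<open>T\<close> whenever the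
  prime factors of \<open>T\<close> are bounded by a constant \<open>b\<close> (for instance if \<open>T\<close> is a power of two). For
  the remaining \<open>T\<close> it may be rounded up by less than a factor 2, the algorithm being stopped after
  \<open>T\<close> days.
\<close>

definition horizon_for :: "nat \<Rightarrow> nat \<Rightarrow> nat \<Rightarrow> bool" where
  "horizon_for b T H \<longleftrightarrow>
     T \<le> H \<and> H < 2 * T \<and> ((\<forall>q. prime q \<and> q dvd T \<longrightarrow> q \<le> b) \<longrightarrow> H = T)"

end

theory Submission
  imports Defs
begin

text \<open>
  Take \<open>T\<^sub>0 = 1\<close>, bounded ratios \<open>T\<^bsub>i+1\<^esub> / T\<^sub>i\<close> and \<open>T\<^bsub>k-1\<^esub> \<approx> T m / n\<close>. Fix the best expert \<open>i*\<close>. Call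
  the window of level \<open>i\<close> starting at \<open>u\<close> covered if some entry present in \<open>B\<^sub>i\<close> stays there until a time
  \<open>s > u\<close> (the end, or a time at which it could evict an entry of time \<open>u\<close>) and loses at most \<open>1 + \<epsilon>\<close>
  times as much as \<open>i*\<close> between \<open>u\<close> and \<open>s\<close>. Because of forwarding, that entry is available in ever
  higher buckets as \<open>s\<close> is approached. Hence the days can be cut into windows, each with an entry to compare
  with, such that all higher windows around it are uncovered; a day for which no level is covered is
  given up.

  Whether an entry is evicted depends only on entries that arrived earlier. If a sample leaves the window
  uncovered, then replacing any one of the \<open>m\<close> sampled experts by \<open>i*\<close> yields an entry of \<open>i*\<close> that is
  never evicted, after which every window of the level is covered. So a new permanent entry is at least
  \<open>m / n\<close> times as likely as an uncovered window, and each level has only \<open>O((n / m) log T)\<close> uncovered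
  windows with high probability.

  Multiplicative weights with learning rate \<open>\<eta>\<close> satisfy a high probability regret bound directly,
  since \<open>exp(\<eta> \<cdot> loss of the draws - \<eta>\<^sup>2 t / 2)\<close> times the total weight is a supermartingale.
  A window of level \<open>i\<close> thus costs \<open>sqrt(T\<^sub>i)\<close> up to logarithms, the top level \<open>T / sqrt(T\<^bsub>k-1\<^esub>)\<close> in total and
  the lower levels \<open>(n / m) sqrt(T\<^bsub>k-1\<^esub>)\<close>; both are of the order of \<open>sqrt(T n / m)\<close>.
\<close>

subsection \<open>Chains of divisors\<close>

text \<open>The losses are fixed in advance, so the contents of the buckets depend on the sampled
  experts alone and never on the draws. The comparison across levels is pathwise, with the losses
  realised by the draws, since these drive the between-level weights. The uncovered windows of a
  level are not independent events. They are counted by the potential \<open>rho ^ (N - X)\<close>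
  with \<open>rho = n / (n + m) = 1 / (1 + m / n)\<close>: an uncovered window multiplies it by
  \<open>1 + m / n\<close>, a permanent entry of \<open>i*\<close> sends it to 0, and the resampling
  argument makes these two effects balance in expectation. Bucket sizes are bounded only crudely, by
  \<open>m * T ^ k\<close>. Every period is at least twice the previous one, so
  \<open>k = O(log T)\<close> and the logarithm of this size is \<open>O(log(T)^2)\<close>, which is
  affordable. The final power \<open>ln T ^ 4\<close> has two factors from the width
  \<open>R\<close> of the multiplicative weights bounds, one from the number \<open>N\<close> of
  uncovered windows of a level and one from the number of levels.\<close>

text \<open>One prime factor is split off at a time, and the chain of the cofactor is extended by
  \<open>H\<close>; the last ratio is that prime.\<close>

lemma smooth_divisor_chain:
  fixes H B :: nat
  assumes "0 < H" "\<And>q. prime q \<Longrightarrow> q dvd H \<Longrightarrow> q \<le> B"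
  shows "\<exists>r D. D 0 = 1 \<and> D r = H \<and>
           (\<forall>i<r. D i < D (Suc i) \<and> D i dvd D (Suc i) \<and> D (Suc i) \<le> B * D i)"
  using assms
proof (induction H rule: less_induct)
  case (less H)
  show ?case
  proof (cases "H = 1")
    case True
    then show ?thesis by (intro exI[of _ 0] exI[of _ "\<lambda>_. 1"]) simp
  next
    case False
    then obtain q where q: "prime q" "q dvd H"
      using prime_factor_nat by blast
    then obtain G where G: "H = q * G" by auto
    have q1: "1 < q" using q prime_gt_1_nat by blast
    have G0: "0 < G" using less.prems(1) G by (cases G) auto
    have "G < H" using G q1 G0 by simp
    moreover have "q' \<le> B" if "prime q'" "q' dvd G" for q'
      using less.prems(2)[of q'] that G by simp
    ultimately obtain r D where D: "D 0 = 1" "D r = G"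
      "\<forall>i<r. D i < D (Suc i) \<and> D i dvd D (Suc i) \<and> D (Suc i) \<le> B * D i"
      using less.IH[of G] G0 by blast
    have "q \<le> B" using less.prems(2) q by blast
    then have step: "G < H" "G dvd H" "H \<le> B * G"
      using \<open>G < H\<close> G by auto
    show ?thesis
      using D step
      by (intro exI[of _ "Suc r"] exI[of _ "\<lambda>i. if i \<le> r then D i else H"])
         (auto simp: less_Suc_eq)
  qed
qed

text \<open>A non-smooth \<open>T\<close> is rounded up to the next power of two; minimality of the
  exponent keeps it below \<open>2 * T\<close>. The bound is \<open>max b 2\<close> because that
  power has the prime factor 2 even if \<open>b < 2\<close>.\<close>

lemma ex_smooth_horizon:
  fixes T b :: nat
  assumes "0 < T"
  shows "\<exists>H. horizon_for b T H \<and> (\<forall>q. prime q \<longrightarrow> q dvd H \<longrightarrow> q \<le> max b 2)"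
proof (cases "\<forall>q. prime q \<and> q dvd T \<longrightarrow> q \<le> b")
  case True
  then have "horizon_for b T T" using assms by (auto simp: horizon_for_def)
  then show ?thesis using True by (intro exI[of _ T]) (auto simp: max_def)
next
  case False
  have "T \<noteq> 1" using False by auto
  define e where "e = (LEAST e. T \<le> 2 ^ e)"
  have "T \<le> 2 ^ T" by (simp add: less_imp_le)
  then have e: "T \<le> 2 ^ e" unfolding e_def by (rule LeastI)
  have "e \<noteq> 0" using e assms \<open>T \<noteq> 1\<close> by (cases e) auto
  then obtain f where f: "e = Suc f" by (cases e) auto
  have "\<not> T \<le> 2 ^ f" using not_less_Least[of f "\<lambda>e. T \<le> 2 ^ e"] f unfolding e_def by simp
  then have "2 ^ e < 2 * T" using f by simp
  then have "horizon_for b T (2 ^ e)" using e False by (auto simp: horizon_for_def)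
  moreover have "q \<le> max b 2" if "prime q" "q dvd 2 ^ e" for q :: nat
  proof -
    have "q dvd 2" using that prime_dvd_power by blast
    then have "q \<le> 2" by (simp add: dvd_imp_le)
    then show ?thesis by simp
  qed
  ultimately show ?thesis by blast
qed

text \<open>The chain of divisors is cut at the last period \<open>D j\<close> with
  \<open>D j * n \<le> T * m\<close> and then jumps to the horizon. Hence ratios are bounded only
  between levels below \<open>k\<close>; the last ratio, about \<open>n / m\<close>, is the number
  of windows of the top bucket.\<close>

lemma ex_periods:
  fixes T n m b :: nat
  assumes "2 \<le> T" "n \<le> T * m" "1 \<le> m" "m \<le> n"
  shows "\<exists>k Ts. valid_periods k Ts \<and> Ts 0 = 1 \<and> horizon_for b T (Ts k) \<and>
           (\<forall>i. Suc i < k \<longrightarrow> Ts (Suc i) \<le> max b 2 * Ts i) \<and>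
           Ts (k - 1) * n \<le> T * m \<and> T * m \<le> max b 2 * n * Ts (k - 1)"
proof -
  obtain H where H: "horizon_for b T H" "\<forall>q. prime q \<longrightarrow> q dvd H \<longrightarrow> q \<le> max b 2"
    using ex_smooth_horizon[of T b] assms by auto
  have TH: "T \<le> H" using H by (simp add: horizon_for_def)
  obtain r D where D: "D 0 = (1::nat)" "D r = H"
    "\<forall>i<r. D i < D (Suc i) \<and> D i dvd D (Suc i) \<and> D (Suc i) \<le> max b 2 * D i"
    using smooth_divisor_chain[of H "max b 2"] H TH assms by auto
  have r: "0 < r" using D TH assms by (cases r) auto
  \<comment> \<open>The condition \<open>j < r\<close> keeps the horizon itself out, so that it
    remains available as \<open>T\<^sub>k\<close>; 0 is a member because
    \<open>n \<le> T * m\<close>.\<close>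
  let ?J = "{j. j < r \<and> D j * n \<le> T * m}"
  define j where "j = Max ?J"
  have "0 \<in> ?J" using r D assms by simp
  then have "j \<in> ?J" unfolding j_def by (intro Max_in) auto
  then have j: "j < r" "D j * n \<le> T * m" by auto
  \<comment> \<open>Either the next period violates the cut by maximality of \<open>j\<close>, or it
    is already the horizon, which is at least \<open>T\<close>, and then \<open>m \<le> n\<close>
    suffices.\<close>
  have upper: "T * m \<le> n * D (Suc j)"
  proof (cases "Suc j < r")
    case True
    have "Suc j \<notin> ?J"
    proof
      assume "Suc j \<in> ?J"
      then have "Suc j \<le> j" unfolding j_def by (intro Max_ge) auto
      then show False by simp
    qed
    then show ?thesis using True by (simp add: mult.commute)
  next
    case False
    then have "D (Suc j) = H" using j D by (metis Suc_lessI)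
    then show ?thesis using TH assms by (simp add: mult.commute mult_mono)
  qed
  have "D (Suc j) \<le> max b 2 * D j" using D j by blast
  then have "n * D (Suc j) \<le> n * (max b 2 * D j)" by (rule mult_le_mono2)
  with upper have "T * m \<le> n * (max b 2 * D j)" by (rule le_trans)
  then have low: "T * m \<le> max b 2 * n * D j" by (simp only: mult.assoc mult.left_commute)
  have mono: "D i < D i' \<and> D i dvd D i'" if "i < i'" "i' \<le> r" for i i'
    using that
  proof (induction i')
    case (Suc i')
    have "D i' < D (Suc i') \<and> D i' dvd D (Suc i')" using D(3) Suc.prems by simp
    then show ?case using Suc by (cases "i = i'") (auto intro: dvd_trans)
  qed simp
  define Ts where "Ts = (\<lambda>i. if i \<le> j then D i else H)"
  have Tsj: "Ts i = D i" if "i \<le> j" for i using that by (simp add: Ts_def)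
  have "Ts i < Ts (Suc i) \<and> Ts i dvd Ts (Suc i)" if "i < Suc j" for i
    using that D(2) D(3) j(1) mono[of j r] by (cases "i = j") (auto simp: Ts_def)
  then have v: "valid_periods (Suc j) Ts" using D(1) by (simp add: valid_periods_def Ts_def)
  show ?thesis
  proof (intro exI conjI)
    show "valid_periods (Suc j) Ts" by (rule v)
    show "Ts 0 = 1" using D(1) by (simp add: Ts_def)
    show "horizon_for b T (Ts (Suc j))" using H(1) by (simp add: Ts_def)
    show "\<forall>i. Suc i < Suc j \<longrightarrow> Ts (Suc i) \<le> max b 2 * Ts i"
      using D(3) j(1) by (simp add: Ts_def)
    show "Ts (Suc j - 1) * n \<le> T * m" using j(2) by (simp add: Ts_def)
    show "T * m \<le> max b 2 * n * Ts (Suc j - 1)" using low by (simp add: Ts_def)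
  qed
qed

subsection \<open>Covering the days\<close>

locale period_chain =
  fixes p :: params and T :: nat
  assumes valid_periods: "valid_periods (levels p) (period p)"
    and period_0: "period p 0 = 1"
    and horizon: "T \<le> period p (levels p)"
begin

abbreviation "k \<equiv> levels p"
abbreviation "P \<equiv> period p"

definition wstart :: "nat \<Rightarrow> nat \<Rightarrow> nat" where
  "wstart j t = t div P j * P j"

text \<open>The cut at \<open>T\<close> matters because the horizon \<open>P k\<close> may exceed
  \<open>T\<close>; the last window of a level can be incomplete.\<close>

definition window :: "nat \<Rightarrow> nat \<Rightarrow> nat set" where
  "window j w = {t. w \<le> t \<and> t < w + P j \<and> t < T}"

lemma levels_pos: "1 \<le> k"
  using valid_periods by (simp add: valid_periods_def)

lemma period_dvd_mono: "i \<le> j \<Longrightarrow> j \<le> k \<Longrightarrow> P i dvd P j"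
proof (induction j)
  case (Suc j)
  then show ?case
    using valid_periods by (cases "i = Suc j") (auto simp: valid_periods_def intro: dvd_trans)
qed simp

lemma period_pos: "j \<le> k \<Longrightarrow> 0 < P j"
proof (induction j)
  case 0
  then show ?case using period_0 by simp
next
  case (Suc j)
  then have "P j < P (Suc j)" using valid_periods by (simp add: valid_periods_def)
  then show ?case by simp
qed

lemma top_level_less: "top_level p t < k" and period_top_level_dvd: "P (top_level p t) dvd t"
proof -
  have "0 \<in> {i. i < k \<and> P i dvd t}" using levels_pos period_0 by simp
  then have "top_level p t \<in> {i. i < k \<and> P i dvd t}"
    unfolding top_level_def by (intro Max_in) auto
  then show "top_level p t < k" "P (top_level p t) dvd t" by auto
qed

text \<open>As the periods divide one another, the levels updated at a given time form an initial
  segment.\<close>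

lemma le_top_level_iff: "i < k \<Longrightarrow> i \<le> top_level p t \<longleftrightarrow> P i dvd t"
proof
  assume "i < k" "P i dvd t"
  then show "i \<le> top_level p t" unfolding top_level_def by (intro Max_ge) auto
next
  assume "i < k" "i \<le> top_level p t"
  then show "P i dvd t"
    using period_dvd_mono[of i "top_level p t"] top_level_less[of t] period_top_level_dvd[of t]
    by (auto intro: dvd_trans)
qed

lemma epoch_start_ge: "q \<le> t \<Longrightarrow> P (Suc (top_level p t)) dvd q \<Longrightarrow> q \<le> epoch_start p t"
  unfolding epoch_start_def Let_def by (intro Max_ge) (auto intro: finite_subset[of _ "{..t}"])

lemma wstart_le: "wstart j t \<le> t"
  by (simp add: wstart_def)

lemma less_wstart_add: "j \<le> k \<Longrightarrow> t < wstart j t + P j"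
  using period_pos[of j] by (simp add: wstart_def) (metis add.commute dividend_less_div_times)

lemma dvd_wstart: "P j dvd wstart j t"
  by (simp add: wstart_def)

lemma wstart_eqI:
  assumes "P j dvd w" "w \<le> t" "t < w + P j"
  shows "wstart j t = w"
proof -
  obtain q where q: "w = P j * q" using assms(1) by auto
  have "P j \<noteq> 0" using assms by auto
  then have "t div P j = q" using assms q by (intro div_nat_eqI) auto
  then show ?thesis using q by (simp add: wstart_def mult.commute)
qed

lemma wstart_eq_self_iff: "j \<le> k \<Longrightarrow> wstart j u = u \<longleftrightarrow> P j dvd u"
  unfolding wstart_def by (metis dvd_div_mult_self dvd_triv_right)

lemma dvd_gap:
  assumes "P j dvd w" "P j dvd s" "w < s"
  shows "w + P j \<le> s"
proof -
  have "P j dvd s - w" using assms by (simp add: dvd_diff_nat)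
  then have "P j \<le> s - w" using assms by (intro dvd_imp_le) auto
  then show ?thesis using assms by simp
qed

text \<open>Windows are nested: with \<open>P j' = P j * q\<close>, the quotient
  \<open>t div P j'\<close> is a function of \<open>t div P j\<close>.\<close>

lemma wstart_coarsen:
  assumes "wstart j t = wstart j t'" "j \<le> j'" "j' \<le> k"
  shows "wstart j' t = wstart j' t'"
proof -
  have pj: "0 < P j" using assms by (intro period_pos) auto
  obtain q where q: "P j' = P j * q" using period_dvd_mono[OF assms(2,3)] by auto
  have "t div P j = t' div P j" using assms(1) pj by (simp add: wstart_def)
  then have "t div P j' = t' div P j'" unfolding q div_mult2_eq by simp
  then show ?thesis by (simp add: wstart_def)
qed

lemma mem_window_iff:
  assumes "P j dvd w" "j \<le> k"
  shows "t \<in> window j w \<longleftrightarrow> t < T \<and> wstart j t = w"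
  using assms wstart_eqI[of j w t] wstart_le[of j t] less_wstart_add[of j t]
  by (auto simp: window_def)

end

text \<open>
  \<open>X j w\<close> stands for the experts that are in bucket \<open>j\<close> during the window of level \<open>j\<close> that starts
  at \<open>w\<close>. An expert that sits in bucket \<open>i\<close> from \<open>u\<close> to \<open>s\<close> is forwarded to every higher bucket
  updated in between, hence the two quantified conditions in \<open>covers\<close>.
\<close>

locale covering = period_chain +
  fixes X :: "nat \<Rightarrow> nat \<Rightarrow> nat set" and l :: "nat \<Rightarrow> nat \<Rightarrow> real"
    and best :: nat and \<epsilon> :: real
begin

definition covers :: "nat \<Rightarrow> nat \<Rightarrow> nat \<Rightarrow> nat \<Rightarrow> bool" where
  "covers i u s x \<longleftrightarrow>
     u < s \<and> s \<le> T \<and> (s = T \<or> P i dvd s \<and> epoch_start p s \<le> u) \<and>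
     (\<forall>w. u \<le> w \<and> w < s \<and> P i dvd w \<longrightarrow> x \<in> X i w) \<and>
     (\<forall>j w. i < j \<and> j < k \<and> u < w \<and> w < s \<and> P j dvd w \<longrightarrow> x \<in> X j w) \<and>
     (\<Sum>t=u..<s. l t x) \<le> (1 + \<epsilon>) * (\<Sum>t=u..<s. l t best)"

definition uncovered :: "nat \<Rightarrow> nat \<Rightarrow> bool" where
  "uncovered i u \<longleftrightarrow> \<not> (\<exists>s x. covers i u s x)"

text \<open>
  An assignment of days before \<open>u\<close>: \<open>lev t = Suc j\<close> says that day \<open>t\<close> is charged to bucket \<open>j\<close> and
  its expert \<open>cmp t\<close>, \<open>lev t = 0\<close> that it is charged its full loss.
\<close>

definition assignment :: "nat \<Rightarrow> (nat \<Rightarrow> nat) \<Rightarrow> (nat \<Rightarrow> nat) \<Rightarrow> bool" where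
  "assignment u lev cmp \<longleftrightarrow>
     (\<Sum>t\<in>{t. t < u \<and> 0 < lev t}. l t (cmp t)) \<le> (1 + \<epsilon>) * (\<Sum>t<u. l t best) \<and>
     (\<forall>t<u. lev t \<le> k \<and> (\<forall>j. lev t \<le> j \<and> j < k \<longrightarrow> uncovered j (wstart j t))) \<and>
     (\<forall>t j. t < u \<and> lev t = Suc j \<longrightarrow> cmp t \<in> X j (wstart j t) \<and>
        (\<forall>t'<T. wstart j t' = wstart j t \<longrightarrow> t' < u \<and> lev t' = lev t \<and> cmp t' = cmp t))"

lemma assignmentD:
  assumes "assignment u lev cmp"
  shows "(\<Sum>t\<in>{t. t < u \<and> 0 < lev t}. l t (cmp t)) \<le> (1 + \<epsilon>) * (\<Sum>t<u. l t best)"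
    and "t < u \<Longrightarrow> lev t \<le> k"
    and "t < u \<Longrightarrow> lev t \<le> j \<Longrightarrow> j < k \<Longrightarrow> uncovered j (wstart j t)"
    and "t < u \<Longrightarrow> lev t = Suc j \<Longrightarrow> cmp t \<in> X j (wstart j t)"
    and "t < u \<Longrightarrow> lev t = Suc j \<Longrightarrow> t' < T \<Longrightarrow> wstart j t' = wstart j t \<Longrightarrow>
         t' < u \<and> lev t' = lev t \<and> cmp t' = cmp t"
  using assms unfolding assignment_def by blast+

text \<open>Invariant of the next day \<open>u\<close> to be assigned. Windows that opened strictly
  before \<open>u\<close> and still contain it can no longer be given a comparator as a whole, so
  they must be known to be uncovered. Vacuous at the end, \<open>u = T\<close>.\<close>

definition pointer :: "nat \<Rightarrow> bool" where
  "pointer u \<longleftrightarrow> (u < T \<longrightarrow> (\<forall>j<k. \<not> P j dvd u \<longrightarrow> uncovered j (wstart j u)))"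

text \<open>The entry \<open>x\<close> covering the highest possible level \<open>i\<close> serves
  as comparator for all days from \<open>u\<close> to \<open>s\<close>. Each of these days is
  charged to the highest bucket that \<open>x\<close> has reached by forwarding, so only complete
  windows are used, and the windows above them are those that already contained
  \<open>u\<close>.\<close>

lemma assignment_step_cover:
  assumes a: "assignment u lev cmp" and ptr: "pointer u" and uT: "u < T"
    and i: "i < k" "P i dvd u" and cov: "covers i u s x"
    and top: "\<And>j. i < j \<Longrightarrow> j < k \<Longrightarrow> P j dvd u \<Longrightarrow> uncovered j u"
  shows "\<exists>lev' cmp'. assignment s lev' cmp' \<and> pointer s"
proof -
  have us: "u < s" and sT: "s \<le> T" and fin: "s = T \<or> P i dvd s \<and> epoch_start p s \<le> u"
    and Xi: "\<And>w. u \<le> w \<Longrightarrow> w < s \<Longrightarrow> P i dvd w \<Longrightarrow> x \<in> X i w"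
    and Xj: "\<And>j w. i < j \<Longrightarrow> j < k \<Longrightarrow> u < w \<Longrightarrow> w < s \<Longrightarrow> P j dvd w \<Longrightarrow> x \<in> X j w"
    and loss: "(\<Sum>t=u..<s. l t x) \<le> (1 + \<epsilon>) * (\<Sum>t=u..<s. l t best)"
    using cov by (auto simp: covers_def)
  \<comment> \<open>This is what the epoch condition in \<open>covers\<close> is for: if
    \<open>s\<close> were no multiple of \<open>P j\<close>, the epoch of \<open>s\<close> would
    start no earlier than \<open>w\<close>, hence after \<open>u\<close>. So windows of level
    \<open>j\<close> opened after \<open>u\<close> are complete at \<open>s\<close>.\<close>
  have multiple: "P j dvd s" if "s \<noteq> T" "j < k" "P j dvd w" "u < w" "w \<le> s" for j w
  proof (rule ccontr)
    assume "\<not> P j dvd s"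
    then have "top_level p s < j" using le_top_level_iff[of j s] that by auto
    then have "P (Suc (top_level p s)) dvd w"
      using period_dvd_mono[of "Suc (top_level p s)" j] that by (auto intro: dvd_trans)
    then have "w \<le> epoch_start p s" using epoch_start_ge that by blast
    then show False using fin that by auto
  qed
  \<comment> \<open>Above level \<open>i\<close> the window must begin strictly after
    \<open>u\<close>: \<open>x\<close> may have been sampled at \<open>u\<close> and reaches higher
    buckets only at later updates. Level \<open>i\<close> is always available, as
    \<open>P i dvd u\<close>.\<close>
  define S where "S = (\<lambda>t. {j. i \<le> j \<and> j < k \<and> (j = i \<or> u < wstart j t)})"
  define L where "L = (\<lambda>t. Max (S t))"
  have finS: "finite (S t)" for t by (simp add: S_def)
  have L_in: "L t \<in> S t" for t
  proof -
    have "i \<in> S t" using i by (simp add: S_def)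
    then show ?thesis unfolding L_def using finS by (intro Max_in) auto
  qed
  then have L: "i \<le> L t" "L t < k" "L t = i \<or> u < wstart (L t) t" for t
    by (auto simp: S_def)
  have L_max: "wstart j t \<le> u" if "L t < j" "j < k" for j t
  proof (rule ccontr)
    assume "\<not> wstart j t \<le> u"
    then have "j \<in> S t" using that L(1)[of t] by (simp add: S_def)
    then have "j \<le> L t" unfolding L_def using finS by (intro Max_ge)
    then show False using that by simp
  qed
  define lev' where "lev' = (\<lambda>t. if t < u then lev t else Suc (L t))"
  define cmp' where "cmp' = (\<lambda>t. if t < u then cmp t else x)"
  have ws: "u \<le> wstart (L t) t" if "u \<le> t" for t
  proof (cases "L t = i")
    case True
    show ?thesis
    proof (rule ccontr)
      assume "\<not> ?thesis"
      then have "wstart i t + P i \<le> u" using True i by (intro dvd_gap dvd_wstart) auto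
      then show False using less_wstart_add[of i t] i that by simp
    qed
  qed (use L(3)[of t] in auto)
  have "assignment s lev' cmp'"
    unfolding assignment_def
  proof (intro conjI allI impI)
    have eq: "{t. t < s \<and> 0 < lev' t} = {t. t < u \<and> 0 < lev t} \<union> {u..<s}"
      using us by (auto simp: lev'_def)
    have "(\<Sum>t\<in>{t. t < s \<and> 0 < lev' t}. l t (cmp' t)) =
          (\<Sum>t\<in>{t. t < u \<and> 0 < lev t}. l t (cmp' t)) + (\<Sum>t=u..<s. l t (cmp' t))"
      unfolding eq by (intro sum.union_disjoint) auto
    also have "\<dots> = (\<Sum>t\<in>{t. t < u \<and> 0 < lev t}. l t (cmp t)) + (\<Sum>t=u..<s. l t x)"
      by (intro arg_cong2[of _ _ _ _ "(+)"] sum.cong) (auto simp: cmp'_def)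
    also have "\<dots> \<le> (1 + \<epsilon>) * (\<Sum>t<u. l t best) + (1 + \<epsilon>) * (\<Sum>t=u..<s. l t best)"
      using assignmentD(1)[OF a] loss by (rule add_mono)
    also have "\<dots> = (1 + \<epsilon>) * (\<Sum>t<s. l t best)"
      using us sum.atLeastLessThan_concat[of 0 u s "\<lambda>t. l t best"]
      by (simp add: distrib_left[symmetric] lessThan_atLeast0)
    finally show "(\<Sum>t\<in>{t. t < s \<and> 0 < lev' t}. l t (cmp' t)) \<le> (1 + \<epsilon>) * (\<Sum>t<s. l t best)" .
  next
    fix t assume "t < s"
    then show "lev' t \<le> k" using assignmentD(2)[OF a, of t] L(2)[of t] by (auto simp: lev'_def)
  next
    fix t j assume t: "t < s" and j: "lev' t \<le> j \<and> j < k"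
    show "uncovered j (wstart j t)"
    proof (cases "t < u")
      case True
      then show ?thesis using assignmentD(3)[OF a, of t j] j by (simp add: lev'_def)
    next
      case False
      then have Lj: "L t < j" using j by (simp add: lev'_def)
      then have le: "wstart j t \<le> u" using L_max j by blast
      have lt: "t < wstart j t + P j" using j by (intro less_wstart_add) auto
      \<comment> \<open>A window above the chosen level is the one that contains \<open>u\<close>:
        uncovered by maximality of \<open>i\<close> if it begins at \<open>u\<close>, by the pointer
        invariant otherwise.\<close>
      have eq: "wstart j u = wstart j t"
        using le lt False by (intro wstart_eqI dvd_wstart) auto
      show ?thesis
      proof (cases "P j dvd u")
        case True
        then have "wstart j t = u" using eq j wstart_eq_self_iff[of j u] by auto
        then show ?thesis using top[of j] True j Lj L(1)[of t] by auto
      next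
        case False
        then show ?thesis using ptr uT j eq by (auto simp: pointer_def)
      qed
    qed
  next
    fix t j assume t: "t < s \<and> lev' t = Suc j"
    show "cmp' t \<in> X j (wstart j t)"
    proof (cases "t < u")
      case True
      then show ?thesis using assignmentD(4)[OF a, of t j] t by (simp add: lev'_def cmp'_def)
    next
      case False
      then have j: "j = L t" using t by (simp add: lev'_def)
      have w: "u \<le> wstart j t" "wstart j t < s" using ws[of t] False j t wstart_le[of j t] by auto
      show ?thesis
      proof (cases "j = i")
        case True
        then show ?thesis using Xi w dvd_wstart False by (auto simp: cmp'_def)
      next
        case F: False
        then show ?thesis using Xj[of j "wstart j t"] w dvd_wstart False L[of t] j
          by (auto simp: cmp'_def)
      qed
    qed
  next
    fix t j t' assume t: "t < s \<and> lev' t = Suc j" and t': "t' < T" "wstart j t' = wstart j t"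
    have "t' < s \<and> lev' t' = lev' t \<and> cmp' t' = cmp' t"
    proof (cases "t < u")
      case True
      then show ?thesis using assignmentD(5)[OF a, of t j t'] t t' us by (simp add: lev'_def cmp'_def)
    next
      case False
      then have j: "j = L t" using t by (simp add: lev'_def)
      have jk: "j < k" using L j by simp
      have w: "u \<le> wstart j t" "wstart j t < s" using ws[of t] False j t wstart_le[of j t] by auto
      have ut': "u \<le> t'" using w t' wstart_le[of j t'] by simp
      have "t' < s"
      proof (cases "s = T")
        case False
        have "P j dvd s"
          using L[of t] j fin False multiple[of j "wstart j t"] w dvd_wstart by auto
        then have "wstart j t + P j \<le> s" using w by (intro dvd_gap dvd_wstart)
        then show ?thesis using less_wstart_add[of j t'] t' jk by simp
      qed (use t' in simp)
      \<comment> \<open>All coarser windows of two days in the same window coincide, and the maximum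
        defining \<open>L\<close> looks at nothing else.\<close>
      moreover have "L t' = L t"
      proof -
        have eq: "wstart j' t' = wstart j' t" if "j \<le> j'" "j' < k" for j'
          using wstart_coarsen[of j t' t j'] t' that by simp
        have "j \<in> S t'" using L_in[of t] j eq[of j] jk by (auto simp: S_def)
        then have 1: "L t \<le> L t'" unfolding j L_def using finS by (intro Max_ge)
        have "\<not> L t < L t'"
        proof
          assume lt: "L t < L t'"
          then have "u < wstart (L t') t'" using L(3)[of t'] L(1)[of t] by auto
          then have "u < wstart (L t') t" using eq[of "L t'"] lt L(2)[of t'] j by auto
          then show False using L_max[of t "L t'"] lt L(2)[of t'] by simp
        qed
        with 1 show ?thesis by simp
      qed
      ultimately show ?thesis using False ut' by (simp add: lev'_def cmp'_def)
    qed
    then show "t' < s" "lev' t' = lev' t" "cmp' t' = cmp' t" by auto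
  qed
  moreover have "pointer s"
    unfolding pointer_def
  proof (intro allI impI)
    fix j assume sT: "s < T" and j: "j < k" and nd: "\<not> P j dvd s"
    have w: "wstart j s < s" using nd wstart_le[of j s] wstart_eq_self_iff[of j s] j by auto
    have le: "wstart j s \<le> u"
    proof (rule ccontr)
      assume "\<not> wstart j s \<le> u"
      then show False using multiple[of j "wstart j s"] nd w dvd_wstart sT j by auto
    qed
    have eq: "wstart j u = wstart j s"
      using le less_wstart_add[of j s] us j by (intro wstart_eqI dvd_wstart) auto
    show "uncovered j (wstart j s)"
    proof (cases "P j dvd u")
      case True
      then have wu: "wstart j s = u" using eq wstart_eq_self_iff[of j u] j by auto
      have "P i dvd s" using fin sT by auto
      then have "\<not> j \<le> i" using nd period_dvd_mono[of j i] i by (auto intro: dvd_trans)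
      then show ?thesis using top[of j] True j wu by auto
    next
      case False
      then show ?thesis using ptr uT j eq by (auto simp: pointer_def)
    qed
  qed
  ultimately show ?thesis by blast
qed

text \<open>No level covers at \<open>u\<close>, so the day is given up with level 0. The left side
  of the loss bound does not change, and the right side grows by a nonnegative loss of
  \<open>best\<close>.\<close>

lemma assignment_step_skip:
  assumes a: "assignment u lev cmp" and ptr: "pointer u" and uT: "u < T"
    and eps: "0 \<le> \<epsilon>" and nonneg: "0 \<le> l u best"
    and top: "\<And>j. j < k \<Longrightarrow> P j dvd u \<Longrightarrow> uncovered j u"
  shows "\<exists>lev' cmp'. assignment (Suc u) lev' cmp' \<and> pointer (Suc u)"
proof -
  have unc: "uncovered j (wstart j u)" if "j < k" for j
    using top[of j] ptr uT that wstart_eq_self_iff[of j u] by (cases "P j dvd u") (auto simp: pointer_def)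
  define lev' where "lev' = (\<lambda>t. if t < u then lev t else 0)"
  have "assignment (Suc u) lev' cmp"
    unfolding assignment_def
  proof (intro conjI allI impI)
    have eq: "{t. t < Suc u \<and> 0 < lev' t} = {t. t < u \<and> 0 < lev t}"
      by (auto simp: lev'_def)
    have "(\<Sum>t\<in>{t. t < u \<and> 0 < lev t}. l t (cmp t)) \<le> (1 + \<epsilon>) * (\<Sum>t<u. l t best)"
      by (rule assignmentD(1)[OF a])
    also have "\<dots> \<le> (1 + \<epsilon>) * (\<Sum>t<Suc u. l t best)"
      using eps nonneg by (intro mult_left_mono) auto
    finally show "(\<Sum>t\<in>{t. t < Suc u \<and> 0 < lev' t}. l t (cmp t)) \<le> (1 + \<epsilon>) * (\<Sum>t<Suc u. l t best)"
      unfolding eq .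
  next
    fix t assume "t < Suc u"
    then show "lev' t \<le> k" using assignmentD(2)[OF a, of t] by (auto simp: lev'_def)
  next
    fix t j assume t: "t < Suc u" and j: "lev' t \<le> j \<and> j < k"
    show "uncovered j (wstart j t)"
    proof (cases "t < u")
      case True
      then show ?thesis using assignmentD(3)[OF a, of t j] j by (simp add: lev'_def)
    next
      case False
      then have "t = u" using t by simp
      then show ?thesis using unc j by simp
    qed
  next
    fix t j assume "t < Suc u \<and> lev' t = Suc j"
    then have t: "t < u" "lev t = Suc j" by (auto simp: lev'_def split: if_splits)
    then show "cmp t \<in> X j (wstart j t)" by (rule assignmentD(4)[OF a])
    fix t' assume t': "t' < T" "wstart j t' = wstart j t"
    have "t' < u \<and> lev t' = lev t \<and> cmp t' = cmp t" by (rule assignmentD(5)[OF a t t'])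
    then show "t' < Suc u" "lev' t' = lev' t" "cmp t' = cmp t" using t by (auto simp: lev'_def)
  qed
  moreover have "pointer (Suc u)"
    unfolding pointer_def
  proof (intro allI impI)
    fix j assume j: "j < k" and nd: "\<not> P j dvd Suc u"
    have "wstart j (Suc u) \<noteq> Suc u" using nd wstart_eq_self_iff[of j "Suc u"] j by auto
    then have "wstart j (Suc u) \<le> u" using wstart_le[of j "Suc u"] by simp
    then have "wstart j u = wstart j (Suc u)"
      using less_wstart_add[of j "Suc u"] j by (intro wstart_eqI dvd_wstart) auto
    then show "uncovered j (wstart j (Suc u))" using unc[OF j] by simp
  qed
  ultimately show ?thesis by blast
qed

text \<open>Greedy scan: use the highest covered level whose window begins at the current day, or
  skip the day if there is none. Every move gains at least one day, so \<open>T\<close> moves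
  suffice.\<close>

lemma ex_assignment:
  assumes eps: "0 \<le> \<epsilon>" and nonneg: "\<And>t. t < T \<Longrightarrow> 0 \<le> l t best"
  shows "\<exists>lev cmp. assignment T lev cmp"
proof -
  have "\<exists>u lev cmp. T - n \<le> u \<and> u \<le> T \<and> assignment u lev cmp \<and> pointer u" if "n \<le> T" for n
    using that
  proof (induction "T - n" arbitrary: n)
    case 0
    have "assignment 0 (\<lambda>_. 0) (\<lambda>_. 0)" "pointer 0" by (auto simp: assignment_def pointer_def)
    with 0 show ?case by (intro exI[of _ 0] exI[of _ "\<lambda>_. 0"]) auto
  next
    case (Suc q)
    have "q = T - Suc n" "Suc n \<le> T" using Suc.hyps(2) by auto
    from Suc.hyps(1)[OF this] obtain u lev cmp where
      u: "T - Suc n \<le> u" "u \<le> T" "assignment u lev cmp" "pointer u" by blast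
    show ?case
    proof (cases "T - n \<le> u")
      case True
      then show ?thesis using u by blast
    next
      case False
      then have uT: "u < T" and less: "u < T - n" by auto
      let ?I = "{i. i < k \<and> P i dvd u \<and> \<not> uncovered i u}"
      show ?thesis
      proof (cases "?I = {}")
        case True
        then have "\<exists>lev' cmp'. assignment (Suc u) lev' cmp' \<and> pointer (Suc u)"
          using u uT eps nonneg by (intro assignment_step_skip[of u lev cmp]) auto
        moreover have "T - n \<le> Suc u" "Suc u \<le> T" using u uT by auto
        ultimately show ?thesis by blast
      next
        case False
        define i where "i = Max ?I"
        have "i \<in> ?I" unfolding i_def using False by (intro Max_in) auto
        then have i: "i < k" "P i dvd u" and "\<not> uncovered i u" by auto
        then obtain s x where cov: "covers i u s x" by (auto simp: uncovered_def)
        have "uncovered j u" if "i < j" "j < k" "P j dvd u" for j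
        proof (rule ccontr)
          assume "\<not> uncovered j u"
          then have "j \<in> ?I" using that by simp
          then have "j \<le> i" unfolding i_def by (intro Max_ge) auto
          then show False using that by simp
        qed
        then have "\<exists>lev' cmp'. assignment s lev' cmp' \<and> pointer s"
          using u uT i cov by (intro assignment_step_cover[of u lev cmp i s x]) auto
        moreover have "T - n \<le> s" "s \<le> T"
          using cov u by (auto simp: covers_def)
        ultimately show ?thesis by blast
      qed
    qed
  qed
  from this[of 0] obtain u lev cmp where "T \<le> u" "u \<le> T" "assignment u lev cmp" by auto
  then show ?thesis by auto
qed

end

section \<open>Summing the regret over the windows of an assignment\<close>

lemma (in period_chain) sum_window:
  fixes g :: "nat \<Rightarrow> real"
  assumes "P (Suc i) dvd w" "Suc i \<le> k"
  shows "(\<Sum>t\<in>window (Suc i) w. g t) =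
         (\<Sum>w'\<in>{w'\<in>window (Suc i) w. P i dvd w'}. \<Sum>t\<in>window i w'. g t)"
proof -
  let ?S = "window (Suc i) w" and ?D = "{w'\<in>window (Suc i) w. P i dvd w'}"
  have fin: "finite ?S" by (rule finite_subset[of _ "{..<T}"]) (auto simp: window_def)
  have dvd: "P i dvd w" using assms period_dvd_mono[of i "Suc i"] by (auto intro: dvd_trans)
  have "wstart i t \<in> ?D" if "t \<in> ?S" for t
  proof -
    have t: "w \<le> t" "t < w + P (Suc i)" "t < T" using that by (auto simp: window_def)
    have "w \<le> wstart i t"
    proof (rule ccontr)
      assume "\<not> ?thesis"
      then have "wstart i t + P i \<le> w" using dvd by (intro dvd_gap dvd_wstart) auto
      then show False using less_wstart_add[of i t] t assms by simp
    qed
    then show ?thesis using t wstart_le[of i t] dvd_wstart by (auto simp: window_def)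
  qed
  then have sub: "wstart i ` ?S \<subseteq> ?D" by auto
  have eq: "{t\<in>?S. wstart i t = w'} = window i w'" if "w' \<in> ?D" for w'
  proof -
    have w': "P i dvd w'" "w \<le> w'" "w' < w + P (Suc i)" using that by (auto simp: window_def)
    have "w' + P i \<le> w + P (Suc i)"
      using w' dvd period_dvd_mono[of i "Suc i"] assms by (intro dvd_gap dvd_add) auto
    then have "window i w' \<subseteq> ?S" using w' by (auto simp: window_def)
    moreover have "t \<in> window i w' \<longleftrightarrow> t < T \<and> wstart i t = w'" for t
      using assms(2) by (intro mem_window_iff w') simp
    moreover have "t < T" if "t \<in> ?S" for t using that by (simp add: window_def)
    ultimately show ?thesis by blast
  qed
  have "sum g ?S = (\<Sum>w'\<in>?D. sum g {t\<in>?S. wstart i t = w'})"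
    using fin sub by (intro sum.group[symmetric]) auto
  also have "\<dots> = (\<Sum>w'\<in>?D. sum g (window i w'))"
    using eq by (intro sum.cong) auto
  finally show ?thesis .
qed

lemma (in period_chain) finite_window: "finite (window j w)"
  by (rule finite_subset[of _ "{..<T}"]) (auto simp: window_def)

context covering
begin

text \<open>Only at these windows is the regret of level \<open>j\<close> paid, because the
  comparison descends below a level only inside its uncovered windows. The predicate holds at starts
  of windows only, so summing it over days counts windows.\<close>

definition visited :: "nat \<Rightarrow> nat \<Rightarrow> bool" where
  "visited j w \<longleftrightarrow> P j dvd w \<and> (\<forall>j'. j < j' \<and> j' < k \<longrightarrow> uncovered j' (wstart j' w))"

lemma sum_choice_le:
  fixes Y :: "nat \<Rightarrow> nat \<Rightarrow> real" and R :: real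
  assumes a: "assignment T lev cmp" and R: "0 \<le> R"
    and Y1: "\<And>j t. j < k \<Longrightarrow> t < T \<Longrightarrow> Y j t \<le> 1"
    and mem: "\<And>j w x. j < k \<Longrightarrow> w < T \<Longrightarrow> P j dvd w \<Longrightarrow> x \<in> X j w \<Longrightarrow>
      (\<Sum>t\<in>window j w. Y j t) \<le> (\<Sum>t\<in>window j w. l t x) + R * sqrt (real (P j))"
    and down: "\<And>j w. Suc j < k \<Longrightarrow> w < T \<Longrightarrow> P (Suc j) dvd w \<Longrightarrow>
      (\<Sum>t\<in>window (Suc j) w. Y (Suc j) t) \<le>
      (\<Sum>t\<in>window (Suc j) w. Y j t) + R * sqrt (real (P (Suc j)))"
    and "Suc i \<le> k" "P (Suc i) dvd w" "w < T" "\<And>t. t \<in> window (Suc i) w \<Longrightarrow> lev t \<le> Suc i"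
  shows "(\<Sum>t\<in>window (Suc i) w. Y i t) \<le>
         (\<Sum>t\<in>window (Suc i) w. (if lev t = 0 then 1 else l t (cmp t)) +
            (\<Sum>j\<le>i. R * sqrt (real (P j)) * of_bool (visited j t)))"
  using assms(6-)
proof (induction i arbitrary: w rule: less_induct)
  case (less i)
  note i = less.prems(1) and w = less.prems(2,3) and lev = less.prems(4)
  let ?c = "\<lambda>t. if lev t = 0 then 1 else l t (cmp t)"
  let ?f = "\<lambda>i t. ?c t + (\<Sum>j\<le>i. R * sqrt (real (P j)) * of_bool (visited j t))"
  have sub: "(\<Sum>t\<in>window i w'. Y i t) \<le> (\<Sum>t\<in>window i w'. ?f i t)"
    if "w' \<in> window (Suc i) w" "P i dvd w'" for w'
  proof -
    have dvd: "P i dvd w" using w i period_dvd_mono[of i "Suc i"] by (auto intro: dvd_trans)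
    have w': "w' < T" "w \<le> w'" "w' < w + P (Suc i)" using that by (auto simp: window_def)
    have "w' + P i \<le> w + P (Suc i)"
      using w' dvd that period_dvd_mono[of i "Suc i"] i by (intro dvd_gap dvd_add) auto
    then have ss: "window i w' \<subseteq> window (Suc i) w" using w' by (auto simp: window_def)
    have w'_in: "w' \<in> window i w'" using w' period_pos[of i] i by (auto simp: window_def)
    have "visited i w'"
      unfolding visited_def using that(2) assignmentD(3)[OF a w'(1)] lev[OF that(1)] by auto
    \<comment> \<open>The one-time cost of the window is booked on its first day.\<close>
    then have "R * sqrt (real (P i)) = (\<Sum>t\<in>{w'}. R * sqrt (real (P i)) * of_bool (visited i t))"
      by simp
    also have "\<dots> \<le> (\<Sum>t\<in>window i w'. R * sqrt (real (P i)) * of_bool (visited i t))"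
      using R w'_in by (intro sum_mono2 finite_window) auto
    finally have Ri: "R * sqrt (real (P i)) \<le>
        (\<Sum>t\<in>window i w'. R * sqrt (real (P i)) * of_bool (visited i t))" .
    show ?thesis
    proof (cases "\<exists>t0\<in>window i w'. lev t0 = Suc i")
      case True
      then obtain t0 where t0: "t0 \<in> window i w'" "lev t0 = Suc i" by blast
      have t0': "t0 < T" "wstart i t0 = w'" using t0 mem_window_iff[OF that(2)] i by auto
      have x: "cmp t0 \<in> X i w'" using assignmentD(4)[OF a t0'(1) t0(2)] t0' by simp
      \<comment> \<open>By the last clause of \<open>assignment\<close> a window is charged as a
        whole or not at all, which is what allows a regret bound over a full window.\<close>
      have same: "lev t = Suc i \<and> cmp t = cmp t0" if "t \<in> window i w'" for t
        using assignmentD(5)[OF a t0'(1) t0(2), of t] that mem_window_iff[OF \<open>P i dvd w'\<close>] i t0 t0'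
        by auto
      have "(\<Sum>t\<in>window i w'. Y i t) \<le> (\<Sum>t\<in>window i w'. l t (cmp t0)) + R * sqrt (real (P i))"
        using mem[of i w' "cmp t0"] i w' that x by simp
      also have "(\<Sum>t\<in>window i w'. l t (cmp t0)) = (\<Sum>t\<in>window i w'. ?c t)"
        using same by (intro sum.cong) auto
      also have "(\<Sum>t\<in>window i w'. ?c t) + R * sqrt (real (P i)) \<le>
          (\<Sum>t\<in>window i w'. ?c t) + (\<Sum>t\<in>window i w'. R * sqrt (real (P i)) * of_bool (visited i t))"
        using Ri by simp
      also have "\<dots> = (\<Sum>t\<in>window i w'. ?c t + R * sqrt (real (P i)) * of_bool (visited i t))"
        by (simp add: sum.distrib)
      also have "\<dots> \<le> (\<Sum>t\<in>window i w'. ?f i t)"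
        using R by (intro sum_mono add_left_mono member_le_sum) auto
      finally show ?thesis .
    next
      case False
      have le: "lev t \<le> i" if "t \<in> window i w'" for t
        using False lev[of t] that ss by (metis le_Suc_eq subsetD)
      show ?thesis
      proof (cases i)
        case 0
        have "Y i t \<le> ?f i t" if "t \<in> window i w'" for t
        proof -
          have "lev t = 0" "Y i t \<le> 1" using le[OF that] 0 Y1[of i t] i that by (auto simp: window_def)
          moreover have "0 \<le> (\<Sum>j\<le>i. R * sqrt (real (P j)) * of_bool (visited j t))"
            using R by (intro sum_nonneg) auto
          ultimately show ?thesis by simp
        qed
        then show ?thesis by (intro sum_mono)
      next
        case (Suc i')
        have "(\<Sum>t\<in>window i w'. Y i t) \<le> (\<Sum>t\<in>window i w'. Y i' t) + R * sqrt (real (P i))"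
          using down[of i' w'] Suc i w' that by simp
        also have "(\<Sum>t\<in>window i w'. Y i' t) \<le> (\<Sum>t\<in>window i w'. ?f i' t)"
          using less.IH[of i' w'] Suc that(2) w' le i by simp
        also have "(\<Sum>t\<in>window i w'. ?f i' t) + R * sqrt (real (P i)) \<le>
            (\<Sum>t\<in>window i w'. ?f i' t) +
            (\<Sum>t\<in>window i w'. R * sqrt (real (P i)) * of_bool (visited i t))"
          using Ri by simp
        also have "\<dots> = (\<Sum>t\<in>window i w'. ?f i t)"
          unfolding Suc by (simp add: sum.distrib)
        finally show ?thesis by simp
      qed
    qed
  qed
  have "(\<Sum>t\<in>window (Suc i) w. Y i t) =
      (\<Sum>w'\<in>{w'\<in>window (Suc i) w. P i dvd w'}. \<Sum>t\<in>window i w'. Y i t)"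
    by (rule sum_window[OF w(1) i])
  also have "\<dots> \<le> (\<Sum>w'\<in>{w'\<in>window (Suc i) w. P i dvd w'}. \<Sum>t\<in>window i w'. ?f i t)"
  proof (rule sum_mono)
    fix w' assume "w' \<in> {w'\<in>window (Suc i) w. P i dvd w'}"
    then show "(\<Sum>t\<in>window i w'. Y i t) \<le> (\<Sum>t\<in>window i w'. ?f i t)"
      by (intro sub) simp_all
  qed
  also have "\<dots> = (\<Sum>t\<in>window (Suc i) w. ?f i t)"
    by (rule sum_window[OF w(1) i, symmetric])
  finally show ?case .
qed

text \<open>A visited window below the top lies in an uncovered window of the next level, and that
  one contains at most \<open>B\<close> windows of level \<open>j\<close>; \<open>r\<close> is the
  index inside it.\<close>

lemma card_visited_le:
  assumes B: "P (Suc j) \<le> B * P j" and j: "Suc j < k"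
    and N: "real (card {u. u < T \<and> P (Suc j) dvd u \<and> uncovered (Suc j) u}) \<le> N"
  shows "(\<Sum>t<T. of_bool (visited j t)) \<le> real B * N"
proof -
  let ?U = "{u. u < T \<and> P (Suc j) dvd u \<and> uncovered (Suc j) u}"
  have pos: "0 < P j" using j by (intro period_pos) auto
  have "{t\<in>{..<T}. visited j t} \<subseteq> (\<lambda>(u, r). u + r * P j) ` (?U \<times> {..<B})"
  proof
    fix t assume "t \<in> {t\<in>{..<T}. visited j t}"
    then have t: "t < T" "P j dvd t" and unc: "uncovered (Suc j) (wstart (Suc j) t)"
      using j by (auto simp: visited_def)
    let ?u = "wstart (Suc j) t"
    have u: "?u \<in> ?U" using unc t wstart_le[of "Suc j" t] dvd_wstart by auto
    have "P j dvd ?u"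
      using period_dvd_mono[of j "Suc j"] j dvd_wstart[of "Suc j" t] by (auto intro: dvd_trans)
    then have "P j dvd t - ?u" using t by (simp add: dvd_diff_nat)
    then obtain r where r: "t - ?u = P j * r" by auto
    have "t - ?u < P (Suc j)" using less_wstart_add[of "Suc j" t] wstart_le[of "Suc j" t] j by auto
    then have "P j * r < P (Suc j)" using r by simp
    also have "\<dots> \<le> P j * B" using B by (simp add: mult.commute)
    finally have "r < B" by (metis mult_less_cancel1)
    moreover have "t = ?u + r * P j" using r wstart_le[of "Suc j" t] by (simp add: mult.commute)
    ultimately show "t \<in> (\<lambda>(u, r). u + r * P j) ` (?U \<times> {..<B})" using u by force
  qed
  then have "card {t\<in>{..<T}. visited j t} \<le> card ((\<lambda>(u, r). u + r * P j) ` (?U \<times> {..<B}))"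
    by (intro card_mono finite_imageI) simp_all
  also have "\<dots> \<le> card (?U \<times> {..<B})" by (intro card_image_le) simp
  finally have "card {t\<in>{..<T}. visited j t} \<le> card ?U * B" by simp
  then have "real (card {t\<in>{..<T}. visited j t}) \<le> real (card ?U) * real B"
    by (metis of_nat_le_iff of_nat_mult)
  also have "\<dots> \<le> N * real B" using N by (intro mult_right_mono) auto
  finally show ?thesis by (simp add: mult.commute Int_def)
qed

text \<open>Nothing lies above the top bucket, so all its windows count; the extra 1 is for an
  incomplete last window.\<close>

lemma card_visited_top_le:
  "(\<Sum>t<T. of_bool (visited (k - 1) t)) \<le> real T / real (P (k - 1)) + 1"
proof -
  let ?q = "P (k - 1)"
  have pos: "0 < ?q" by (intro period_pos) auto
  have "{t\<in>{..<T}. visited (k - 1) t} \<subseteq> (\<lambda>r. ?q * r) ` {..T div ?q}"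
  proof
    fix t assume "t \<in> {t\<in>{..<T}. visited (k - 1) t}"
    then have "t = ?q * (t div ?q)" "t div ?q \<le> T div ?q"
      by (simp_all add: visited_def div_le_mono)
    then show "t \<in> (\<lambda>r. ?q * r) ` {..T div ?q}" by blast
  qed
  then have "card {t\<in>{..<T}. visited (k - 1) t} \<le> card ((\<lambda>r. ?q * r) ` {..T div ?q})"
    by (intro card_mono) simp_all
  also have "\<dots> \<le> card {..T div ?q}" by (intro card_image_le) simp
  finally have "card {t\<in>{..<T}. visited (k - 1) t} \<le> card {..T div ?q}" .
  then have "real (card {t\<in>{..<T}. visited (k - 1) t}) \<le> real (T div ?q) + 1" by simp
  also have "\<dots> \<le> real T / real ?q + 1" by (simp add: of_nat_div_le_of_nat)
  finally show ?thesis by (simp add: Int_def)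
qed

theorem sum_choice_total_le:
  fixes Y :: "nat \<Rightarrow> nat \<Rightarrow> real" and R N :: real
  assumes eps: "0 \<le> \<epsilon>" and nonneg: "\<And>t. t < T \<Longrightarrow> 0 \<le> l t best" and R: "0 \<le> R" and T: "0 < T"
    and Y1: "\<And>j t. j < k \<Longrightarrow> t < T \<Longrightarrow> Y j t \<le> 1"
    and mem: "\<And>j w x. j < k \<Longrightarrow> w < T \<Longrightarrow> P j dvd w \<Longrightarrow> x \<in> X j w \<Longrightarrow>
      (\<Sum>t\<in>window j w. Y j t) \<le> (\<Sum>t\<in>window j w. l t x) + R * sqrt (real (P j))"
    and down: "\<And>j w. Suc j < k \<Longrightarrow> w < T \<Longrightarrow> P (Suc j) dvd w \<Longrightarrow>
      (\<Sum>t\<in>window (Suc j) w. Y (Suc j) t) \<le>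
      (\<Sum>t\<in>window (Suc j) w. Y j t) + R * sqrt (real (P (Suc j)))"
    and B: "\<And>j. Suc j < k \<Longrightarrow> P (Suc j) \<le> B * P j"
    and N: "\<And>j. j < k \<Longrightarrow> real (card {u. u < T \<and> P j dvd u \<and> uncovered j u}) \<le> N"
  shows "(\<Sum>t<T. Y (k - 1) t) \<le> (1 + \<epsilon>) * (\<Sum>t<T. l t best) + N +
    R * (\<Sum>j<k - 1. sqrt (real (P j)) * (real B * N)) +
    R * (sqrt (real (P (k - 1))) * (real T / real (P (k - 1)) + 1))"
proof -
  obtain lev cmp where a: "assignment T lev cmp" using ex_assignment eps nonneg by blast
  let ?c = "\<lambda>t. if lev t = 0 then 1 else l t (cmp t)"
  let ?v = "\<lambda>j t. R * sqrt (real (P j)) * of_bool (visited j t)"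
  have Suck: "Suc (k - 1) = k" using levels_pos by simp
  have w: "window k 0 = {..<T}" using horizon by (auto simp: window_def)
  \<comment> \<open>The recursion starts from a single window of level \<open>k\<close>, which
    contains all days since \<open>T \<le> P k\<close>.\<close>
  have "(\<Sum>t\<in>window (Suc (k - 1)) 0. Y (k - 1) t) \<le>
      (\<Sum>t\<in>window (Suc (k - 1)) 0. ?c t + (\<Sum>j\<le>k - 1. ?v j t))"
  proof (rule sum_choice_le[OF a R])
    fix t assume "t \<in> window (Suc (k - 1)) 0"
    then show "lev t \<le> Suc (k - 1)" using assignmentD(2)[OF a, of t] Suck by (auto simp: window_def)
  qed (use Y1 mem down T Suck in auto)
  then have "(\<Sum>t<T. Y (k - 1) t) \<le> (\<Sum>t<T. ?c t) + (\<Sum>t<T. \<Sum>j\<le>k - 1. ?v j t)"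
    by (simp only: Suck w sum.distrib)
  moreover have "(\<Sum>t<T. ?c t) \<le> (1 + \<epsilon>) * (\<Sum>t<T. l t best) + N"
  proof -
    have "(\<Sum>t<T. ?c t) = (\<Sum>t<T. (if 0 < lev t then l t (cmp t) else 0)) + (\<Sum>t<T. of_bool (lev t = 0))"
      unfolding sum.distrib[symmetric] by (intro sum.cong) auto
    also have "(\<Sum>t<T. (if 0 < lev t then l t (cmp t) else 0)) = (\<Sum>t\<in>{t. t < T \<and> 0 < lev t}. l t (cmp t))"
      by (simp add: sum.inter_filter[symmetric])
    also have "\<dots> \<le> (1 + \<epsilon>) * (\<Sum>t<T. l t best)" by (rule assignmentD(1)[OF a])
    also have "(\<Sum>t<T. of_bool (lev t = 0)) \<le> N"
    proof -
      \<comment> \<open>Since \<open>P 0 = 1\<close>, each day that was given up is itself an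
        uncovered window of level 0.\<close>
      have "{t\<in>{..<T}. lev t = 0} \<subseteq> {u. u < T \<and> P 0 dvd u \<and> uncovered 0 u}"
      proof
        fix t assume "t \<in> {t\<in>{..<T}. lev t = 0}"
        moreover have "wstart 0 t = t" by (simp add: wstart_def period_0)
        ultimately show "t \<in> {u. u < T \<and> P 0 dvd u \<and> uncovered 0 u}"
          using assignmentD(3)[OF a, of t 0] levels_pos period_0 by auto
      qed
      then have "card {t\<in>{..<T}. lev t = 0} \<le> card {u. u < T \<and> P 0 dvd u \<and> uncovered 0 u}"
        by (intro card_mono) auto
      then have "real (card {t\<in>{..<T}. lev t = 0}) \<le> N" using N[of 0] levels_pos by simp
      then show ?thesis by (simp add: Int_def)
    qed
    finally show ?thesis by simp
  qed
  moreover have "(\<Sum>t<T. \<Sum>j\<le>k - 1. ?v j t) \<le>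
    R * (\<Sum>j<k - 1. sqrt (real (P j)) * (real B * N)) +
    R * (sqrt (real (P (k - 1))) * (real T / real (P (k - 1)) + 1))"
  proof -
    have "(\<Sum>t<T. \<Sum>j\<le>k - 1. ?v j t) = (\<Sum>j\<le>k - 1. \<Sum>t<T. ?v j t)"
      by (rule sum.swap)
    also have "\<dots> = (\<Sum>j\<le>k - 1. R * (sqrt (real (P j)) * (\<Sum>t<T. of_bool (visited j t))))"
      by (intro sum.cong refl) (simp only: sum_distrib_left mult.assoc)
    also have "\<dots> = (\<Sum>j<k - 1. R * (sqrt (real (P j)) * (\<Sum>t<T. of_bool (visited j t)))) +
        R * (sqrt (real (P (k - 1))) * (\<Sum>t<T. of_bool (visited (k - 1) t)))"
      by (simp only: lessThan_Suc_atMost[symmetric] sum.lessThan_Suc)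
    also have "\<dots> \<le> (\<Sum>j<k - 1. R * (sqrt (real (P j)) * (real B * N))) +
        R * (sqrt (real (P (k - 1))) * (real T / real (P (k - 1)) + 1))"
    proof (intro add_mono sum_mono mult_left_mono R card_visited_top_le)
      fix j assume "j \<in> {..<k - 1}"
      then show "(\<Sum>t<T. of_bool (visited j t)) \<le> real B * N"
        using B[of j] N[of "Suc j"] by (intro card_visited_le) auto
    qed auto
    finally show ?thesis by (simp add: sum_distrib_left)
  qed
  ultimately show ?thesis by simp
qed

end

subsection \<open>Histories and buckets\<close>

lemma map_nth_replicate_pmf: "i < N \<Longrightarrow> map_pmf (\<lambda>xs. xs ! i) (replicate_pmf N q) = q"
proof (induction N arbitrary: i)
  case (Suc N)
  show ?case
  proof (cases i)
    case 0
    then show ?thesis by (simp add: map_bind_pmf bind_return_pmf')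
  next
    case (Suc i')
    have "map_pmf (\<lambda>xs. xs ! i) (replicate_pmf (Suc N) q) = q \<bind> (\<lambda>_. map_pmf (\<lambda>xs. xs ! i') (replicate_pmf N q))"
      by (simp add: Suc map_pmf_def bind_assoc_pmf bind_return_pmf)
    also have "\<dots> = q" using Suc.IH[of i'] Suc.prems Suc by simp
    finally show ?thesis .
  qed
qed simp

text \<open>
  A history records, for each day, the state after the bucket update and the draws of the day. It
  carries the quantities that the plays alone do not determine.
\<close>

type_synonym history = "(state \<times> (nat \<Rightarrow> nat) \<times> (nat \<Rightarrow> bool)) list"

definition current :: "params \<Rightarrow> (nat \<Rightarrow> nat \<Rightarrow> real) \<Rightarrow> history \<Rightarrow> state" where
  "current p l h =
     (if h = [] then init_state
      else case last h of (s, e, c) \<Rightarrow> observe p (l (length h - 1)) e c s)"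

definition draws :: "params \<Rightarrow> state \<Rightarrow> ((nat \<Rightarrow> nat) \<times> (nat \<Rightarrow> bool)) pmf" where
  "draws p s = pair_pmf
     (Pi_pmf {..<levels p} 0 (\<lambda>i. draw_expert (bucket s i)))
     (Pi_pmf {1..<levels p} False
        (\<lambda>i. bernoulli_pmf (fst (mix_weights s i) / (fst (mix_weights s i) + snd (mix_weights s i)))))"

definition record_day :: "params \<Rightarrow> nat \<Rightarrow> state \<Rightarrow> (state \<times> (nat \<Rightarrow> nat) \<times> (nat \<Rightarrow> bool)) pmf" where
  "record_day p t s = update_step p t s \<bind> (\<lambda>s'. map_pmf (\<lambda>ec. (s', ec)) (draws p s'))"

primrec hrun :: "params \<Rightarrow> (nat \<Rightarrow> nat \<Rightarrow> real) \<Rightarrow> nat \<Rightarrow> history pmf" where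
  "hrun p l 0 = return_pmf []"
| "hrun p l (Suc t) = hrun p l t \<bind> (\<lambda>h. map_pmf (\<lambda>r. h @ [r]) (record_day p t (current p l h)))"

definition choice :: "nat \<Rightarrow> state \<times> (nat \<Rightarrow> nat) \<times> (nat \<Rightarrow> bool) \<Rightarrow> nat" where
  "choice i r = final_choice (fst (snd r)) (snd (snd r)) i"

definition is_history :: "params \<Rightarrow> (nat \<Rightarrow> nat \<Rightarrow> real) \<Rightarrow> history \<Rightarrow> bool" where
  "is_history p l h \<longleftrightarrow>
     (\<forall>t<length h. h ! t \<in> set_pmf (record_day p t (current p l (take t h))))"

lemma set_pmf_hrun: "h \<in> set_pmf (hrun p l t) \<Longrightarrow> length h = t \<and> is_history p l h"
proof (induction t arbitrary: h)
  case 0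
  then show ?case by (simp add: is_history_def)
next
  case (Suc t)
  then obtain g r where g: "g \<in> set_pmf (hrun p l t)" and h: "h = g @ [r]"
    and r: "r \<in> set_pmf (record_day p t (current p l g))"
    by auto
  have "length g = t" "is_history p l g" using Suc.IH[OF g] by auto
  then show ?case using h r by (auto simp: is_history_def nth_append less_Suc_eq)
qed

lemma current_snoc:
  "current p l (h @ [r]) = observe p (l (length h)) (fst (snd r)) (snd (snd r)) (fst r)"
  by (simp add: current_def split: prod.split)

text \<open>Transfers probabilities from histories, where all events of the analysis live, back to
  the plays.\<close>

lemma run_conv_hrun:
  "run p l t = map_pmf (\<lambda>h. (map (choice (levels p - 1)) h, current p l h)) (hrun p l t)"
proof (induction t)
  case 0
  then show ?case by (simp add: current_def)
next
  case (Suc t)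
  have day: "day_step p lt s = map_pmf (\<lambda>ec. (choice (levels p - 1) (s, ec), observe p lt (fst ec) (snd ec) s)) (draws p s)"
    for lt s
    by (simp add: day_step_def draws_def pair_pmf_def map_bind_pmf choice_def)
  have "run p l (Suc t) = hrun p l t \<bind> (\<lambda>h. update_step p t (current p l h) \<bind> (\<lambda>s'.
      map_pmf (\<lambda>ec. (map (choice (levels p - 1)) h @ [choice (levels p - 1) (s', ec)],
        observe p (l t) (fst ec) (snd ec) s')) (draws p s')))"
    by (simp add: Suc bind_map_pmf day map_pmf_def bind_assoc_pmf bind_return_pmf)
  also have "\<dots> = map_pmf (\<lambda>h. (map (choice (levels p - 1)) h, current p l h)) (hrun p l (Suc t))"
    unfolding hrun.simps record_day_def map_bind_pmf pmf.map_comp o_def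
    by (intro bind_pmf_cong refl) (auto simp: current_snoc dest!: set_pmf_hrun)
  finally show ?case .
qed

text \<open>An event decided by the first \<open>t\<close> days can be evaluated in the process
  stopped at \<open>t\<close>; this is applied at the ends of windows.\<close>

lemma map_take_hrun: "t \<le> t' \<Longrightarrow> map_pmf (take t) (hrun p l t') = hrun p l t"
proof (induction t')
  case (Suc t')
  show ?case
  proof (cases "t = Suc t'")
    case True
    have "map_pmf (take t) (hrun p l t) = map_pmf id (hrun p l t)"
      by (intro map_pmf_cong refl) (use set_pmf_hrun in fastforce)
    then show ?thesis using True by (simp add: pmf.map_id)
  next
    case False
    then have "t \<le> t'" using Suc.prems by simp
    have "map_pmf (take t) (hrun p l (Suc t')) = hrun p l t' \<bind> (\<lambda>h. map_pmf (\<lambda>r. take t (h @ [r])) (record_day p t' (current p l h)))"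
      by (simp add: map_bind_pmf pmf.map_comp o_def)
    also have "\<dots> = hrun p l t' \<bind> (\<lambda>h. return_pmf (take t h))"
      using \<open>t \<le> t'\<close> by (intro bind_pmf_cong refl) (auto dest!: set_pmf_hrun)
    also have "\<dots> = map_pmf (take t) (hrun p l t')" by (simp add: map_pmf_def)
    finally show ?thesis using Suc.IH \<open>t \<le> t'\<close> by simp
  qed
qed simp

section \<open>Bucket contents along a history\<close>

locale algorithm = period_chain p T for p :: params and T :: nat +
  fixes l :: "nat \<Rightarrow> nat \<Rightarrow> real" and best :: nat
  assumes losses: "loss_sequence T (num_experts p) l"
    and slots: "valid_slots (fwd_slot p)" "valid_slots (smp_slot p)"
    and best: "best < num_experts p"
    and space: "1 \<le> space_param p"
    and T2: "2 \<le> T"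
begin

abbreviation "n \<equiv> num_experts p"
abbreviation "m \<equiv> space_param p"

definition L :: "nat \<Rightarrow> nat \<Rightarrow> nat \<Rightarrow> real" where
  "L x u s = (\<Sum>t=u..<s. l t x)"

lemma eps_nonneg: "0 \<le> eps p"
proof -
  have "1 \<le> real (P k)" using horizon T2 by simp
  then show ?thesis by (simp add: eps_def)
qed

lemma L_nonneg: "x < n \<Longrightarrow> s \<le> T \<Longrightarrow> 0 \<le> L x u s"
  unfolding L_def using losses by (intro sum_nonneg) (auto simp: loss_sequence_def)

lemma L_mono: "x < n \<Longrightarrow> s \<le> T \<Longrightarrow> u' \<le> u \<Longrightarrow> L x u s \<le> L x u' s"
  unfolding L_def using losses by (intro sum_mono2) (auto simp: loss_sequence_def)

text \<open>With fixed losses, expert and arrival time determine the accumulated loss. Eviction can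
  thus be studied on these pairs, without weights and list positions.\<close>

definition core :: "entry \<Rightarrow> nat \<times> real" where
  "core e = (expert e, arrival e)"

text \<open>The content just before the bucket update of day \<open>t\<close>; its counterpart
  \<open>post\<close> is the content just after it.\<close>

definition pre :: "history \<Rightarrow> nat \<Rightarrow> nat \<Rightarrow> (nat \<times> real) set" where
  "pre h i t = core ` set (bucket (current p l (take t h)) i)"

definition post :: "history \<Rightarrow> nat \<Rightarrow> nat \<Rightarrow> (nat \<times> real) set" where
  "post h i t = core ` set (bucket (fst (h ! t)) i)"

text \<open>Eviction on cores. Arrival times of entries added at \<open>t\<close> lie in
  \<open>[t, t + 1)\<close>, so the floor recovers the first day whose loss the entry
  accumulates.\<close>

definition kill :: "nat \<Rightarrow> (nat \<times> real) set \<Rightarrow> (nat \<times> real) set" where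
  "kill t A = {y \<in> A. \<not> (real (epoch_start p t) + 1/2 \<le> snd y \<and>
     (\<exists>y'\<in>A. snd y' < snd y \<and>
        L (fst y') (nat \<lfloor>snd y'\<rfloor>) t \<le> (1 + eps p) * L (fst y) (nat \<lfloor>snd y\<rfloor>) t))}"

text \<open>Two time parameters, because an update adds entries before their first loss: losses are
  counted up to \<open>t\<close>, arrivals are bounded by \<open>a\<close>, which is
  \<open>t\<close> before the update and \<open>Suc t\<close> after it.\<close>

definition entry_ok :: "nat \<Rightarrow> nat \<Rightarrow> entry \<Rightarrow> bool" where
  "entry_ok t a e \<longleftrightarrow> 0 \<le> arrival e \<and> arrival e < real a \<and> expert e < n \<and>
     acc_loss e = L (expert e) (nat \<lfloor>arrival e\<rfloor>) t"

lemma core_evict: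
  assumes "\<And>e. e \<in> set B \<Longrightarrow> acc_loss e = L (expert e) (nat \<lfloor>arrival e\<rfloor>) t"
  shows "core ` set (evict p t B) = kill t (core ` set B)"
proof -
  let ?F = "{e \<in> set B. \<not> (real (epoch_start p t) + 1/2 \<le> arrival e \<and>
              (\<exists>e'\<in>set B. dominates (eps p) e' e))}"
  have "core ` set (evict p t B) = core ` ?F"
    by (auto simp: evict_def core_def image_image)
  also have "\<dots> = kill t (core ` set B)"
  proof -
    have "e \<in> ?F \<longleftrightarrow> core e \<in> kill t (core ` set B)" if "e \<in> set B" for e
    proof -
      have "dominates (eps p) e' e \<longleftrightarrow> arrival e' < arrival e \<and>
          L (expert e') (nat \<lfloor>arrival e'\<rfloor>) t \<le> (1 + eps p) * L (expert e) (nat \<lfloor>arrival e\<rfloor>) t"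
        if "e' \<in> set B" for e'
        using assms[OF that] assms[OF \<open>e \<in> set B\<close>] by (simp add: dominates_def)
      then show ?thesis using that by (auto simp: kill_def core_def)
    qed
    moreover have "kill t (core ` set B) \<subseteq> core ` set B" by (auto simp: kill_def)
    ultimately show ?thesis by blast
  qed
  finally show ?thesis .
qed

lemma evict_subset: "e \<in> set (evict p t B) \<Longrightarrow> \<exists>e'\<in>set B. expert e = expert e' \<and>
    arrival e = arrival e' \<and> acc_loss e = acc_loss e'"
  by (auto simp: evict_def)

lemma set_pmf_update_step:
  assumes "s' \<in> set_pmf (update_step p t s)"
  obtains xss where "s' = update_with p t s xss" "length xss = Suc (top_level p t)"
    "\<And>i. i \<le> top_level p t \<Longrightarrow> length (xss ! i) = m \<and> set (xss ! i) \<subseteq> {..<n}"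
proof -
  have n: "{..<n} \<noteq> {}" using best by auto
  have "s' \<in> update_with p t s ` set_pmf (replicate_pmf (Suc (top_level p t)) (replicate_pmf m (pmf_of_set {..<n})))"
    using assms by (simp add: update_step_def period_0 del: replicate_pmf.simps)
  then obtain xss where xss: "s' = update_with p t s xss"
    "xss \<in> set_pmf (replicate_pmf (Suc (top_level p t)) (replicate_pmf m (pmf_of_set {..<n})))" by blast
  then have *: "length xss = Suc (top_level p t)" "\<And>ys. ys \<in> set xss \<Longrightarrow> length ys = m \<and> set ys \<subseteq> {..<n}"
    using n by (auto simp: set_replicate_pmf set_pmf_of_set simp del: replicate_pmf.simps)
  show ?thesis
  proof (rule that[OF xss(1) *(1)])
    fix i assume "i \<le> top_level p t"
    then have "xss ! i \<in> set xss" using *(1) by simp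
    then show "length (xss ! i) = m \<and> set (xss ! i) \<subseteq> {..<n}" by (rule *(2))
  qed
qed

lemma history_record:
  assumes "is_history p l h" "t < length h"
  shows "fst (h ! t) \<in> set_pmf (update_step p t (current p l (take t h)))"
    and "snd (h ! t) \<in> set_pmf (draws p (fst (h ! t)))"
proof -
  have "h ! t \<in> set_pmf (record_day p t (current p l (take t h)))"
    using assms unfolding is_history_def by blast
  then show "fst (h ! t) \<in> set_pmf (update_step p t (current p l (take t h)))"
    "snd (h ! t) \<in> set_pmf (draws p (fst (h ! t)))"
    by (auto simp: record_day_def)
qed

lemma current_take_Suc:
  "t < length h \<Longrightarrow> current p l (take (Suc t) h) =
     observe p (l t) (fst (snd (h ! t))) (snd (snd (h ! t))) (fst (h ! t))"
  by (simp add: take_Suc_conv_app_nth current_snoc)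

lemma pre_Suc: "t < length h \<Longrightarrow> pre h i (Suc t) = post h i t"
  by (simp add: pre_def post_def current_take_Suc observe_def core_def image_image)

text \<open>The part of an updated bucket that is determined before sampling.\<close>

definition base :: "nat \<Rightarrow> state \<Rightarrow> nat \<Rightarrow> (nat \<times> real) set" where
  "base t s i = core ` set (evict p t (bucket s i)) \<union>
     core ` set (forwarded p t i (concat (map (\<lambda>j. evict p t (bucket s j)) [0..<i])))"

definition samples :: "nat \<Rightarrow> nat \<Rightarrow> nat list \<Rightarrow> (nat \<times> real) set" where
  "samples t i xs = (\<lambda>j. (xs ! j, real t + 1/2 + smp_slot p t i (length xs) j)) ` {..<length xs}"

lemma core_sampled: "core ` set (sampled p t i xs) = samples t i xs"
  by (simp add: sampled_def samples_def core_def fresh_entry_def image_image atLeast0LessThan)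

lemma core_update_with:
  "core ` set (bucket (update_with p t s xss) i) =
     (if i \<le> top_level p t then base t s i \<union> samples t i (xss ! i) else core ` set (bucket s i))"
  by (simp add: update_with_def base_def core_sampled[symmetric] image_Un Let_def Un_assoc)

lemma forwarded_entry:
  assumes "e \<in> set (forwarded p t i es)"
  shows "real t \<le> arrival e \<and> arrival e < real t + 1/2 \<and> acc_loss e = 0 \<and>
    entry_weight e = 1 \<and> (\<exists>e'\<in>set es. expert e = expert e')"
proof -
  obtain j where j: "j < length es"
    "e = fresh_entry (expert (es ! j)) (real t + fwd_slot p t i (length es) j)"
    using assms by (auto simp: forwarded_def)
  then have "0 \<le> fwd_slot p t i (length es) j \<and> fwd_slot p t i (length es) j < 1/2"
    using slots(1) by (simp add: valid_slots_def)
  then show ?thesis using j nth_mem[OF j(1)] by (auto simp: fresh_entry_def)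
qed

lemma sampled_entry:
  assumes "e \<in> set (sampled p t i xs)"
  shows "real t + 1/2 \<le> arrival e \<and> arrival e < real t + 1 \<and> acc_loss e = 0 \<and>
    entry_weight e = 1 \<and> expert e \<in> set xs"
proof -
  obtain j where j: "j < length xs"
    "e = fresh_entry (xs ! j) (real t + 1/2 + smp_slot p t i (length xs) j)"
    using assms by (auto simp: sampled_def)
  then have "0 \<le> smp_slot p t i (length xs) j \<and> smp_slot p t i (length xs) j < 1/2"
    using slots(2) by (simp add: valid_slots_def)
  then show ?thesis using j by (simp add: fresh_entry_def)
qed

lemma fresh_ok:
  assumes "real t \<le> arrival e" "arrival e < real t + 1" "acc_loss e = 0" "expert e < n"
  shows "entry_ok t (Suc t) e"
proof -
  have "\<lfloor>arrival e\<rfloor> = int t" using assms by (intro floor_unique) auto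
  then show ?thesis using assms by (simp add: entry_ok_def L_def)
qed

lemma entries_ok_update:
  assumes ok: "\<And>i e. e \<in> set (bucket s i) \<Longrightarrow> entry_ok t t e"
    and s': "s' \<in> set_pmf (update_step p t s)" and e: "e \<in> set (bucket s' i)"
  shows "entry_ok t (Suc t) e"
proof -
  obtain xss where xss: "s' = update_with p t s xss"
    "\<And>i. i \<le> top_level p t \<Longrightarrow> length (xss ! i) = m \<and> set (xss ! i) \<subseteq> {..<n}"
    using set_pmf_update_step[OF s'] by metis
  have ok': "entry_ok t (Suc t) e" if "e \<in> set (bucket s i)" for e i
    using ok[OF that] by (auto simp: entry_ok_def)
  have ev: "entry_ok t (Suc t) e" if "e \<in> set (evict p t (bucket s i))" for e i
    using evict_subset[OF that] ok' by (force simp: entry_ok_def)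
  show ?thesis
  proof (cases "i \<le> top_level p t")
    case False
    then show ?thesis using e xss(1) ok' by (auto simp: update_with_def Let_def)
  next
    case True
    let ?es = "concat (map (\<lambda>j. evict p t (bucket s j)) [0..<i])"
    consider "e \<in> set (evict p t (bucket s i))" | "e \<in> set (forwarded p t i ?es)" | "e \<in> set (sampled p t i (xss ! i))"
      using e xss(1) True by (auto simp: update_with_def Let_def)
    then show ?thesis
    proof cases
      case 2
      obtain e' j where "e' \<in> set (evict p t (bucket s j))" "expert e = expert e'"
        using forwarded_entry[OF 2] by auto
      then have "expert e < n" using ev[of e' j] by (simp add: entry_ok_def)
      then show ?thesis using forwarded_entry[OF 2] by (intro fresh_ok) auto
    next
      case 3
      then show ?thesis using sampled_entry[OF 3] xss(2)[OF True] by (intro fresh_ok) auto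
    qed (use ev in auto)
  qed
qed

lemma entries_ok_pre:
  "is_history p l h \<Longrightarrow> t \<le> length h \<Longrightarrow> e \<in> set (bucket (current p l (take t h)) i) \<Longrightarrow> entry_ok t t e"
proof (induction t arbitrary: i e)
  case 0
  then show ?case by (simp add: current_def init_state_def)
next
  case (Suc t)
  have s': "fst (h ! t) \<in> set_pmf (update_step p t (current p l (take t h)))"
    using Suc.prems by (intro history_record) auto
  obtain e' where e': "e' \<in> set (bucket (fst (h ! t)) i)"
    "expert e = expert e'" "arrival e = arrival e'" "acc_loss e = acc_loss e' + l t (expert e')"
    using Suc.prems by (auto simp: current_take_Suc observe_def)
  have ok: "entry_ok t (Suc t) e'"
    using Suc by (intro entries_ok_update[OF _ s' e'(1)]) auto
  then have "nat \<lfloor>arrival e'\<rfloor> < Suc t" by (simp add: entry_ok_def floor_less_iff nat_less_iff)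
  then have "L (expert e') (nat \<lfloor>arrival e'\<rfloor>) (Suc t) = L (expert e') (nat \<lfloor>arrival e'\<rfloor>) t + l t (expert e')"
    by (simp add: L_def)
  then show ?case using ok e' by (simp add: entry_ok_def)
qed

lemma arrival_pre:
  assumes "is_history p l h" "t \<le> length h" "y \<in> pre h i t"
  shows "0 \<le> snd y" "snd y < real t" "fst y < n"
proof -
  obtain e where "e \<in> set (bucket (current p l (take t h)) i)" "y = core e"
    using assms(3) by (auto simp: pre_def)
  then show "0 \<le> snd y" "snd y < real t" "fst y < n"
    using entries_ok_pre[OF assms(1,2), of e i] by (auto simp: core_def entry_ok_def)
qed

text \<open>\<open>F\<close> is the forwarded part. Only its arrival range and its experts are kept,
  so the rule that hands out the slots disappears from the argument.\<close>

lemma base_eq: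
  assumes "is_history p l h" "t \<le> length h"
  shows "\<exists>F. base t (current p l (take t h)) i = kill t (pre h i t) \<union> F \<and>
     (\<forall>y\<in>F. real t \<le> snd y \<and> snd y < real t + 1/2) \<and>
     fst ` F = (\<Union>j<i. fst ` kill t (pre h j t))"
proof -
  let ?s = "current p l (take t h)"
  let ?es = "concat (map (\<lambda>j. evict p t (bucket ?s j)) [0..<i])"
  have ev: "core ` set (evict p t (bucket ?s j)) = kill t (pre h j t)" for j
    unfolding pre_def using entries_ok_pre[OF assms] by (intro core_evict) (auto simp: entry_ok_def)
  have "fst ` core ` set (forwarded p t i ?es) = expert ` set ?es"
  proof -
    have "fst ` core ` set (forwarded p t i ?es) = (\<lambda>j. expert (?es ! j)) ` {..<length ?es}"
      by (simp add: forwarded_def core_def fresh_entry_def image_image atLeast0LessThan)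
    also have "\<dots> = expert ` set ?es"
      unfolding set_conv_nth[of ?es] by auto
    finally show ?thesis .
  qed
  also have "\<dots> = (\<Union>j<i. expert ` set (evict p t (bucket ?s j)))"
    by (simp add: image_UN atLeast0LessThan)
  also have "\<dots> = (\<Union>j<i. fst ` core ` set (evict p t (bucket ?s j)))"
    by (simp add: core_def image_image)
  finally have "fst ` core ` set (forwarded p t i ?es) = (\<Union>j<i. fst ` kill t (pre h j t))"
    unfolding ev .
  moreover have "\<forall>y\<in>core ` set (forwarded p t i ?es). real t \<le> snd y \<and> snd y < real t + 1/2"
    using forwarded_entry[of _ t i ?es] by (auto simp: core_def)
  ultimately show ?thesis unfolding base_def ev by blast
qed

lemma samples_arrival:
  assumes "y \<in> samples t i xs"
  shows "real t + 1/2 \<le> snd y" "snd y < real t + 1"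
proof -
  obtain j where j: "j < length xs" "y = (xs ! j, real t + 1/2 + smp_slot p t i (length xs) j)"
    using assms by (auto simp: samples_def)
  then have "0 \<le> smp_slot p t i (length xs) j \<and> smp_slot p t i (length xs) j < 1/2"
    using slots(2) by (simp add: valid_slots_def)
  then show "real t + 1/2 \<le> snd y" "snd y < real t + 1" using j by auto
qed

lemma post_not_dvd:
  assumes "is_history p l h" "t < length h" "i < k" "\<not> P i dvd t"
  shows "post h i t = pre h i t"
proof -
  obtain xss where "fst (h ! t) = update_with p t (current p l (take t h)) xss"
    using set_pmf_update_step[OF history_record(1)[OF assms(1,2)]] by metis
  then show ?thesis
    using le_top_level_iff[of i t] assms by (simp add: post_def pre_def core_update_with)
qed

lemma post_dvd:
  assumes "is_history p l h" "t < length h" "i < k" "P i dvd t"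
  obtains xs where "post h i t = base t (current p l (take t h)) i \<union> samples t i xs"
    "length xs = m" "set xs \<subseteq> {..<n}"
proof -
  obtain xss where xss: "fst (h ! t) = update_with p t (current p l (take t h)) xss"
    "\<And>i. i \<le> top_level p t \<Longrightarrow> length (xss ! i) = m \<and> set (xss ! i) \<subseteq> {..<n}"
    using set_pmf_update_step[OF history_record(1)[OF assms(1,2)]] by metis
  have i: "i \<le> top_level p t" using le_top_level_iff[of i t] assms by simp
  have "post h i t = base t (current p l (take t h)) i \<union> samples t i (xss ! i)"
    using i by (simp add: post_def xss(1) core_update_with)
  then show thesis using xss(2)[OF i] by (blast intro: that)
qed

section \<open>Fate of the present content of a bucket\<close>

definition below :: "real \<Rightarrow> (nat \<times> real) set \<Rightarrow> (nat \<times> real) set" where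
  "below a A = {y \<in> A. snd y < a}"

definition advance :: "nat \<Rightarrow> nat \<Rightarrow> (nat \<times> real) set \<Rightarrow> (nat \<times> real) set" where
  "advance i t A = (if P i dvd t then kill t A else A)"

text \<open>
  Whether an entry is evicted depends only on entries that arrived earlier, so the fate of the content
  \<open>A\<close> of a bucket can be computed without knowing what is added to it later.
\<close>

primrec remains :: "nat \<Rightarrow> nat \<Rightarrow> (nat \<times> real) set \<Rightarrow> nat \<Rightarrow> (nat \<times> real) set" where
  "remains i u A 0 = A"
| "remains i u A (Suc s) = (if s < u then A else advance i s (remains i u A s))"

text \<open>A dominating entry is earlier than the one it evicts, so truncation at \<open>a\<close>
  never separates the two in a way that saves the later one.\<close>

lemma below_kill: "below a (kill t A) = kill t (below a A)"
  by (auto simp: below_def kill_def)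

lemma kill_subset: "kill t A \<subseteq> A"
  by (auto simp: kill_def)

lemma below_advance: "below a (advance i t A) = advance i t (below a A)"
  by (simp add: advance_def below_kill)

lemma below_remains: "below a (remains i u A s) = remains i u (below a A) s"
  by (induction s) (auto simp: below_advance)

lemma remains_le: "s \<le> u \<Longrightarrow> remains i u A s = A"
  by (cases s) auto

lemma remains_antimono: "s \<le> s' \<Longrightarrow> remains i u A s' \<subseteq> remains i u A s"
proof (induction s')
  case (Suc s')
  have "remains i u A (Suc s') \<subseteq> remains i u A s'"
    using kill_subset by (auto simp: advance_def remains_le)
  then show ?case using Suc by (cases "s = Suc s'") auto
qed simp

lemma remains_Suc_start: "u < s \<Longrightarrow> remains i u A s = remains i (Suc u) (advance i u A) s"
proof (induction s)
  case (Suc s)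
  show ?case
  proof (cases "u = s")
    case True
    then show ?thesis by (simp add: remains_le)
  qed (use Suc in auto)
qed simp

lemma below_all: "(\<And>y. y \<in> A \<Longrightarrow> snd y < a) \<Longrightarrow> below a A = A"
  by (auto simp: below_def)

text \<open>Everything added at time \<open>t\<close> arrives at \<open>t\<close> or later and is
  cut off by the threshold \<open>a \<le> t\<close>.\<close>

lemma below_post:
  assumes h: "is_history p l h" "t < length h" and i: "i < k" and a: "a \<le> real t"
  shows "below a (post h i t) = advance i t (below a (pre h i t))"
proof (cases "P i dvd t")
  case False
  then show ?thesis using post_not_dvd[OF h i] by (simp add: advance_def)
next
  case True
  obtain xs where xs: "post h i t = base t (current p l (take t h)) i \<union> samples t i xs"
    using post_dvd[OF h i True] by metis
  obtain F where F: "base t (current p l (take t h)) i = kill t (pre h i t) \<union> F"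
    "\<forall>y\<in>F. real t \<le> snd y"
    using base_eq[of h t i] h by auto
  have "below a F = {}" using F(2) a by (auto simp: below_def)
  moreover have "below a (samples t i xs) = {}"
    using samples_arrival(1)[of _ t i xs] a by (force simp: below_def)
  ultimately have "below a (post h i t) = below a (kill t (pre h i t))"
    unfolding xs F(1) by (auto simp: below_def)
  then show ?thesis using True by (simp add: advance_def below_kill)
qed

text \<open>Links the actual buckets to the deterministic recursion \<open>remains\<close>. The
  threshold \<open>Suc u\<close> retains all arrivals of day \<open>u\<close>, including its
  samples, and nothing later.\<close>

lemma below_pre_eq_remains:
  assumes h: "is_history p l h" and i: "i < k" and u: "u < s" "s \<le> length h"
  shows "below (real (Suc u)) (pre h i s) = remains i (Suc u) (post h i u) s"
  using u
proof (induction s)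
  case (Suc s)
  show ?case
  proof (cases "u = s")
    case True
    have "below (real (Suc u)) (pre h i (Suc u)) = pre h i (Suc u)"
      using arrival_pre[OF h, of "Suc u"] Suc.prems True by (intro below_all) auto
    then show ?thesis using True pre_Suc[of u h i] Suc.prems by simp
  next
    case False
    then have us: "u < s" using Suc.prems by simp
    have "below (real (Suc u)) (pre h i (Suc s)) = below (real (Suc u)) (post h i s)"
      using pre_Suc[of s h i] Suc.prems by simp
    also have "\<dots> = advance i s (below (real (Suc u)) (pre h i s))"
      using h i us Suc.prems by (intro below_post) auto
    also have "\<dots> = remains i (Suc u) (post h i u) (Suc s)"
      using Suc us by simp
    finally show ?thesis .
  qed
qed simp

lemma remains_subset_post:
  assumes "is_history p l h" "i < k" "u \<le> w" "w < s" "s \<le> length h"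
  shows "remains i (Suc u) (post h i u) s \<subseteq> post h i w"
proof -
  have "remains i (Suc u) (post h i u) s \<subseteq> remains i (Suc u) (post h i u) (Suc w)"
    using assms by (intro remains_antimono) auto
  also have "\<dots> = below (real (Suc u)) (pre h i (Suc w))"
    using assms by (intro below_pre_eq_remains[symmetric]) auto
  also have "\<dots> \<subseteq> post h i w" using assms pre_Suc[of w h i] by (auto simp: below_def)
  finally show ?thesis .
qed

text \<open>Level \<open>i\<close> is updated whenever level \<open>j\<close> is, and forwarding
  copies exactly what survives the eviction of the lower buckets at that moment.\<close>

lemma remains_forwarded:
  assumes h: "is_history p l h" "s \<le> length h" and i: "i < j" "j < k" and w: "u < w" "w < s" "P j dvd w"
    and y: "y \<in> remains i (Suc u) (post h i u) s"
  shows "fst y \<in> fst ` post h j w"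
proof -
  have ik: "i < k" using i by simp
  have iw: "P i dvd w" using period_dvd_mono[of i j] i w by (auto intro: dvd_trans)
  \<comment> \<open>\<open>Suc w\<close> and not \<open>w\<close>: eviction precedes forwarding, so
    \<open>y\<close> has to survive the eviction of time \<open>w\<close> itself, which
    \<open>w < s\<close> ensures.\<close>
  have "y \<in> remains i (Suc u) (post h i u) (Suc w)"
    using remains_antimono[of "Suc w" s i "Suc u" "post h i u"] y w by auto
  then have "y \<in> kill w (below (real (Suc u)) (pre h i w))"
    using below_pre_eq_remains[OF h(1) ik, of u w] w h iw by (simp add: advance_def)
  then have "y \<in> below (real (Suc u)) (kill w (pre h i w))" by (simp only: below_kill)
  then have y': "y \<in> kill w (pre h i w)" by (simp add: below_def)
  obtain F where F: "base w (current p l (take w h)) j = kill w (pre h j w) \<union> F"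
    "fst ` F = (\<Union>j'<j. fst ` kill w (pre h j' w))"
    using base_eq[of h w j] h w by auto
  have "fst y \<in> fst ` F" unfolding F(2) using y' i by auto
  moreover have "F \<subseteq> post h j w"
    using post_dvd[OF h(1) _ i(2) w(3)] F(1) h w by (metis Un_upper2 le_supI1 less_le_trans)
  ultimately show ?thesis by blast
qed

end

subsection \<open>Few windows are uncovered\<close>

lemma replicate_pmf_of_set:
  assumes S: "finite S" "S \<noteq> {}"
  shows "replicate_pmf N (pmf_of_set S) = pmf_of_set {xs. set xs \<subseteq> S \<and> length xs = N}"
proof (rule pmf_eqI)
  fix xs :: "'a list"
  let ?\<Omega> = "{xs. set xs \<subseteq> S \<and> length xs = N}"
  have fin: "finite ?\<Omega>" by (rule finite_lists_length_eq[OF S(1)])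
  obtain x where x: "x \<in> S" using S by blast
  then have "replicate N x \<in> ?\<Omega>" by auto
  then have ne: "?\<Omega> \<noteq> {}" by blast
  have *: "pmf (replicate_pmf N (pmf_of_set S)) xs = 1 / real (card S) ^ N"
    if "set xs \<subseteq> S" "length xs = N" for xs
    using that
  proof (induction N arbitrary: xs)
    case (Suc N)
    then obtain y ys where xs: "xs = y # ys" by (cases xs) auto
    have rep: "replicate_pmf (Suc N) (pmf_of_set S) =
        map_pmf (\<lambda>(y, ys). y # ys) (pair_pmf (pmf_of_set S) (replicate_pmf N (pmf_of_set S)))"
      by (simp add: pair_pmf_def map_bind_pmf)
    have "pmf (replicate_pmf (Suc N) (pmf_of_set S)) ((\<lambda>(y, ys). y # ys) (y, ys)) =
        pmf (pair_pmf (pmf_of_set S) (replicate_pmf N (pmf_of_set S))) (y, ys)"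
      unfolding rep by (rule pmf_map_inj') (auto simp: inj_def)
    then show ?case using Suc xs S by (simp add: pmf_pair pmf_of_set)
  qed auto
  show "pmf (replicate_pmf N (pmf_of_set S)) xs = pmf (pmf_of_set ?\<Omega>) xs"
  proof (cases "xs \<in> ?\<Omega>")
    case True
    then show ?thesis using * fin ne S(1) by (simp add: pmf_of_set card_lists_length_eq)
  next
    case False
    then have "xs \<notin> set_pmf (replicate_pmf N (pmf_of_set S))"
      using S by (auto simp: set_replicate_pmf set_pmf_of_set)
    then show ?thesis using False fin ne by (simp add: pmf_of_set pmf_eq_0_set_pmf)
  qed
qed

text \<open>Supermartingale principle; the one-day decrease is required only at histories of
  positive probability. Combined with the Markov inequality that follows, it yields all tail
  bounds.\<close>

lemma nn_integral_hrun_le: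
  fixes \<Phi> :: "history \<Rightarrow> ennreal"
  assumes "t0 \<le> t1"
    and "\<And>t h. t0 \<le> t \<Longrightarrow> t < t1 \<Longrightarrow> h \<in> set_pmf (hrun p l t) \<Longrightarrow>
      (\<integral>\<^sup>+ r. \<Phi> (h @ [r]) \<partial>record_day p t (current p l h)) \<le> \<Phi> h"
  shows "(\<integral>\<^sup>+ h. \<Phi> h \<partial>hrun p l t1) \<le> (\<integral>\<^sup>+ h. \<Phi> h \<partial>hrun p l t0)"
  using assms
proof (induction t1)
  case (Suc t1)
  show ?case
  proof (cases "t0 = Suc t1")
    case False
    then have le: "t0 \<le> t1" using Suc.prems by simp
    have "(\<integral>\<^sup>+ h. \<Phi> h \<partial>hrun p l (Suc t1)) =
        (\<integral>\<^sup>+ h. (\<integral>\<^sup>+ r. \<Phi> (h @ [r]) \<partial>record_day p t1 (current p l h)) \<partial>hrun p l t1)"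
      by simp
    also have "\<dots> \<le> (\<integral>\<^sup>+ h. \<Phi> h \<partial>hrun p l t1)"
      using Suc.prems(2)[of t1] le by (intro nn_integral_mono_AE) (auto simp: AE_measure_pmf_iff)
    also have "\<dots> \<le> (\<integral>\<^sup>+ h. \<Phi> h \<partial>hrun p l t0)"
      using le Suc.prems(2) by (intro Suc.IH) auto
    finally show ?thesis .
  qed simp
qed simp

lemma prob_le_nn_integral:
  fixes \<Phi> :: "'a \<Rightarrow> ennreal"
  assumes "(\<integral>\<^sup>+ x. \<Phi> x \<partial>measure_pmf M) \<le> ennreal q" "0 \<le> q"
    and "\<And>x. x \<in> set_pmf M \<Longrightarrow> x \<in> A \<Longrightarrow> 1 \<le> \<Phi> x"
  shows "measure_pmf.prob M A \<le> q"
proof -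
  have "ennreal (measure_pmf.prob M A) = (\<integral>\<^sup>+ x. indicator A x \<partial>measure_pmf M)"
    by (simp add: measure_pmf.emeasure_eq_measure)
  also have "\<dots> \<le> (\<integral>\<^sup>+ x. \<Phi> x \<partial>measure_pmf M)"
    using assms(3) by (intro nn_integral_mono_AE) (auto simp: AE_measure_pmf_iff indicator_def)
  also have "\<dots> \<le> ennreal q" by (rule assms(1))
  finally show ?thesis using assms(2) by (simp add: ennreal_le_iff)
qed

section \<open>Counting uncovered windows by resampling\<close>

context algorithm
begin

definition eligible :: "nat \<Rightarrow> nat \<Rightarrow> nat \<Rightarrow> bool" where
  "eligible i u s \<longleftrightarrow> s = T \<or> P i dvd s \<and> epoch_start p s \<le> u"

definition covered :: "nat \<Rightarrow> nat \<Rightarrow> (nat \<times> real) set \<Rightarrow> bool" where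
  "covered i u A \<longleftrightarrow> (\<exists>s y. u < s \<and> s \<le> T \<and> eligible i u s \<and> y \<in> remains i (Suc u) A s \<and>
     L (fst y) u s \<le> (1 + eps p) * L best u s)"

definition hit :: "nat \<Rightarrow> nat \<Rightarrow> (nat \<times> real) set \<Rightarrow> bool" where
  "hit i u A \<longleftrightarrow> (\<exists>a. (best, a) \<in> remains i u A T)"

lemma hit_covered:
  assumes "hit i (Suc u) A" "u < T"
  shows "covered i u A"
proof -
  obtain a where a: "(best, a) \<in> remains i (Suc u) A T" using assms by (auto simp: hit_def)
  have "L best u T \<le> (1 + eps p) * L best u T"
    using eps_nonneg L_nonneg[OF best, of T u] by (simp add: distrib_right)
  then show ?thesis using a assms(2) unfolding covered_def eligible_def
    by (intro exI[of _ T] exI[of _ "(best, a)"]) auto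
qed

lemma below_samples_update:
  assumes "j < length xs"
  shows "below (real u + 1/2 + smp_slot p u i (length xs) j) (samples u i (xs[j := x])) =
         below (real u + 1/2 + smp_slot p u i (length xs) j) (samples u i xs)"
proof -
  have eq: "below (real u + 1/2 + smp_slot p u i (length xs) j) (samples u i ys) =
      (\<lambda>j'. (ys ! j', real u + 1/2 + smp_slot p u i (length xs) j')) `
        {j'. j' < length xs \<and> smp_slot p u i (length xs) j' < smp_slot p u i (length xs) j}"
    if "length ys = length xs" for ys
    using that by (auto simp: below_def samples_def)
  show ?thesis
    unfolding eq[OF refl] eq[OF length_list_update]
  proof (intro image_cong refl)
    fix j'
    assume "j' \<in> {j'. j' < length xs \<and> smp_slot p u i (length xs) j' < smp_slot p u i (length xs) j}"
    then have "j' \<noteq> j" by auto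
    then show "(xs[j := x] ! j', real u + 1/2 + smp_slot p u i (length xs) j') =
        (xs ! j', real u + 1/2 + smp_slot p u i (length xs) j')" by simp
  qed
qed

lemma remains_subset: "remains i u A s \<subseteq> A"
  using remains_antimono[of 0 s i u A] by simp

text \<open>Suppose the new entry of \<open>best\<close> were evicted at \<open>s\<close> by
  \<open>y'\<close>. Then \<open>y'\<close> arrived earlier, hence it also survives until
  \<open>s\<close> with the original samples. Its loss since \<open>u\<close> is at most its loss
  since its own arrival, so at most \<open>1 + eps\<close> times that of \<open>best\<close>, and
  \<open>y'\<close> would have covered the window.\<close>

lemma replace_hit:
  assumes A0: "\<And>y. y \<in> A0 \<Longrightarrow> fst y < n \<and> snd y < real u + 1/2"
    and i: "i < k" "u < T" and xs: "set xs \<subseteq> {..<n}" "j < length xs"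
    and unc: "\<not> covered i u (A0 \<union> samples u i xs)"
  shows "hit i (Suc u) (A0 \<union> samples u i (xs[j := best]))"
proof -
  let ?A = "A0 \<union> samples u i xs" and ?A' = "A0 \<union> samples u i (xs[j := best])"
  let ?a = "real u + 1/2 + smp_slot p u i (length xs) j"
  let ?y = "(best, ?a)"
  have slot: "0 \<le> smp_slot p u i (length xs) j" "smp_slot p u i (length xs) j < 1/2"
    using slots(2) xs by (auto simp: valid_slots_def)
  then have fl: "nat \<lfloor>?a\<rfloor> = u" by (simp add: floor_unique nat_eq_iff)
  have below_eq: "below ?a ?A' = below ?a ?A"
    using below_samples_update[OF xs(2), of u i best] by (auto simp: below_def)
  have "?y \<in> samples u i (xs[j := best])"
    unfolding samples_def using xs(2) by (intro image_eqI[of _ _ j]) auto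
  then have y_in: "?y \<in> ?A'" by blast
  have "?y \<in> remains i (Suc u) ?A' s" if "s \<le> T" for s
    using that
  proof (induction s)
    case (Suc s)
    let ?R = "remains i (Suc u) ?A' s"
    have yR: "?y \<in> ?R" using Suc by simp
    have "?y \<in> kill s ?R" if us: "\<not> s < Suc u" and dvd: "P i dvd s"
    proof (rule ccontr)
      assume "?y \<notin> kill s ?R"
      then obtain y' where ep: "real (epoch_start p s) + 1/2 \<le> ?a" and y': "y' \<in> ?R" "snd y' < ?a"
        and le: "L (fst y') (nat \<lfloor>snd y'\<rfloor>) s \<le> (1 + eps p) * L best u s"
        using yR fl by (auto simp: kill_def)
      \<comment> \<open>The two sample lists agree before the slot of \<open>j\<close>, so the fates
        of entries earlier than that slot agree as well.\<close>
      have "y' \<in> below ?a ?R" using y' by (simp add: below_def)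
      then have "y' \<in> below ?a (remains i (Suc u) ?A s)" by (simp only: below_remains below_eq)
      then have y'': "y' \<in> remains i (Suc u) ?A s" by (simp add: below_def)
      then have "y' \<in> ?A" using remains_subset by blast
      moreover have "fst y' \<in> set xs" if "y' \<in> samples u i xs" using that by (auto simp: samples_def)
      ultimately have n: "fst y' < n" using A0[of y'] xs by blast
      have "snd y' < real u + 1" using y'(2) slot by simp
      then have "nat \<lfloor>snd y'\<rfloor> \<le> u" by (simp add: nat_le_iff floor_le_iff)
      then have "L (fst y') u s \<le> L (fst y') (nat \<lfloor>snd y'\<rfloor>) s"
        using n Suc.prems by (intro L_mono) auto
      with le have "L (fst y') u s \<le> (1 + eps p) * L best u s" by simp
      moreover have "epoch_start p s \<le> u" using ep slot by simp
      ultimately have "covered i u ?A"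
        unfolding covered_def eligible_def using y'' us dvd Suc.prems
        by (intro exI[of _ s] exI[of _ y']) auto
      then show False using unc by simp
    qed
    then show ?case using y_in yR by (auto simp: advance_def)
  qed (use y_in in simp)
  then show ?thesis by (auto simp: hit_def)
qed

text \<open>Map \<open>(xs, j)\<close> to the list with \<open>best\<close> at position
  \<open>j\<close> together with the overwritten expert. An uncovered \<open>xs\<close> does not
  contain \<open>best\<close>, so \<open>j\<close> can be read off as its only position and the map
  is injective.\<close>

lemma card_uncovered_le:
  fixes A0 u i
  assumes A0: "\<And>y. y \<in> A0 \<Longrightarrow> fst y < n \<and> snd y < real u + 1/2"
    and i: "i < k" "u < T"
  defines "\<Omega> \<equiv> {xs. set xs \<subseteq> {..<n} \<and> length xs = m}"
  shows "card {xs \<in> \<Omega>. \<not> covered i u (A0 \<union> samples u i xs)} * m \<le>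
         card {xs \<in> \<Omega>. hit i (Suc u) (A0 \<union> samples u i xs)} * n"
proof -
  let ?U = "{xs \<in> \<Omega>. \<not> covered i u (A0 \<union> samples u i xs)}"
  let ?H = "{xs \<in> \<Omega>. hit i (Suc u) (A0 \<union> samples u i xs)}"
  let ?f = "\<lambda>(xs, j). (xs[j := best], xs ! j)"
  have fin: "finite \<Omega>" unfolding \<Omega>_def by (intro finite_lists_length_eq) simp
  have notin: "best \<notin> set xs" if xs: "xs \<in> ?U" for xs
  proof
    assume "best \<in> set xs"
    then obtain j where j: "j < length xs" "xs ! j = best" by (auto simp: in_set_conv_nth)
    \<comment> \<open>If \<open>best\<close> is already sampled, the replacement changes nothing,
      and the same list would be both uncovered and hit.\<close>
    have "xs[j := best] = xs" using j by auto
    moreover have "hit i (Suc u) (A0 \<union> samples u i (xs[j := best]))"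
      using xs by (intro replace_hit A0 i j) (auto simp: \<Omega>_def)
    ultimately show False using hit_covered[OF _ i(2)] xs by auto
  qed
  have "inj_on ?f (?U \<times> {..<m})"
  proof (rule inj_onI)
    fix z z' assume z: "z \<in> ?U \<times> {..<m}" and z': "z' \<in> ?U \<times> {..<m}" and eq: "?f z = ?f z'"
    obtain xs j where zz: "z = (xs, j)" by (cases z)
    obtain xs' j' where zz': "z' = (xs', j')" by (cases z')
    have len: "length xs = m" "length xs' = m" "j < m" "j' < m" using z z' zz zz' by (auto simp: \<Omega>_def)
    have eq': "xs[j := best] = xs'[j' := best]" "xs ! j = xs' ! j'" using eq zz zz' by auto
    have jj: "j = j'"
    proof (rule ccontr)
      assume "j \<noteq> j'"
      then have "xs' ! j = best" using arg_cong[OF eq'(1), of "\<lambda>v. v ! j"] len by simp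
      then have "best \<in> set xs'" using len by (metis nth_mem)
      then show False using notin[of xs'] z' zz' by auto
    qed
    have "xs = (xs[j := best])[j := xs ! j]" by simp
    also have "\<dots> = (xs'[j' := best])[j' := xs' ! j']" using eq' jj by simp
    also have "\<dots> = xs'" by simp
    finally show "z = z'" using jj zz zz' by simp
  qed
  moreover have "?f ` (?U \<times> {..<m}) \<subseteq> ?H \<times> {..<n}"
  proof
    fix v assume "v \<in> ?f ` (?U \<times> {..<m})"
    then obtain xs j where v: "v = (xs[j := best], xs ! j)" and xs: "xs \<in> ?U" and j: "j < m" by auto
    have len: "length xs = m" "set xs \<subseteq> {..<n}" using xs by (auto simp: \<Omega>_def)
    have "hit i (Suc u) (A0 \<union> samples u i (xs[j := best]))"
      using xs len j by (intro replace_hit A0 i) auto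
    moreover have "set (xs[j := best]) \<subseteq> {..<n}"
      using len best set_update_subset_insert[of xs j best] by auto
    moreover have "xs ! j \<in> set xs" using len j by simp
    then have "xs ! j < n" using len(2) by auto
    ultimately show "v \<in> ?H \<times> {..<n}" using v len by (simp add: \<Omega>_def)
  qed
  ultimately have "card (?U \<times> {..<m}) \<le> card (?H \<times> {..<n})"
    using fin by (intro card_inj_on_le) auto
  then show ?thesis by (simp only: card_cartesian_product card_lessThan)
qed

definition num_uncovered :: "nat \<Rightarrow> history \<Rightarrow> nat" where
  "num_uncovered i h = card {u. u < length h \<and> P i dvd u \<and> \<not> covered i u (post h i u)}"

text \<open>Bounds the conditional probability of reaching \<open>N\<close> uncovered windows. A
  permanent entry of \<open>best\<close> covers all later windows of the level, which explains the
  value 0.\<close>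

definition count_potential :: "nat \<Rightarrow> nat \<Rightarrow> history \<Rightarrow> real" where
  "count_potential i N h =
     (if N \<le> num_uncovered i h then 1
      else if hit i (length h) (pre h i (length h)) then 0
      else (real n / real (n + m)) ^ (N - num_uncovered i h))"

text \<open>Without a permanent entry, the expected new value is at most
  \<open>q * (1 + Pr(uncovered) * m / n - Pr(hit))\<close>, and the counting bound makes this at
  most the old value \<open>q\<close>. In the other cases the potential is constant or already at
  its maximum 1.\<close>

lemma count_potential_step:
  assumes h: "h \<in> set_pmf (hrun p l t)" and t: "t < T" and i: "i < k"
  shows "(\<integral>\<^sup>+ r. ennreal (count_potential i N (h @ [r])) \<partial>record_day p t (current p l h))
         \<le> ennreal (count_potential i N h)"
proof -
  define \<rho> where "\<rho> = real n / real (n + m)"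
  have len: "length h = t" and hist: "is_history p l h" using set_pmf_hrun[OF h] by auto
  have n: "0 < n" using best by simp
  have rho: "0 < \<rho>" "\<rho> \<le> 1" "1 / \<rho> = 1 + real m / real n" using n by (auto simp: \<rho>_def field_simps)
  define X where "X = num_uncovered i h"
  define X' where "X' = (\<lambda>A. X + of_bool (P i dvd t \<and> \<not> covered i t A))"
  define G where "G = (\<lambda>A. if N \<le> X' A then 1 else if hit i (Suc t) A then 0 else \<rho> ^ (N - X' A))"
  have Phi: "count_potential i N (h @ [r]) = G (core ` set (bucket (fst r) i))" for r
  proof -
    have "{u. u < length (h @ [r]) \<and> P i dvd u \<and> \<not> covered i u (post (h @ [r]) i u)} =
        {u. u < length h \<and> P i dvd u \<and> \<not> covered i u (post h i u)} \<union>
        (if P i dvd t \<and> \<not> covered i t (core ` set (bucket (fst r) i)) then {t} else {})"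
      using len by (auto simp: post_def nth_append less_Suc_eq)
    then have "num_uncovered i (h @ [r]) = X' (core ` set (bucket (fst r) i))"
      using len by (simp add: num_uncovered_def X'_def X_def)
    moreover have "pre (h @ [r]) i (length (h @ [r])) = core ` set (bucket (fst r) i)"
      using pre_Suc[of t "h @ [r]" i] len nth_append_length[of h r "[]"] by (simp add: post_def)
    ultimately show ?thesis using len by (simp add: count_potential_def G_def \<rho>_def)
  qed
  have PhiX: "count_potential i N h = (if N \<le> X then 1 else if hit i t (pre h i t) then 0 else \<rho> ^ (N - X))"
    by (simp add: count_potential_def X_def len \<rho>_def)
  have G01: "0 \<le> G A" "G A \<le> 1" for A
    using rho by (auto simp: G_def intro: power_le_one)
  have "(\<integral>\<^sup>+ r. ennreal (count_potential i N (h @ [r])) \<partial>record_day p t (current p l h)) =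
      (\<integral>\<^sup>+ s'. ennreal (G (core ` set (bucket s' i))) \<partial>update_step p t (current p l h))"
    by (simp add: Phi record_day_def)
  also have "\<dots> \<le> ennreal (count_potential i N h)"
  proof (cases "N \<le> X")
    case True
    have "(\<integral>\<^sup>+ s'. ennreal (G (core ` set (bucket s' i))) \<partial>update_step p t (current p l h)) \<le>
        (\<integral>\<^sup>+ s'. 1 \<partial>update_step p t (current p l h))"
      using G01 by (intro nn_integral_mono) simp
    then show ?thesis using True PhiX by simp
  next
    case NX: False
    show ?thesis
    proof (cases "P i dvd t")
      case False
      have "G (core ` set (bucket s' i)) = count_potential i N h"
        if "s' \<in> set_pmf (update_step p t (current p l h))" for s'
      proof -
        have itop: "\<not> i \<le> top_level p t" using le_top_level_iff[OF i] False by simp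
        have "core ` set (bucket s' i) = core ` set (bucket (current p l h) i)"
          using set_pmf_update_step[OF that] itop by (metis core_update_with)
        also have "\<dots> = pre h i t" by (simp add: pre_def len)
        finally have eq: "core ` set (bucket s' i) = pre h i t" .
        have "hit i (Suc t) (pre h i t) \<longleftrightarrow> hit i t (pre h i t)"
          using remains_Suc_start[OF t, of i "pre h i t"] False by (simp add: hit_def advance_def)
        then show ?thesis unfolding eq PhiX using False by (simp add: G_def X'_def)
      qed
      then have "(\<integral>\<^sup>+ s'. ennreal (G (core ` set (bucket s' i))) \<partial>update_step p t (current p l h)) =
          (\<integral>\<^sup>+ s'. ennreal (count_potential i N h) \<partial>update_step p t (current p l h))"
        by (intro nn_integral_cong_AE) (auto simp: AE_measure_pmf_iff)
      then show ?thesis by simp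
    next
      case True
      let ?base = "base t (current p l h) i"
      let ?A = "\<lambda>xs. ?base \<union> samples t i xs"
      define \<Omega> where "\<Omega> = {xs. set xs \<subseteq> {..<n} \<and> length xs = m}"
      have fin: "finite \<Omega>" unfolding \<Omega>_def by (intro finite_lists_length_eq) simp
      have "replicate m best \<in> \<Omega>" using best by (auto simp: \<Omega>_def)
      then have ne: "\<Omega> \<noteq> {}" by blast
      have card: "0 < card \<Omega>" using fin ne by (simp add: card_gt_0_iff)
      have itop: "i \<le> top_level p t" using le_top_level_iff[OF i] True by simp
      have unif: "replicate_pmf m (pmf_of_set {..<n}) = pmf_of_set \<Omega>"
        unfolding \<Omega>_def using n by (intro replicate_pmf_of_set) auto
      have "(\<integral>\<^sup>+ s'. ennreal (G (core ` set (bucket s' i))) \<partial>update_step p t (current p l h)) =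
          (\<integral>\<^sup>+ xss. ennreal (G (?A (xss ! i))) \<partial>replicate_pmf (Suc (top_level p t)) (pmf_of_set \<Omega>))"
        using itop by (simp add: update_step_def period_0 core_update_with unif del: replicate_pmf.simps)
      \<comment> \<open>The bucket of level \<open>i\<close> sees only its own list of samples, so
        the joint draw is replaced by its \<open>i\<close>-th marginal.\<close>
      also have "\<dots> = (\<integral>\<^sup>+ xs. ennreal (G (?A xs)) \<partial>map_pmf (\<lambda>xss. xss ! i) (replicate_pmf (Suc (top_level p t)) (pmf_of_set \<Omega>)))"
        by (simp del: replicate_pmf.simps)
      also have "\<dots> = (\<integral>\<^sup>+ xs. ennreal (G (?A xs)) \<partial>pmf_of_set \<Omega>)"
        using itop by (subst map_nth_replicate_pmf) auto
      also have "\<dots> = ennreal ((\<Sum>xs\<in>\<Omega>. G (?A xs)) / real (card \<Omega>))"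
        using fin ne G01 card
        by (simp add: nn_integral_pmf_of_set sum_ennreal divide_ennreal sum_nonneg ennreal_of_nat_eq_real_of_nat)
      also have "\<dots> \<le> ennreal (count_potential i N h)"
      proof (rule ennreal_leI)
        obtain F where F: "?base = kill t (pre h i t) \<union> F"
          "\<forall>y\<in>F. real t \<le> snd y \<and> snd y < real t + 1/2"
          "fst ` F = (\<Union>j<i. fst ` kill t (pre h j t))"
          using base_eq[OF hist, of t i] len by auto
        have pre_ok: "fst y < n \<and> snd y < real t" if "y \<in> kill t (pre h j t)" for y j
          using that arrival_pre[OF hist, of t y j] len kill_subset by auto
        have A0: "fst y < n \<and> snd y < real t + 1/2" if y: "y \<in> ?base" for y
        proof -
          consider "y \<in> kill t (pre h i t)" | "y \<in> F" using y F(1) by auto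
          then show ?thesis
          proof cases
            case 2
            then have "fst y \<in> (\<Union>j<i. fst ` kill t (pre h j t))" using F(3) by blast
            then show ?thesis using pre_ok F(2) 2 by auto
          qed (use pre_ok[of y i] in auto)
        qed
        show "(\<Sum>xs\<in>\<Omega>. G (?A xs)) / real (card \<Omega>) \<le> count_potential i N h"
        proof (cases "hit i t (pre h i t)")
          case hitted: True
          have "G (?A xs) = 0" if "xs \<in> \<Omega>" for xs
          proof -
            \<comment> \<open>New arrivals are later than a permanent entry and cannot end its life,
              so an existing hit persists whatever is sampled.\<close>
            have "below (real t) F = {}" using F(2) by (force simp: below_def)
            moreover have "below (real t) (samples t i xs) = {}"
              using samples_arrival(1)[of _ t i xs] by (force simp: below_def)
            moreover have "below (real t) (kill t (pre h i t)) = kill t (pre h i t)"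
              using pre_ok[of _ i] by (intro below_all) auto
            ultimately have "below (real t) (?A xs) = kill t (pre h i t)"
              unfolding F(1) by (auto simp: below_def)
            then have "below (real t) (remains i (Suc t) (?A xs) T) = remains i t (pre h i t) T"
              using remains_Suc_start[OF t, of i "pre h i t"] True by (simp add: below_remains advance_def)
            then have "hit i (Suc t) (?A xs)" using hitted by (auto simp: hit_def below_def)
            then show ?thesis using hit_covered[OF _ t] NX by (simp add: G_def X'_def)
          qed
          then show ?thesis using hitted NX by (simp add: PhiX)
        next
          case False
          define q where "q = \<rho> ^ (N - X)"
          have q: "0 < q" "q / \<rho> = \<rho> ^ (N - X - 1)"
          proof -
            have "N - X = Suc (N - X - 1)" using NX by simp
            then have "q = \<rho> * \<rho> ^ (N - X - 1)" unfolding q_def by (metis power_Suc)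
            then show "q / \<rho> = \<rho> ^ (N - X - 1)" using rho(1) by simp
          qed (use rho q_def in simp)
          let ?u = "\<lambda>xs. of_bool (\<not> covered i t (?A xs)) :: real" and ?h = "\<lambda>xs. of_bool (hit i (Suc t) (?A xs)) :: real"
          \<comment> \<open>A linear bound valid for every outcome: a hit gives 0, an uncovered
            window gives the factor \<open>1 / \<rho> = 1 + m / n\<close>. No outcome has
            both.\<close>
          have "G (?A xs) \<le> q * (1 + ?u xs * (real m / real n) - ?h xs)" for xs
          proof (cases "covered i t (?A xs)")
            case True
            then show ?thesis using NX q(1) by (auto simp: G_def X'_def q_def)
          next
            case unc: False
            then have nh: "\<not> hit i (Suc t) (?A xs)" using hit_covered[OF _ t] by blast
            have "G (?A xs) \<le> \<rho> ^ (N - X - 1)"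
            proof (cases "N \<le> X + 1")
              case True
              \<comment> \<open>With the \<open>N\<close>-th uncovered window the potential jumps to
                1, which agrees with the power at exponent 0.\<close>
              then have "N - X - 1 = 0" by simp
              then show ?thesis using G01(2) by simp
            qed (use unc nh \<open>P i dvd t\<close> in \<open>auto simp: G_def X'_def\<close>)
            also have "\<dots> = q * (1 / \<rho>)" using q(2) by simp
            also have "\<dots> = q * (1 + real m / real n)" by (simp only: rho(3))
            finally show ?thesis using unc nh by simp
          qed
          then have "(\<Sum>xs\<in>\<Omega>. G (?A xs)) \<le> (\<Sum>xs\<in>\<Omega>. q * (1 + ?u xs * (real m / real n) - ?h xs))"
            by (intro sum_mono)
          also have "\<dots> = q * (real (card \<Omega>) + (\<Sum>xs\<in>\<Omega>. ?u xs) * (real m / real n) - (\<Sum>xs\<in>\<Omega>. ?h xs))"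
            by (simp only: sum_distrib_left[symmetric] sum.distrib sum_subtractf sum_distrib_right[symmetric]) simp
          also have "\<dots> \<le> q * real (card \<Omega>)"
          proof -
            have "card {xs \<in> \<Omega>. \<not> covered i t (?A xs)} * m \<le> card {xs \<in> \<Omega>. hit i (Suc t) (?A xs)} * n"
              unfolding \<Omega>_def by (rule card_uncovered_le[OF A0 i t])
            then have "real (card {xs \<in> \<Omega>. \<not> covered i t (?A xs)}) * real m \<le>
                real (card {xs \<in> \<Omega>. hit i (Suc t) (?A xs)}) * real n"
              by (simp only: of_nat_mult[symmetric] of_nat_le_iff)
            moreover have "(\<Sum>xs\<in>\<Omega>. ?u xs) = real (card {xs \<in> \<Omega>. \<not> covered i t (?A xs)})"
              "(\<Sum>xs\<in>\<Omega>. ?h xs) = real (card {xs \<in> \<Omega>. hit i (Suc t) (?A xs)})"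
              using fin by (simp_all add: Int_def)
            ultimately have "(\<Sum>xs\<in>\<Omega>. ?u xs) * (real m / real n) \<le> (\<Sum>xs\<in>\<Omega>. ?h xs)"
              using n by (simp add: field_simps)
            then show ?thesis using q(1) by simp
          qed
          finally show ?thesis using card NX False by (simp add: PhiX q_def field_simps)
        qed
      qed
      finally show ?thesis .
    qed
  qed
  finally show ?thesis .
qed

lemma prob_num_uncovered_ge:
  assumes i: "i < k"
  shows "measure_pmf.prob (hrun p l T) {h. N \<le> num_uncovered i h} \<le> (real n / real (n + m)) ^ N"
proof (rule prob_le_nn_integral)
  have "(\<integral>\<^sup>+ h. ennreal (count_potential i N h) \<partial>hrun p l T) \<le>
      (\<integral>\<^sup>+ h. ennreal (count_potential i N h) \<partial>hrun p l 0)"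
    using count_potential_step i by (intro nn_integral_hrun_le) auto
  also have "\<dots> = ennreal (count_potential i N [])" by simp
  also have "\<dots> \<le> ennreal ((real n / real (n + m)) ^ N)"
    by (intro ennreal_leI) (auto simp: count_potential_def num_uncovered_def)
  finally show "(\<integral>\<^sup>+ h. ennreal (count_potential i N h) \<partial>hrun p l T) \<le>
    ennreal ((real n / real (n + m)) ^ N)" .
qed (auto simp: count_potential_def)

end

subsection \<open>Regret of multiplicative weights\<close>

lemma tanh_le_self: "0 \<le> x \<Longrightarrow> tanh x \<le> x" for x :: real
proof -
  assume "0 \<le> x"
  have "((\<lambda>x. x - tanh x) has_real_derivative (tanh y)\<^sup>2) (at y)" for y :: real
    by (auto intro!: derivative_eq_intros)
  then have "0 - tanh 0 \<le> x - tanh x"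
    using \<open>0 \<le> x\<close> by (intro DERIV_nonneg_imp_nondecreasing[of 0 x "\<lambda>x. x - tanh x"]) (auto intro!: exI)
  then show ?thesis by simp
qed

text \<open>The derivative of \<open>x\<^sup>2 / 2 - ln (cosh x)\<close> is
  \<open>x - tanh x\<close>, which is nonnegative. The bound holds for all rates, as required
  because learning rates may exceed 1.\<close>

lemma cosh_le_exp_square: "0 \<le> x \<Longrightarrow> cosh x \<le> exp (x\<^sup>2 / 2)" for x :: real
proof -
  assume x: "0 \<le> x"
  have d: "((\<lambda>x. x\<^sup>2 / 2 - ln (cosh x)) has_real_derivative (y - tanh y)) (at y)" for y :: real
  proof -
    have "((\<lambda>x. ln (cosh x)) has_real_derivative (1 / cosh y * sinh y)) (at y)"
      by (rule DERIV_chain'[OF _ DERIV_ln_divide]) (auto intro!: derivative_eq_intros simp: cosh_real_pos)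
    moreover have "((\<lambda>x. x\<^sup>2 / 2) has_real_derivative y) (at y)"
      by (auto intro!: derivative_eq_intros)
    ultimately show ?thesis by (auto intro!: derivative_eq_intros simp: tanh_def)
  qed
  have "0\<^sup>2 / 2 - ln (cosh 0) \<le> x\<^sup>2 / 2 - ln (cosh x)"
  proof (rule DERIV_nonneg_imp_nondecreasing[of 0 x "\<lambda>x. x\<^sup>2 / 2 - ln (cosh x)"])
    fix y :: real assume "0 \<le> y" "y \<le> x"
    then show "\<exists>z. ((\<lambda>x. x\<^sup>2 / 2 - ln (cosh x)) has_real_derivative z) (at y) \<and> 0 \<le> z"
      using d[of y] tanh_le_self[of y] by (intro exI[of _ "y - tanh y"]) simp
  qed (rule x)
  then have "ln (cosh x) \<le> x\<^sup>2 / 2" by simp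
  then have "exp (ln (cosh x)) \<le> exp (x\<^sup>2 / 2)" by (simp only: exp_le_cancel_iff)
  moreover have "exp (ln (cosh x)) = cosh x" by (simp add: cosh_real_pos)
  ultimately show ?thesis by (simp only:)
qed

lemma exp_chord_le:
  fixes x \<eta> :: real
  assumes "0 \<le> x" "x \<le> 1"
  shows "exp (\<eta> * x) \<le> 1 - x + x * exp \<eta>"
  using convex_onD[OF exp_convex, of x 0 \<eta>] assms by (simp add: mult.commute)

text \<open>
  The product of the exponential moment of the loss of the drawn option and of the relative decrease
  of the total weight. It makes the potentials below supermartingales.
\<close>

lemma weighted_exp_product_le:
  fixes B :: "'a list" and w x :: "'a \<Rightarrow> real"
  assumes w: "\<And>e. e \<in> set B \<Longrightarrow> 0 \<le> w e" and x: "\<And>e. e \<in> set B \<Longrightarrow> 0 \<le> x e \<and> x e \<le> 1"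
    and eta: "0 \<le> \<eta>"
  shows "(\<Sum>e\<leftarrow>B. w e * exp (\<eta> * x e)) * (\<Sum>e\<leftarrow>B. w e * exp (- \<eta> * x e))
         \<le> exp (\<eta>\<^sup>2 / 2) * (\<Sum>e\<leftarrow>B. w e)\<^sup>2"
proof -
  define W where "W = (\<Sum>e\<leftarrow>B. w e)"
  define V where "V = (\<Sum>e\<leftarrow>B. w e * x e)"
  have V: "0 \<le> V" unfolding V_def using w x by (intro sum_list_nonneg) auto
  have "V \<le> W" unfolding V_def W_def
    using w x by (intro sum_list_mono) (simp add: mult_left_le)
  have bound: "(\<Sum>e\<leftarrow>B. w e * exp (s * x e)) \<le> W - V + V * exp s" for s
  proof -
    have "(\<Sum>e\<leftarrow>B. w e * exp (s * x e)) \<le> (\<Sum>e\<leftarrow>B. w e - w e * x e + w e * x e * exp s)"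
    proof (rule sum_list_mono)
      fix e assume e: "e \<in> set B"
      have "w e * exp (s * x e) \<le> w e * (1 - x e + x e * exp s)"
        using w[OF e] x[OF e] by (intro mult_left_mono exp_chord_le) auto
      then show "w e * exp (s * x e) \<le> w e - w e * x e + w e * x e * exp s" by (simp add: algebra_simps)
    qed
    also have "\<dots> = W - V + V * exp s"
      unfolding W_def V_def by (induction B) (auto simp: algebra_simps)
    finally show ?thesis .
  qed
  have "(\<Sum>e\<leftarrow>B. w e * exp (\<eta> * x e)) * (\<Sum>e\<leftarrow>B. w e * exp (- \<eta> * x e)) \<le>
      (W - V + V * exp \<eta>) * (W - V + V * exp (- \<eta>))"
    using bound[of \<eta>] bound[of "- \<eta>"] w V \<open>V \<le> W\<close>
    by (intro mult_mono) (auto intro!: sum_list_nonneg)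
  \<comment> \<open>Multiplying the bounds for \<open>\<eta>\<close> and \<open>- \<eta>\<close>
    cancels the linear drift: the exponentials appear only as the product 1 and the sum
    \<open>2 * cosh \<eta>\<close>.\<close>
  also have "\<dots> = (W - V)\<^sup>2 + V\<^sup>2 * (exp \<eta> * exp (- \<eta>)) + V * (W - V) * (exp \<eta> + exp (- \<eta>))"
    by (simp add: algebra_simps power2_eq_square)
  also have "\<dots> = (W - V)\<^sup>2 + V\<^sup>2 + V * (W - V) * (2 * cosh \<eta>)"
    by (simp add: exp_minus cosh_def)
  \<comment> \<open>The two squares are enlarged by the same factor, so that the terms combine to
    the full square \<open>W\<^sup>2\<close>.\<close>
  also have "\<dots> \<le> (W - V)\<^sup>2 * exp (\<eta>\<^sup>2 / 2) + V\<^sup>2 * exp (\<eta>\<^sup>2 / 2) + V * (W - V) * (2 * exp (\<eta>\<^sup>2 / 2))"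
    using V \<open>V \<le> W\<close> cosh_le_exp_square[OF eta]
    by (intro add_mono mult_left_mono) (auto simp: mult_le_cancel_left1)
  also have "\<dots> = exp (\<eta>\<^sup>2 / 2) * W\<^sup>2" by (simp add: algebra_simps power2_eq_square)
  finally show ?thesis by (simp add: W_def)
qed

text \<open>An expert may own several entries of a bucket; the sum over the list collects the
  probabilities of all its copies.\<close>

lemma nn_integral_pmf_of_list:
  fixes f :: "'a \<Rightarrow> real"
  assumes wf: "pmf_of_list_wf xs" and f: "\<And>x. 0 \<le> f x"
  shows "(\<integral>\<^sup>+ x. ennreal (f x) \<partial>pmf_of_list xs) = ennreal (\<Sum>z\<leftarrow>xs. snd z * f (fst z))"
proof -
  define A where "A = set (map fst xs)"
  have fin: "finite A" by (simp add: A_def)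
  have sub: "set_pmf (pmf_of_list xs) \<subseteq> A" unfolding A_def by (rule set_pmf_of_list[OF wf])
  have "(\<integral>\<^sup>+ x. ennreal (f x) \<partial>pmf_of_list xs) = (\<Sum>x\<in>A. ennreal (f x) * ennreal (pmf (pmf_of_list xs) x))"
    using sub by (intro nn_integral_measure_pmf_support fin) auto
  also have "\<dots> = ennreal (\<Sum>x\<in>A. f x * pmf (pmf_of_list xs) x)"
    using f by (simp add: ennreal_mult[symmetric] sum_ennreal)
  also have "(\<Sum>x\<in>A. f x * pmf (pmf_of_list xs) x) = (\<Sum>x\<in>A. f x * sum_list (map snd (filter (\<lambda>z. fst z = x) xs)))"
    by (simp add: pmf_pmf_of_list[OF wf])
  also have "\<dots> = (\<Sum>z\<leftarrow>xs. snd z * f (fst z))"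
  proof -
    have "(\<Sum>x\<in>A. f x * sum_list (map snd (filter (\<lambda>z. fst z = x) ys))) = (\<Sum>z\<leftarrow>ys. snd z * f (fst z))"
      if "set (map fst ys) \<subseteq> A" for ys :: "('a \<times> real) list"
      using that
    proof (induction ys)
      case (Cons z ys)
      have "(\<Sum>x\<in>A. f x * sum_list (map snd (filter (\<lambda>z. fst z = x) (z # ys)))) =
          (\<Sum>x\<in>A. (if fst z = x then f x * snd z else 0) + f x * sum_list (map snd (filter (\<lambda>z. fst z = x) ys)))"
        by (intro sum.cong) (auto simp: algebra_simps)
      also have "\<dots> = f (fst z) * snd z + (\<Sum>z\<leftarrow>ys. snd z * f (fst z))"
        using Cons fin by (simp add: sum.distrib)
      finally show ?case by (simp add: mult.commute)
    qed simp
    then show ?thesis by (simp add: A_def)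
  qed
  finally show ?thesis .
qed

lemma sum_list_divide_real: "(\<Sum>e\<leftarrow>B. f e / c) = (\<Sum>e\<leftarrow>B. f e) / c" for c :: real
  by (induction B) (auto simp: add_divide_distrib)

lemma sum_list_pos: "B \<noteq> [] \<Longrightarrow> (\<And>e. e \<in> set B \<Longrightarrow> 0 < f e) \<Longrightarrow> 0 < (\<Sum>e\<leftarrow>B. f e)" for f :: "'a \<Rightarrow> real"
proof (induction B)
  case (Cons a B)
  then show ?case by (cases "B = []") (auto intro: add_pos_pos)
qed simp

lemma draw_expert_step:
  fixes lt :: "nat \<Rightarrow> real"
  assumes B: "B \<noteq> []" "\<And>e. e \<in> set B \<Longrightarrow> 0 < entry_weight e"
    and lt: "\<And>e. e \<in> set B \<Longrightarrow> 0 \<le> lt (expert e) \<and> lt (expert e) \<le> 1" and eta: "0 \<le> \<eta>"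
  shows "(\<integral>\<^sup>+ x. ennreal (exp (\<eta> * lt x) * (\<Sum>e\<leftarrow>B. entry_weight e * exp (- \<eta> * lt (expert e)))) \<partial>draw_expert B)
         \<le> ennreal (exp (\<eta>\<^sup>2 / 2) * (\<Sum>e\<leftarrow>B. entry_weight e))"
proof -
  let ?W = "\<Sum>e\<leftarrow>B. entry_weight e" and ?D = "\<Sum>e\<leftarrow>B. entry_weight e * exp (- \<eta> * lt (expert e))"
  have W: "0 < ?W" using B by (intro sum_list_pos)
  have D: "0 \<le> ?D" using B by (intro sum_list_nonneg) (auto intro!: mult_nonneg_nonneg less_imp_le)
  have "(\<integral>\<^sup>+ x. ennreal (exp (\<eta> * lt x) * ?D) \<partial>draw_expert B) =
      ennreal (\<Sum>e\<leftarrow>B. entry_weight e / ?W * (exp (\<eta> * lt (expert e)) * ?D))"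
    unfolding draw_expert_def
    by (subst nn_integral_pmf_of_list[OF draw_expert_wf[OF B]]) (use D in \<open>auto simp: o_def\<close>)
  also have "(\<Sum>e\<leftarrow>B. entry_weight e / ?W * (exp (\<eta> * lt (expert e)) * ?D)) =
      (\<Sum>e\<leftarrow>B. entry_weight e * exp (\<eta> * lt (expert e))) * ?D / ?W"
    by (simp add: sum_list_divide_real[symmetric] sum_list_mult_const[symmetric] mult.assoc)
  also have "\<dots> \<le> exp (\<eta>\<^sup>2 / 2) * ?W\<^sup>2 / ?W"
    using weighted_exp_product_le[of B entry_weight "\<lambda>e. lt (expert e)" \<eta>] B(2) lt eta W
    by (intro divide_right_mono) (auto intro: less_imp_le)
  also have "\<dots> = exp (\<eta>\<^sup>2 / 2) * ?W" using W by (simp add: power2_eq_square)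
  finally show ?thesis by (simp add: ennreal_leI)
qed

lemma coin_step:
  fixes u v a b \<mu> :: real
  assumes "0 < u" "0 < v" "0 \<le> a" "a \<le> 1" "0 \<le> b" "b \<le> 1" "0 \<le> \<mu>"
  shows "(\<integral>\<^sup>+ z. ennreal (exp (\<mu> * (if z then a else b)) * (u * exp (- \<mu> * a) + v * exp (- \<mu> * b))) \<partial>bernoulli_pmf (u / (u + v)))
         \<le> ennreal (exp (\<mu>\<^sup>2 / 2) * (u + v))"
proof -
  let ?D = "u * exp (- \<mu> * a) + v * exp (- \<mu> * b)"
  have D: "0 \<le> ?D" using assms by (auto intro!: add_nonneg_nonneg)
  have p: "0 \<le> u / (u + v)" "u / (u + v) \<le> 1" and q: "1 - u / (u + v) = v / (u + v)" using assms by (auto simp: field_simps)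
  have "(\<integral>\<^sup>+ z. ennreal (exp (\<mu> * (if z then a else b)) * ?D) \<partial>bernoulli_pmf (u / (u + v))) =
      ennreal (exp (\<mu> * a) * ?D * (u / (u + v)) + exp (\<mu> * b) * ?D * (v / (u + v)))"
    using p D q assms by (simp add: ennreal_mult[symmetric] ennreal_plus[symmetric] del: ennreal_plus)
  also have "exp (\<mu> * a) * ?D * (u / (u + v)) + exp (\<mu> * b) * ?D * (v / (u + v)) =
      (u * exp (\<mu> * a) + v * exp (\<mu> * b)) * ?D / (u + v)"
    by (simp add: algebra_simps add_divide_distrib)
  also have "\<dots> \<le> exp (\<mu>\<^sup>2 / 2) * (u + v)\<^sup>2 / (u + v)"
  proof (intro divide_right_mono)
    have "(\<Sum>e\<leftarrow>[(u, a), (v, b)]. fst e * exp (\<mu> * snd e)) * (\<Sum>e\<leftarrow>[(u, a), (v, b)]. fst e * exp (- \<mu> * snd e))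
        \<le> exp (\<mu>\<^sup>2 / 2) * (\<Sum>e\<leftarrow>[(u, a), (v, b)]. fst e)\<^sup>2"
      using assms by (intro weighted_exp_product_le) auto
    then show "(u * exp (\<mu> * a) + v * exp (\<mu> * b)) * ?D \<le> exp (\<mu>\<^sup>2 / 2) * (u + v)\<^sup>2" by simp
  qed (use assms in simp)
  also have "\<dots> = exp (\<mu>\<^sup>2 / 2) * (u + v)" using assms by (simp add: power2_eq_square)
  finally show ?thesis by (simp add: ennreal_leI)
qed

lemma final_choice_upd: "j < i \<Longrightarrow> final_choice e (c(i := z)) j = final_choice e c j"
  by (induction j) auto

section \<open>Supermartingales for the bucket draws and the between-level coins\<close>

context algorithm
begin

definition drawn :: "history \<Rightarrow> nat \<Rightarrow> nat \<Rightarrow> nat" where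
  "drawn h i t = fst (snd (h ! t)) i"

definition chosen :: "history \<Rightarrow> nat \<Rightarrow> nat \<Rightarrow> nat" where
  "chosen h i t = choice i (h ! t)"

lemma update_with_at_start:
  assumes "i \<le> top_level p t"
  shows "(\<forall>e\<in>set (bucket (update_with p t s xss) i). entry_weight e = 1) \<and>
    mix_weights (update_with p t s xss) i = (1, 1) \<and>
    length (xss ! i) \<le> length (bucket (update_with p t s xss) i)"
proof -
  have "entry_weight e = 1" if "e \<in> set (evict p t B)" for e B
    using that by (auto simp: evict_def)
  moreover have "length (sampled p t i xs) = length xs" for xs by (simp add: sampled_def)
  ultimately show ?thesis
    using assms forwarded_entry sampled_entry by (auto simp: update_with_def Let_def)
qed

text \<open>Level \<open>i\<close> is updated at the start of a window and then not before its end.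
  Hence its list of experts, its size and its learning rate stay fixed, and the weights, reset to 1
  at \<open>w\<close>, depend only on the losses since \<open>w\<close>.\<close>

lemma window_state:
  assumes h: "is_history p l h" and i: "i < k" "P i dvd w" and t: "w \<le> t" "t < length h" "t < w + P i"
  shows "map (\<lambda>e. (expert e, entry_weight e)) (bucket (fst (h ! t)) i) =
      map (\<lambda>e. (expert e, exp (- bucket_rate p i (bucket (fst (h ! w)) i) * L (expert e) w t)))
        (bucket (fst (h ! w)) i) \<and>
    mix_weights (fst (h ! t)) i =
      (exp (- mix_rate p i * (\<Sum>\<tau>=w..<t. l \<tau> (drawn h i \<tau>))),
       exp (- mix_rate p i * (\<Sum>\<tau>=w..<t. l \<tau> (chosen h (i - 1) \<tau>))))"
  using t
proof (induction t rule: dec_induct)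
  case base
  have "i \<le> top_level p w" using le_top_level_iff i by simp
  moreover obtain xss where "fst (h ! w) = update_with p w (current p l (take w h)) xss"
    using set_pmf_update_step[OF history_record(1)[OF h base(1)]] by metis
  ultimately show ?case
    using update_with_at_start[of i w "current p l (take w h)" xss] by (simp add: L_def)
next
  case (step t)
  let ?B = "bucket (fst (h ! w)) i" and ?Bt = "bucket (fst (h ! t)) i"
  let ?r = "bucket_rate p i ?B"
  have IH: "map (\<lambda>e. (expert e, entry_weight e)) ?Bt =
      map (\<lambda>e. (expert e, exp (- ?r * L (expert e) w t))) ?B"
    "mix_weights (fst (h ! t)) i =
      (exp (- mix_rate p i * (\<Sum>\<tau>=w..<t. l \<tau> (drawn h i \<tau>))),
       exp (- mix_rate p i * (\<Sum>\<tau>=w..<t. l \<tau> (chosen h (i - 1) \<tau>))))"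
    using step by auto
  have len: "length ?Bt = length ?B" using arg_cong[OF IH(1), of length] by simp
  then have rate: "bucket_rate p i ?Bt = ?r" by (simp add: bucket_rate_def)
  have "\<not> P i dvd Suc t"
  proof
    assume "P i dvd Suc t"
    then have "w + P i \<le> Suc t" using i step by (intro dvd_gap) auto
    then show False using step by simp
  qed
  then have "\<not> i \<le> top_level p (Suc t)" using le_top_level_iff i by simp
  moreover obtain xss where "fst (h ! Suc t) = update_with p (Suc t) (current p l (take (Suc t) h)) xss"
    using set_pmf_update_step[OF history_record(1)[OF h step.prems(1)]] by metis
  ultimately have st: "bucket (fst (h ! Suc t)) i = bucket (current p l (take (Suc t) h)) i"
    "mix_weights (fst (h ! Suc t)) i = mix_weights (current p l (take (Suc t) h)) i"
    by (simp_all add: update_with_def Let_def)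
  have cur: "current p l (take (Suc t) h) = observe p (l t) (fst (snd (h ! t))) (snd (snd (h ! t))) (fst (h ! t))"
    using step.prems by (intro current_take_Suc) simp
  have "map (\<lambda>e. (expert e, entry_weight e)) (bucket (fst (h ! Suc t)) i) =
      map (\<lambda>(x, v). (x, v * exp (- ?r * l t x))) (map (\<lambda>e. (expert e, entry_weight e)) ?Bt)"
    unfolding st cur by (simp add: observe_def rate)
  also have "\<dots> = map (\<lambda>e. (expert e, exp (- ?r * L (expert e) w (Suc t)))) ?B"
    unfolding IH(1) using step.hyps(1) by (simp add: L_def exp_add[symmetric] algebra_simps)
  finally show ?case
    using step.hyps(1) IH(2)
    by (simp add: st cur observe_def drawn_def chosen_def choice_def exp_add[symmetric] algebra_simps)
qed

lemma sum_window_weights: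
  assumes "is_history p l h" "i < k" "P i dvd w" "w \<le> t" "t < length h" "t < w + P i"
  shows "(\<Sum>e\<leftarrow>bucket (fst (h ! t)) i. entry_weight e * f (expert e)) =
    (\<Sum>e\<leftarrow>bucket (fst (h ! w)) i. exp (- bucket_rate p i (bucket (fst (h ! w)) i) * L (expert e) w t) * f (expert e))"
  using arg_cong[OF conjunct1[OF window_state[OF assms]], of "\<lambda>ys. \<Sum>(x, v)\<leftarrow>ys. v * f x"]
  by (simp add: o_def)

lemma bucket_start_nonempty:
  assumes "is_history p l h" "i < k" "P i dvd w" "w < length h"
  shows "bucket (fst (h ! w)) i \<noteq> []"
proof -
  have i: "i \<le> top_level p w" using le_top_level_iff assms by simp
  obtain xss where xss: "fst (h ! w) = update_with p w (current p l (take w h)) xss" "length (xss ! i) = m"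
    using set_pmf_update_step[OF history_record(1)[OF assms(1,4)]] i by metis
  then have "m \<le> length (bucket (fst (h ! w)) i)" using update_with_at_start[OF i, of "current p l (take w h)" xss] by simp
  then show ?thesis using space by auto
qed

lemma bucket_wf:
  assumes h: "is_history p l h" and i: "i < k" and t: "t < length h"
  shows "bucket (fst (h ! t)) i \<noteq> []" "e \<in> set (bucket (fst (h ! t)) i) \<Longrightarrow> 0 < entry_weight e"
    "0 < fst (mix_weights (fst (h ! t)) i)" "0 < snd (mix_weights (fst (h ! t)) i)"
proof -
  define w where "w = wstart i t"
  have w: "P i dvd w" "w \<le> t" "t < w + P i"
    unfolding w_def using dvd_wstart wstart_le less_wstart_add i by auto
  note ws = window_state[OF h i w(1,2) t w(3)]
  have "length (bucket (fst (h ! t)) i) = length (bucket (fst (h ! w)) i)"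
    using arg_cong[OF conjunct1[OF ws], of length] by simp
  then show "bucket (fst (h ! t)) i \<noteq> []"
    using bucket_start_nonempty[OF h i w(1)] w t by auto
  show "0 < entry_weight e" if "e \<in> set (bucket (fst (h ! t)) i)"
  proof -
    have "(expert e, entry_weight e) \<in> set (map (\<lambda>e. (expert e, entry_weight e)) (bucket (fst (h ! t)) i))"
      using that by auto
    then show ?thesis unfolding conjunct1[OF ws] by auto
  qed
  show "0 < fst (mix_weights (fst (h ! t)) i)" "0 < snd (mix_weights (fst (h ! t)) i)"
    using conjunct2[OF ws] by auto
qed

lemma entries_ok_post:
  assumes "is_history p l h" "t < length h" "e \<in> set (bucket (fst (h ! t)) i)"
  shows "entry_ok t (Suc t) e"
  using entries_ok_pre[OF assms(1)] assms(2,3)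
  by (intro entries_ok_update[OF _ history_record(1)[OF assms(1,2)]]) auto

lemma draws_expert:
  assumes h: "is_history p l h" and t: "t < length h" and i: "i < k"
    and e: "e \<in> set_pmf (Pi_pmf {..<k} 0 (\<lambda>i. draw_expert (bucket (fst (h ! t)) i)))"
  shows "e i \<in> expert ` set (bucket (fst (h ! t)) i)" "e i < n"
proof -
  let ?B = "bucket (fst (h ! t)) i"
  have "e i \<in> set_pmf (map_pmf (\<lambda>f. f i) (Pi_pmf {..<k} 0 (\<lambda>i. draw_expert (bucket (fst (h ! t)) i))))"
    using e by auto
  then have "e i \<in> set_pmf (draw_expert ?B)" using i by (subst (asm) Pi_pmf_component) auto
  then show *: "e i \<in> expert ` set ?B"
    unfolding draw_expert_def using set_pmf_of_list[OF draw_expert_wf, of ?B] bucket_wf[OF h i t] by force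
  then obtain e' where e': "e' \<in> set ?B" "e i = expert e'" by auto
  then show "e i < n" using entries_ok_post[OF h t e'(1)] by (simp add: entry_ok_def)
qed

lemma final_choice_cases: "\<exists>j\<le>i. final_choice e c i = e j"
  by (induction i) (auto intro: le_SucI)

lemma drawn_mem:
  assumes "is_history p l h" "t < length h" "i < k"
  shows "drawn h i t \<in> expert ` set (bucket (fst (h ! t)) i)" "drawn h i t < n" "chosen h i t < n"
proof -
  have e: "fst (snd (h ! t)) \<in> set_pmf (Pi_pmf {..<k} 0 (\<lambda>i. draw_expert (bucket (fst (h ! t)) i)))"
    using history_record(2)[OF assms(1,2)] by (auto simp: draws_def)
  show "drawn h i t \<in> expert ` set (bucket (fst (h ! t)) i)" "drawn h i t < n"
    unfolding drawn_def using draws_expert[OF assms e] by auto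
  obtain j where "j \<le> i" "chosen h i t = fst (snd (h ! t)) j"
    unfolding chosen_def choice_def using final_choice_cases by metis
  then show "chosen h i t < n" using draws_expert(2)[OF assms(1,2) _ e, of j] assms(3) by simp
qed

lemma is_history_snoc:
  assumes "is_history p l h" "s' \<in> set_pmf (update_step p (length h) (current p l h))"
    "ec \<in> set_pmf (draws p s')"
  shows "is_history p l (h @ [(s', ec)])"
  using assms by (auto simp: is_history_def nth_append less_Suc_eq record_day_def)

lemma loss_bounds: "t < T \<Longrightarrow> x < n \<Longrightarrow> 0 \<le> l t x \<and> l t x \<le> 1"
  using losses by (simp add: loss_sequence_def)

text \<open>Dividing by the bucket size makes the value 1 at the start of the window. Before that it
  is set to 1, as the bucket and its learning rate are not determined yet.\<close>

definition bucket_potential :: "nat \<Rightarrow> nat \<Rightarrow> history \<Rightarrow> real" where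
  "bucket_potential i w h =
     (if length h \<le> w then 1
      else let B = bucket (fst (h ! w)) i; \<eta> = bucket_rate p i B in
        exp (\<eta> * (\<Sum>\<tau>=w..<length h. l \<tau> (drawn h i \<tau>)) - \<eta>\<^sup>2 * real (length h - w) / 2) *
        (\<Sum>e\<leftarrow>B. exp (- \<eta> * L (expert e) w (length h))) / real (length B))"

lemma drawn_snoc: "\<tau> < length h \<Longrightarrow> drawn (h @ [r]) i \<tau> = drawn h i \<tau>"
  and drawn_snoc_last: "drawn (h @ [r]) i (length h) = fst (snd r) i"
  and chosen_snoc: "\<tau> < length h \<Longrightarrow> chosen (h @ [r]) i \<tau> = chosen h i \<tau>"
  and chosen_snoc_last: "chosen (h @ [r]) i (length h) = choice i r"
  by (auto simp: drawn_def chosen_def nth_append)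

lemma bucket_potential_step:
  assumes h: "h \<in> set_pmf (hrun p l t)" and i: "i < k" "P i dvd w" and t: "w \<le> t" "t < w + P i" "t < T"
  shows "(\<integral>\<^sup>+ r. ennreal (bucket_potential i w (h @ [r])) \<partial>record_day p t (current p l h))
         \<le> ennreal (bucket_potential i w h)"
proof -
  have len: "length h = t" and hist: "is_history p l h" using set_pmf_hrun[OF h] by auto
  have "(\<integral>\<^sup>+ ec. ennreal (bucket_potential i w (h @ [(s', ec)])) \<partial>draws p s') \<le> ennreal (bucket_potential i w h)"
    if s': "s' \<in> set_pmf (update_step p t (current p l h))" for s'
  proof -
    \<comment> \<open>Facts about buckets are stated for histories, so the new state is completed by
      an arbitrary possible draw; the conclusions used below concern \<open>s'\<close> only.\<close>
    obtain ec0 where ec0: "ec0 \<in> set_pmf (draws p s')" using set_pmf_not_empty[of "draws p s'"] by auto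
    define h0 where "h0 = h @ [(s', ec0)]"
    have hist0: "is_history p l h0"
      unfolding h0_def using s' len by (intro is_history_snoc hist ec0) simp
    have t0: "t < length h0" and at: "fst (h0 ! t) = s'" by (auto simp: h0_def len nth_append)
    define B where "B = bucket (fst (h0 ! w)) i"
    define \<eta> where "\<eta> = bucket_rate p i B"
    define K where "K = exp (\<eta> * (\<Sum>\<tau>=w..<t. l \<tau> (drawn h i \<tau>)) - \<eta>\<^sup>2 * real (t - w) / 2) / real (length B)"
    let ?B' = "bucket s' i"
    have B_snoc: "bucket (fst ((h @ [(s', ec)]) ! w)) i = B" for ec
      using t len by (cases "w = t") (auto simp: B_def h0_def nth_append)
    have Bne: "B \<noteq> []" unfolding B_def using t t0 by (intro bucket_start_nonempty hist0 i) simp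
    have "1 \<le> length B" using Bne by (simp add: Suc_le_eq)
    then have "0 \<le> ln (real (length B))" by simp
    then have eta: "0 \<le> \<eta>" by (simp add: \<eta>_def bucket_rate_def)
    have K: "0 \<le> K" by (simp add: K_def)
    have sumw: "(\<Sum>e\<leftarrow>?B'. entry_weight e * f (expert e)) = (\<Sum>e\<leftarrow>B. exp (- \<eta> * L (expert e) w t) * f (expert e))" for f
      using sum_window_weights[OF hist0 i t(1) t0 t(2), of f] unfolding at B_def \<eta>_def .
    have wf: "?B' \<noteq> []" "\<And>e. e \<in> set ?B' \<Longrightarrow> 0 < entry_weight e"
      using bucket_wf(1,2)[OF hist0 i(1) t0] unfolding at by auto
    have lt: "0 \<le> l t (expert e) \<and> l t (expert e) \<le> 1" if "e \<in> set ?B'" for e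
      using entries_ok_post[OF hist0 t0, of e i] that at t(3) by (intro loss_bounds) (auto simp: entry_ok_def)
    have pot: "bucket_potential i w (h @ [(s', ec)]) = K * exp (- (\<eta>\<^sup>2 / 2)) *
        (exp (\<eta> * l t (fst ec i)) * (\<Sum>e\<leftarrow>?B'. entry_weight e * exp (- \<eta> * l t (expert e))))" for ec
    proof -
      have 1: "(\<Sum>\<tau>=w..<Suc t. l \<tau> (drawn (h @ [(s', ec)]) i \<tau>)) = (\<Sum>\<tau>=w..<t. l \<tau> (drawn h i \<tau>)) + l t (fst ec i)"
        using t(1) len drawn_snoc_last[of h "(s', ec)" i] by (simp add: drawn_snoc)
      have 2: "(\<Sum>e\<leftarrow>B. exp (- \<eta> * L (expert e) w (Suc t))) = (\<Sum>e\<leftarrow>?B'. entry_weight e * exp (- \<eta> * l t (expert e)))"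
        unfolding sumw[of "\<lambda>x. exp (- \<eta> * l t x)"] using t(1) by (simp add: L_def exp_add[symmetric] algebra_simps)
      have 3: "\<eta> * (S + x) - \<eta>\<^sup>2 * real (Suc t - w) / 2 = (\<eta> * S - \<eta>\<^sup>2 * real (t - w) / 2) + (- (\<eta>\<^sup>2 / 2)) + \<eta> * x" for S x
      proof -
        have "real (Suc t - w) = real (t - w) + 1" using t(1) by (simp add: Suc_diff_le)
        moreover have "\<eta> * (S + x) - \<eta>\<^sup>2 * (d + 1) / 2 = (\<eta> * S - \<eta>\<^sup>2 * d / 2) + (- (\<eta>\<^sup>2 / 2)) + \<eta> * x" for d
          by (simp add: field_simps)
        ultimately show ?thesis by (simp only:)
      qed
      have "bucket_potential i w (h @ [(s', ec)]) =
          exp (\<eta> * (\<Sum>\<tau>=w..<Suc t. l \<tau> (drawn (h @ [(s', ec)]) i \<tau>)) - \<eta>\<^sup>2 * real (Suc t - w) / 2) *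
          (\<Sum>e\<leftarrow>B. exp (- \<eta> * L (expert e) w (Suc t))) / real (length B)"
        using t(1) by (simp add: bucket_potential_def Let_def len B_snoc \<eta>_def)
      also have "\<dots> = K * exp (- (\<eta>\<^sup>2 / 2)) *
          (exp (\<eta> * l t (fst ec i)) * (\<Sum>e\<leftarrow>?B'. entry_weight e * exp (- \<eta> * l t (expert e))))"
        unfolding 1 2 3 exp_add K_def by simp
      finally show ?thesis .
    qed
    have "(\<integral>\<^sup>+ ec. ennreal (bucket_potential i w (h @ [(s', ec)])) \<partial>draws p s') =
        ennreal (K * exp (- (\<eta>\<^sup>2 / 2))) * (\<integral>\<^sup>+ ec. ennreal (exp (\<eta> * l t (fst ec i)) * (\<Sum>e\<leftarrow>?B'. entry_weight e * exp (- \<eta> * l t (expert e)))) \<partial>draws p s')"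
      unfolding pot using K by (subst nn_integral_cmult[symmetric]) (auto simp: ennreal_mult')
    also have "(\<integral>\<^sup>+ ec. ennreal (exp (\<eta> * l t (fst ec i)) * (\<Sum>e\<leftarrow>?B'. entry_weight e * exp (- \<eta> * l t (expert e)))) \<partial>draws p s') =
        (\<integral>\<^sup>+ x. ennreal (exp (\<eta> * l t x) * (\<Sum>e\<leftarrow>?B'. entry_weight e * exp (- \<eta> * l t (expert e)))) \<partial>map_pmf (\<lambda>f. f i) (Pi_pmf {..<k} 0 (\<lambda>i. draw_expert (bucket s' i))))"
      by (simp add: draws_def nn_integral_pair_pmf')
    also have "\<dots> = (\<integral>\<^sup>+ x. ennreal (exp (\<eta> * l t x) * (\<Sum>e\<leftarrow>?B'. entry_weight e * exp (- \<eta> * l t (expert e)))) \<partial>draw_expert ?B')"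
      using i by (subst Pi_pmf_component) auto
    also have "\<dots> \<le> ennreal (exp (\<eta>\<^sup>2 / 2) * (\<Sum>e\<leftarrow>?B'. entry_weight e))"
      by (rule draw_expert_step[where lt = "l t", OF wf lt eta])
    also have "ennreal (K * exp (- (\<eta>\<^sup>2 / 2))) * ennreal (exp (\<eta>\<^sup>2 / 2) * (\<Sum>e\<leftarrow>?B'. entry_weight e)) =
        ennreal (K * (\<Sum>e\<leftarrow>?B'. entry_weight e))"
      using K by (subst ennreal_mult'[symmetric]) (auto simp: exp_minus field_simps)
    also have "(\<Sum>e\<leftarrow>?B'. entry_weight e) = (\<Sum>e\<leftarrow>B. exp (- \<eta> * L (expert e) w t))"
      using sumw[of "\<lambda>_. 1"] by simp
    also have "K * (\<Sum>e\<leftarrow>B. exp (- \<eta> * L (expert e) w t)) = bucket_potential i w h"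
    proof (cases "t = w")
      case True
      have "(\<Sum>e\<leftarrow>B. 1) = real (length B)" by (induction B) auto
      then show ?thesis using True Bne len by (simp add: bucket_potential_def K_def L_def)
    next
      case False
      then have "bucket (fst (h ! w)) i = B" using t len by (simp add: B_def h0_def nth_append)
      then show ?thesis using False t len by (simp add: bucket_potential_def K_def \<eta>_def Let_def)
    qed
    finally show ?thesis by (simp add: mult_left_mono)
  qed
  then have "(\<integral>\<^sup>+ s'. (\<integral>\<^sup>+ ec. ennreal (bucket_potential i w (h @ [(s', ec)])) \<partial>draws p s') \<partial>update_step p t (current p l h)) \<le>
      (\<integral>\<^sup>+ s'. ennreal (bucket_potential i w h) \<partial>update_step p t (current p l h))"
    by (intro nn_integral_mono_AE) (auto simp: AE_measure_pmf_iff)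
  then show ?thesis by (simp add: record_day_def)
qed

definition mix_potential :: "nat \<Rightarrow> nat \<Rightarrow> history \<Rightarrow> real" where
  "mix_potential i w h =
     exp (mix_rate p i * (\<Sum>\<tau>=w..<length h. l \<tau> (chosen h i \<tau>)) - (mix_rate p i)\<^sup>2 * real (length h - w) / 2) *
     (exp (- mix_rate p i * (\<Sum>\<tau>=w..<length h. l \<tau> (drawn h i \<tau>))) +
      exp (- mix_rate p i * (\<Sum>\<tau>=w..<length h. l \<tau> (chosen h (i - 1) \<tau>)))) / 2"

text \<open>Both options of level \<open>i\<close> are random on the same day. Conditioning on all
  expert draws and on all coins except the \<open>i\<close>-th fixes their two losses, and the
  two-option inequality applies to the remaining coin.\<close>

lemma mix_potential_step:
  assumes h: "h \<in> set_pmf (hrun p l t)" and i: "0 < i" "i < k" "P i dvd w" and t: "w \<le> t" "t < w + P i" "t < T"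
  shows "(\<integral>\<^sup>+ r. ennreal (mix_potential i w (h @ [r])) \<partial>record_day p t (current p l h))
         \<le> ennreal (mix_potential i w h)"
proof -
  have len: "length h = t" and hist: "is_history p l h" using set_pmf_hrun[OF h] by auto
  define \<mu> where "\<mu> = mix_rate p i"
  have mu: "0 \<le> \<mu>" by (simp add: \<mu>_def mix_rate_def)
  define K where "K = exp (\<mu> * (\<Sum>\<tau>=w..<t. l \<tau> (chosen h i \<tau>)) - \<mu>\<^sup>2 * real (t - w) / 2) / 2"
  have K: "0 \<le> K" by (simp add: K_def)
  have "(\<integral>\<^sup>+ ec. ennreal (mix_potential i w (h @ [(s', ec)])) \<partial>draws p s') \<le> ennreal (mix_potential i w h)"
    if s': "s' \<in> set_pmf (update_step p t (current p l h))" for s'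
  proof -
    obtain ec0 where ec0: "ec0 \<in> set_pmf (draws p s')" using set_pmf_not_empty[of "draws p s'"] by auto
    define h0 where "h0 = h @ [(s', ec0)]"
    have hist0: "is_history p l h0"
      unfolding h0_def using s' len by (intro is_history_snoc hist ec0) simp
    have t0: "t < length h0" and at: "fst (h0 ! t) = s'" by (auto simp: h0_def len nth_append)
    let ?u = "fst (mix_weights s' i)" and ?v = "snd (mix_weights s' i)"
    have "(\<Sum>\<tau>=w..<t. l \<tau> (drawn h0 i \<tau>)) = (\<Sum>\<tau>=w..<t. l \<tau> (drawn h i \<tau>))"
      "(\<Sum>\<tau>=w..<t. l \<tau> (chosen h0 (i - 1) \<tau>)) = (\<Sum>\<tau>=w..<t. l \<tau> (chosen h (i - 1) \<tau>))"
      by (intro sum.cong; simp add: h0_def len drawn_snoc chosen_snoc)+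
    then have uv: "?u = exp (- \<mu> * (\<Sum>\<tau>=w..<t. l \<tau> (drawn h i \<tau>)))"
      "?v = exp (- \<mu> * (\<Sum>\<tau>=w..<t. l \<tau> (chosen h (i - 1) \<tau>)))"
      using conjunct2[OF window_state[OF hist0 i(2,3) t(1) t0 t(2)]] unfolding at by (simp_all add: \<mu>_def)
    have uv_pos: "0 < ?u" "0 < ?v" unfolding uv by simp_all
    let ?a = "\<lambda>e. l t (e i)" and ?b = "\<lambda>e c. l t (final_choice e c (i - 1))"
    let ?g = "\<lambda>e c. exp (\<mu> * l t (final_choice e c i)) * (?u * exp (- \<mu> * ?a e) + ?v * exp (- \<mu> * ?b e c))"
    have pot: "mix_potential i w (h @ [(s', ec)]) = K * exp (- (\<mu>\<^sup>2 / 2)) * ?g (fst ec) (snd ec)" for ec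
    proof -
      have 1: "(\<Sum>\<tau>=w..<Suc t. l \<tau> (chosen (h @ [(s', ec)]) j \<tau>)) =
          (\<Sum>\<tau>=w..<t. l \<tau> (chosen h j \<tau>)) + l t (final_choice (fst ec) (snd ec) j)" for j
        using t(1) len chosen_snoc_last[of h "(s', ec)" j] by (simp add: chosen_snoc choice_def)
      have 2: "(\<Sum>\<tau>=w..<Suc t. l \<tau> (drawn (h @ [(s', ec)]) i \<tau>)) = (\<Sum>\<tau>=w..<t. l \<tau> (drawn h i \<tau>)) + ?a (fst ec)"
        using t(1) len drawn_snoc_last[of h "(s', ec)" i] by (simp add: drawn_snoc)
      have 3: "\<mu> * (S + x) - \<mu>\<^sup>2 * real (Suc t - w) / 2 = (\<mu> * S - \<mu>\<^sup>2 * real (t - w) / 2) + (- (\<mu>\<^sup>2 / 2)) + \<mu> * x" for S x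
      proof -
        have "real (Suc t - w) = real (t - w) + 1" using t(1) by (simp add: Suc_diff_le)
        moreover have "\<mu> * (S + x) - \<mu>\<^sup>2 * (d + 1) / 2 = (\<mu> * S - \<mu>\<^sup>2 * d / 2) + (- (\<mu>\<^sup>2 / 2)) + \<mu> * x" for d
          by (simp add: field_simps)
        ultimately show ?thesis by (simp only:)
      qed
      have 4: "exp (- \<mu> * (S + x)) = exp (- \<mu> * S) * exp (- \<mu> * x)" for S x
        by (simp add: exp_add[symmetric] algebra_simps)
      have "length (h @ [(s', ec)]) = Suc t" using len by simp
      then show ?thesis
        unfolding mix_potential_def \<mu>_def[symmetric] uv K_def by (simp only: 1 2 3 4 exp_add)
    qed
    have day: "(\<integral>\<^sup>+ ec. ennreal (?g (fst ec) (snd ec)) \<partial>draws p s') \<le> ennreal (exp (\<mu>\<^sup>2 / 2) * (?u + ?v))"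
    proof -
      let ?E = "Pi_pmf {..<k} 0 (\<lambda>i. draw_expert (bucket s' i))"
      let ?q = "\<lambda>i. bernoulli_pmf (fst (mix_weights s' i) / (fst (mix_weights s' i) + snd (mix_weights s' i)))"
      have ins: "{1..<k} = insert i ({1..<k} - {i})" using i by auto
      have C: "Pi_pmf {1..<k} False ?q =
          map_pmf (\<lambda>(f, z). f(i := z)) (pair_pmf (Pi_pmf ({1..<k} - {i}) False ?q) (?q i))"
        by (subst ins, subst Pi_pmf_insert, simp, simp, subst pair_commute_pmf)
           (simp add: pmf.map_comp o_def case_prod_unfold)
      have "(\<integral>\<^sup>+ c. ennreal (?g e c) \<partial>Pi_pmf {1..<k} False ?q) \<le> ennreal (exp (\<mu>\<^sup>2 / 2) * (?u + ?v))"
        if e: "e \<in> set_pmf ?E" for e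
      proof -
        have en: "e j < n" if "j < k" for j
          using draws_expert(2)[OF hist0 t0 that, of e] e by (simp add: at)
        have "(\<integral>\<^sup>+ z. ennreal (?g e (f(i := z))) \<partial>?q i) \<le> ennreal (exp (\<mu>\<^sup>2 / 2) * (?u + ?v))" for f
        proof -
          have less: "i - 1 < i" using i by simp
          have fc: "final_choice e (f(i := z)) i = (if z then e i else final_choice e f (i - 1))" for z
            using i by (cases i) (auto simp: final_choice_upd)
          obtain j where j: "j \<le> i - 1" "final_choice e f (i - 1) = e j" using final_choice_cases by blast
          have a: "0 \<le> ?a e \<and> ?a e \<le> 1" using en i t by (intro loss_bounds) auto
          have b: "0 \<le> ?b e f \<and> ?b e f \<le> 1" using en[of j] j i t by (intro loss_bounds) auto
          have "?g e (f(i := z)) = exp (\<mu> * (if z then ?a e else ?b e f)) * (?u * exp (- \<mu> * ?a e) + ?v * exp (- \<mu> * ?b e f))" for z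
            unfolding fc final_choice_upd[OF less] by simp
          then show ?thesis using coin_step[OF uv_pos, of "?a e" "?b e f" \<mu>] a b mu by simp
        qed
        then have "(\<integral>\<^sup>+ f. (\<integral>\<^sup>+ z. ennreal (?g e (f(i := z))) \<partial>?q i) \<partial>Pi_pmf ({1..<k} - {i}) False ?q) \<le>
            (\<integral>\<^sup>+ f. ennreal (exp (\<mu>\<^sup>2 / 2) * (?u + ?v)) \<partial>Pi_pmf ({1..<k} - {i}) False ?q)"
          by (intro nn_integral_mono)
        then show ?thesis unfolding C by (simp add: nn_integral_pair_pmf')
      qed
      then have "(\<integral>\<^sup>+ e. (\<integral>\<^sup>+ c. ennreal (?g e c) \<partial>Pi_pmf {1..<k} False ?q) \<partial>?E) \<le>
          (\<integral>\<^sup>+ e. ennreal (exp (\<mu>\<^sup>2 / 2) * (?u + ?v)) \<partial>?E)"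
        by (intro nn_integral_mono_AE) (auto simp: AE_measure_pmf_iff)
      then show ?thesis by (simp add: draws_def nn_integral_pair_pmf')
    qed
    have "(\<integral>\<^sup>+ ec. ennreal (mix_potential i w (h @ [(s', ec)])) \<partial>draws p s') =
        ennreal (K * exp (- (\<mu>\<^sup>2 / 2))) * (\<integral>\<^sup>+ ec. ennreal (?g (fst ec) (snd ec)) \<partial>draws p s')"
      unfolding pot using K by (subst nn_integral_cmult[symmetric]) (auto simp: ennreal_mult')
    also have "\<dots> \<le> ennreal (K * exp (- (\<mu>\<^sup>2 / 2))) * ennreal (exp (\<mu>\<^sup>2 / 2) * (?u + ?v))"
      using day by (intro mult_left_mono) auto
    also have "\<dots> = ennreal (K * (?u + ?v))"
    proof -
      have "K * exp (- (\<mu>\<^sup>2 / 2)) * (exp (\<mu>\<^sup>2 / 2) * y) = K * y" for y by (simp add: exp_minus)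
      then show ?thesis using K by (subst ennreal_mult'[symmetric]) (auto simp only: mult_nonneg_nonneg exp_ge_zero)
    qed
    also have "K * (?u + ?v) = mix_potential i w h"
      by (simp add: mix_potential_def K_def uv \<mu>_def len)
    finally show ?thesis .
  qed
  then have "(\<integral>\<^sup>+ s'. (\<integral>\<^sup>+ ec. ennreal (mix_potential i w (h @ [(s', ec)])) \<partial>draws p s') \<partial>update_step p t (current p l h)) \<le>
      (\<integral>\<^sup>+ s'. ennreal (mix_potential i w h) \<partial>update_step p t (current p l h))"
    by (intro nn_integral_mono_AE) (auto simp: AE_measure_pmf_iff)
  then show ?thesis by (simp add: record_day_def)
qed

section \<open>A crude bound on bucket sizes\<close>

lemma sum_powers_le: "1 + (\<Sum>j\<le>i. t ^ Suc j) \<le> Suc t ^ Suc i" for t :: nat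
proof (induction i)
  case (Suc i)
  have "1 + (\<Sum>j\<le>Suc i. t ^ Suc j) \<le> Suc t ^ Suc i + t ^ Suc (Suc i)" using Suc by simp
  also have "t ^ Suc (Suc i) \<le> t * Suc t ^ Suc i" using power_mono[of t "Suc t" "Suc i"] by simp
  finally show ?case by simp
qed simp

lemma length_update_with:
  assumes "\<And>i. i < k \<Longrightarrow> length (bucket s i) \<le> m * t ^ Suc i"
    and "\<And>i. i \<le> top_level p t \<Longrightarrow> length (xss ! i) = m" and i: "i < k"
  shows "length (bucket (update_with p t s xss) i) \<le> m * Suc t ^ Suc i"
proof (cases "i \<le> top_level p t")
  case False
  have "m * t ^ Suc i \<le> m * Suc t ^ Suc i" by (intro mult_le_mono2 power_mono) auto
  with assms(1)[OF i] have "length (bucket s i) \<le> m * Suc t ^ Suc i" by (rule le_trans)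
  moreover have "bucket (update_with p t s xss) i = bucket s i"
    using False by (simp add: update_with_def Let_def)
  ultimately show ?thesis by (simp only:)
next
  case True
  have ev: "length (evict p t B) \<le> length B" for B by (simp add: evict_def)
  have "length (bucket (update_with p t s xss) i) =
      length (evict p t (bucket s i)) + (\<Sum>j<i. length (evict p t (bucket s j))) + m"
    using True assms(2)[OF True]
    by (simp add: update_with_def Let_def forwarded_def sampled_def length_concat o_def
        interv_sum_list_conv_sum_set_nat atLeast0LessThan)
  also have "\<dots> \<le> length (bucket s i) + (\<Sum>j<i. length (bucket s j)) + m"
    by (intro add_mono sum_mono ev order_refl)
  also have "\<dots> = (\<Sum>j\<le>i. length (bucket s j)) + m" by (simp add: lessThan_Suc_atMost[symmetric])
  also have "\<dots> \<le> (\<Sum>j\<le>i. m * t ^ Suc j) + m"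
    using assms(1) i by (intro add_mono sum_mono) auto
  also have "\<dots> = m * (1 + (\<Sum>j\<le>i. t ^ Suc j))" by (simp only: sum_distrib_left[symmetric]) (simp add: algebra_simps)
  also have "\<dots> \<le> m * Suc t ^ Suc i" by (intro mult_le_mono2 sum_powers_le)
  finally show ?thesis .
qed

text \<open>An update makes bucket \<open>i\<close> at most as large as all buckets up to
  \<open>i\<close> together plus \<open>m\<close>. Ignoring evictions gives a polynomial of degree
  \<open>i + 1\<close> in time.\<close>

lemma length_bucket_le:
  assumes h: "is_history p l h"
  shows "t < length h \<Longrightarrow> i < k \<Longrightarrow> length (bucket (fst (h ! t)) i) \<le> m * Suc t ^ Suc i"
proof (induction t arbitrary: i)
  case 0
  obtain xss where "fst (h ! 0) = update_with p 0 (current p l (take 0 h)) xss"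
    "\<And>i. i \<le> top_level p 0 \<Longrightarrow> length (xss ! i) = m"
    using set_pmf_update_step[OF history_record(1)[OF h 0(1)]] by metis
  then show ?case using length_update_with[of "current p l (take 0 h)" 0 xss i] 0
    by (simp add: current_def init_state_def)
next
  case (Suc t)
  obtain xss where "fst (h ! Suc t) = update_with p (Suc t) (current p l (take (Suc t) h)) xss"
    "\<And>i. i \<le> top_level p (Suc t) \<Longrightarrow> length (xss ! i) = m"
    using set_pmf_update_step[OF history_record(1)[OF h Suc.prems(1)]] by metis
  moreover have "length (bucket (current p l (take (Suc t) h)) j) \<le> m * Suc t ^ Suc j" if "j < k" for j
    using Suc.IH[of j] Suc.prems(1) that by (simp add: current_take_Suc observe_def)
  ultimately show ?case using length_update_with[of "current p l (take (Suc t) h)" "Suc t" xss i] Suc.prems by simp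
qed

lemma prob_take_eq:
  assumes "t \<le> T" "\<And>h. h \<in> set_pmf (hrun p l T) \<Longrightarrow> Q h \<longleftrightarrow> Q' (take t h)"
  shows "measure_pmf.prob (hrun p l T) {h. Q h} = measure_pmf.prob (hrun p l t) {h. Q' h}"
proof -
  have "measure_pmf.prob (hrun p l t) {h. Q' h} = measure_pmf.prob (map_pmf (take t) (hrun p l T)) {h. Q' h}"
    by (simp only: map_take_hrun[OF assms(1)])
  also have "\<dots> = measure_pmf.prob (hrun p l T) {h. Q' (take t h)}"
    by (simp add: vimage_def)
  also have "\<dots> = measure_pmf.prob (hrun p l T) {h. Q h}"
    using assms(2) by (intro measure_pmf.finite_measure_eq_AE) (auto simp: AE_measure_pmf_iff)
  finally show ?thesis by simp
qed

lemma window_eq: "window i w = {w..<min (w + P i) T}"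
  by (auto simp: window_def)

end

subsection \<open>Failure probabilities\<close>

context algorithm
begin

lemma window_experts:
  assumes "is_history p l h" "i < k" "P i dvd w" "w \<le> t" "t < length h" "t < w + P i"
  shows "expert ` set (bucket (fst (h ! t)) i) = fst ` post h i w"
proof -
  have "fst ` set (map (\<lambda>e. (expert e, entry_weight e)) (bucket (fst (h ! t)) i)) =
      expert ` set (bucket (fst (h ! w)) i)"
    unfolding conjunct1[OF window_state[OF assms]] by (simp add: image_image)
  then show ?thesis by (simp add: image_image post_def core_def)
qed

definition bucket_failure :: "real \<Rightarrow> nat \<Rightarrow> nat \<Rightarrow> history \<Rightarrow> bool" where
  "bucket_failure R i w h \<longleftrightarrow> (\<exists>x\<in>fst ` post h i w.
     (\<Sum>t\<in>window i w. l t x) + R * sqrt (real (P i)) < (\<Sum>t\<in>window i w. l t (drawn h i t)))"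

definition mix_failure :: "real \<Rightarrow> nat \<Rightarrow> nat \<Rightarrow> history \<Rightarrow> bool" where
  "mix_failure R i w h \<longleftrightarrow>
     (\<Sum>t\<in>window i w. l t (drawn h i t)) + R * sqrt (real (P i)) < (\<Sum>t\<in>window i w. l t (chosen h i t)) \<or>
     (\<Sum>t\<in>window i w. l t (chosen h (i - 1) t)) + R * sqrt (real (P i)) < (\<Sum>t\<in>window i w. l t (chosen h i t))"

definition bucket_log :: real where
  "bucket_log = ln (real m * real T ^ k)"

text \<open>Markov's inequality for a potential that equals 1 when the window opens, evaluated at
  the end of the window, where the failure is decided.\<close>

lemma window_failure_bound:
  fixes \<Phi> :: "history \<Rightarrow> real"
  assumes w: "w < T" "P i dvd w" "i < k"
    and start: "\<And>h. length h = w \<Longrightarrow> \<Phi> h = 1"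
    and step: "\<And>h t. h \<in> set_pmf (hrun p l t) \<Longrightarrow> w \<le> t \<Longrightarrow> t < w + P i \<Longrightarrow> t < T \<Longrightarrow>
      (\<integral>\<^sup>+ r. ennreal (\<Phi> (h @ [r])) \<partial>record_day p t (current p l h)) \<le> ennreal (\<Phi> h)"
    and prefix: "\<And>h. h \<in> set_pmf (hrun p l T) \<Longrightarrow> F h \<longleftrightarrow> F (take (min (w + P i) T) h)"
    and large: "\<And>h. h \<in> set_pmf (hrun p l (min (w + P i) T)) \<Longrightarrow> F h \<Longrightarrow> real T powr c \<le> \<Phi> h"
  shows "measure_pmf.prob (hrun p l T) {h. F h} \<le> real T powr (- c)"
proof -
  let ?t1 = "min (w + P i) T"
  have T0: "0 < real T powr c" using T2 by simp
  have "measure_pmf.prob (hrun p l T) {h. F h} = measure_pmf.prob (hrun p l ?t1) {h. F h}"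
    using prefix by (intro prob_take_eq) auto
  also have "\<dots> \<le> real T powr (- c)"
  proof (rule prob_le_nn_integral)
    have "(\<integral>\<^sup>+ h. ennreal (\<Phi> h) \<partial>hrun p l ?t1) \<le> (\<integral>\<^sup>+ h. ennreal (\<Phi> h) \<partial>hrun p l w)"
      using w step by (intro nn_integral_hrun_le) auto
    also have "\<dots> = (\<integral>\<^sup>+ h. 1 \<partial>hrun p l w)"
      using start by (intro nn_integral_cong_AE) (auto simp: AE_measure_pmf_iff dest!: set_pmf_hrun)
    finally have "(\<integral>\<^sup>+ h. ennreal (\<Phi> h) \<partial>hrun p l ?t1) \<le> 1" by simp
    then have "ennreal (real T powr (- c)) * (\<integral>\<^sup>+ h. ennreal (\<Phi> h) \<partial>hrun p l ?t1) \<le> ennreal (real T powr (- c)) * 1"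
      by (intro mult_left_mono) auto
    then show "(\<integral>\<^sup>+ h. ennreal (real T powr (- c)) * ennreal (\<Phi> h) \<partial>hrun p l ?t1) \<le> ennreal (real T powr (- c))"
      by (simp add: nn_integral_cmult)
  next
    fix h assume "h \<in> set_pmf (hrun p l ?t1)" "h \<in> {h. F h}"
    then have "real T powr c \<le> \<Phi> h" using large by simp
    then have "1 \<le> real T powr (- c) * \<Phi> h" using T0 by (simp add: powr_minus field_simps)
    then show "1 \<le> ennreal (real T powr (- c)) * ennreal (\<Phi> h)"
      by (subst ennreal_mult'[symmetric]) (auto simp: ennreal_leI simp flip: ennreal_1)
  qed simp
  finally show ?thesis .
qed

lemma take_eqs:
  "\<tau> < t \<Longrightarrow> drawn (take t h) i \<tau> = drawn h i \<tau>"
  "\<tau> < t \<Longrightarrow> chosen (take t h) i \<tau> = chosen h i \<tau>"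
  "\<tau> < t \<Longrightarrow> post (take t h) i \<tau> = post h i \<tau>"
  by (simp_all add: drawn_def chosen_def post_def)

text \<open>On failure the single weight of the better expert already makes the potential at least
  \<open>T powr c\<close>. Of the \<open>3/2\<close> in the bound, 1 pays for the logarithm of the
  bucket size and \<open>1/2\<close> for the variance term.\<close>

lemma prob_bucket_failure:
  assumes w: "w < T" "P i dvd w" "i < k" and c: "0 \<le> c"
    and R: "3/2 * sqrt bucket_log + 2 * c * ln (real T) \<le> R"
  shows "measure_pmf.prob (hrun p l T) {h. bucket_failure R i w h} \<le> real T powr (- c)"
proof (rule window_failure_bound[OF w, where \<Phi> = "bucket_potential i w"])
  let ?t1 = "min (w + P i) T"
  have P: "0 < P i" using period_pos w by simp
  have w1: "w < ?t1" using w P by simp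
  show "bucket_potential i w h = 1" if "length h = w" for h
    using that by (simp add: bucket_potential_def)
  show "(\<integral>\<^sup>+ r. ennreal (bucket_potential i w (h @ [r])) \<partial>record_day p t (current p l h)) \<le> ennreal (bucket_potential i w h)"
    if "h \<in> set_pmf (hrun p l t)" "w \<le> t" "t < w + P i" "t < T" for h t
    using that w by (intro bucket_potential_step) auto
  show "bucket_failure R i w h \<longleftrightarrow> bucket_failure R i w (take ?t1 h)" for h
  proof -
    have "(\<Sum>t\<in>window i w. l t (drawn (take ?t1 h) i t)) = (\<Sum>t\<in>window i w. l t (drawn h i t))"
      unfolding window_eq by (intro sum.cong refl) (simp add: take_eqs)
    then show ?thesis unfolding bucket_failure_def using take_eqs(3)[OF w1, of h i] by simp
  qed
  fix h assume "h \<in> set_pmf (hrun p l ?t1)" and fail: "bucket_failure R i w h"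
  then have len: "length h = ?t1" and hist: "is_history p l h" using set_pmf_hrun by auto
  define B where "B = bucket (fst (h ! w)) i"
  define \<eta> where "\<eta> = bucket_rate p i B"
  have Bne: "B \<noteq> []" unfolding B_def using w w1 len by (intro bucket_start_nonempty hist) auto
  have lnT: "0 \<le> ln (real T)" using T2 by simp
  let ?S = "\<Sum>\<tau>=w..<?t1. l \<tau> (drawn h i \<tau>)"
  obtain e where e: "e \<in> set B" and S: "L (expert e) w ?t1 + R * sqrt (real (P i)) < ?S"
    using fail by (auto simp: bucket_failure_def window_eq post_def core_def B_def L_def)
  have "length B \<le> m * Suc w ^ Suc i"
    unfolding B_def using w w1 len by (intro length_bucket_le hist) auto
  also have "\<dots> \<le> m * T ^ k"
    using w T2 by (intro mult_le_mono2 order_trans[OF power_mono[of "Suc w" T] power_increasing]) auto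
  finally have "real (length B) \<le> real m * real T ^ k"
    by (simp only: of_nat_power[symmetric] of_nat_mult[symmetric] of_nat_le_iff)
  then have ln_le: "ln (real (length B)) \<le> bucket_log"
    unfolding bucket_log_def using Bne by (intro ln_mono) auto
  have Blen: "1 \<le> length B" using Bne by (simp add: Suc_le_eq)
  have ln0: "0 \<le> ln (real (length B))" using Blen by simp
  have R0: "0 \<le> R"
    using R c lnT ln0 ln_le by (intro order_trans[OF _ R] add_nonneg_nonneg mult_nonneg_nonneg) auto
  \<comment> \<open>A bucket of size 1 has learning rate \<open>sqrt (ln 1) = 0\<close>, and the
    potential says nothing. But then the only expert is always drawn and there is no regret.\<close>
  have "length B \<noteq> 1"
  proof
    assume "length B = 1"
    then have B: "B = [e]" using e by (cases B) auto
    have "drawn h i t = expert e" if "t \<in> {w..<?t1}" for t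
      using drawn_mem(1)[OF hist, of t i] window_experts[OF hist w(3,2), of t] that len B w
      by (simp add: post_def core_def B_def[symmetric])
    then have "?S = L (expert e) w ?t1" unfolding L_def by (intro sum.cong) auto
    moreover have "0 \<le> R * sqrt (real (P i))" using R0 by simp
    ultimately show False using S by linarith
  qed
  then have "2 \<le> length B" using Blen by simp
  then have "ln 2 \<le> ln (real (length B))" by (intro ln_mono) auto
  \<comment> \<open>Yields \<open>\<sigma> \<ge> 1/2\<close>; this is why \<open>c * ln T\<close>
    enters the width \<open>R\<close> with the factor 2.\<close>
  moreover have "1/4 \<le> ln (2::real)" using ln2_ge_two_thirds by simp
  ultimately have quarter: "1/4 \<le> ln (real (length B))" by simp
  define \<sigma> where "\<sigma> = sqrt (ln (real (length B)))"
  have lam: "1/2 \<le> \<sigma>" "\<sigma>\<^sup>2 = ln (real (length B))" "\<sigma> \<le> sqrt bucket_log"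
    using quarter ln0 ln_le real_le_rsqrt[of "1/2" "ln (real (length B))"] by (auto simp: \<sigma>_def power2_eq_square)
  have etaP: "\<eta> * sqrt (real (P i)) = \<sigma>" "\<eta>\<^sup>2 * real (P i) = \<sigma>\<^sup>2" and eta: "0 \<le> \<eta>"
    using P ln0 by (auto simp: \<eta>_def bucket_rate_def \<sigma>_def real_sqrt_divide real_sqrt_mult power_divide)
  have expo: "c * ln (real T) \<le> \<eta> * ?S - \<eta>\<^sup>2 * real (?t1 - w) / 2 - \<eta> * L (expert e) w ?t1 - ln (real (length B))"
  proof -
    have "\<eta> * (L (expert e) w ?t1 + R * sqrt (real (P i))) \<le> \<eta> * ?S"
      using S eta by (intro mult_left_mono) auto
    then have 1: "\<sigma> * R \<le> \<eta> * ?S - \<eta> * L (expert e) w ?t1"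
      using etaP(1) by (simp add: algebra_simps)
    have "real (?t1 - w) \<le> real (P i)" by simp
    then have "\<eta>\<^sup>2 * real (?t1 - w) \<le> \<eta>\<^sup>2 * real (P i)" by (rule mult_left_mono) simp
    then have 2: "\<eta>\<^sup>2 * real (?t1 - w) / 2 \<le> \<sigma>\<^sup>2 / 2" unfolding etaP(2) by simp
    have "\<sigma> * (3/2 * \<sigma> + 2 * (c * ln (real T))) \<le> \<sigma> * R"
      using R lam by (intro mult_left_mono) auto
    moreover have "1/2 * (2 * (c * ln (real T))) \<le> \<sigma> * (2 * (c * ln (real T)))"
      using lam c lnT by (intro mult_right_mono) auto
    ultimately have "3/2 * \<sigma>\<^sup>2 + c * ln (real T) \<le> \<sigma> * R"
      by (simp add: algebra_simps power2_eq_square)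
    then show ?thesis using 1 2 lam(2) by simp
  qed
  have "real T powr c = exp (c * ln (real T))" using T2 by (simp add: powr_def)
  also have "\<dots> \<le> exp (\<eta> * ?S - \<eta>\<^sup>2 * real (?t1 - w) / 2 - \<eta> * L (expert e) w ?t1 - ln (real (length B)))"
    using expo by simp
  also have "\<dots> = exp (\<eta> * ?S - \<eta>\<^sup>2 * real (?t1 - w) / 2) * exp (- \<eta> * L (expert e) w ?t1) / real (length B)"
  proof -
    have "exp (a - v - ln (real (length B))) = exp a * exp (- v) / real (length B)" for a v :: real
      using Bne by (simp add: exp_diff exp_minus inverse_eq_divide)
    then show ?thesis by (simp only: mult_minus_left)
  qed
  also have "\<dots> \<le> exp (\<eta> * ?S - \<eta>\<^sup>2 * real (?t1 - w) / 2) * (\<Sum>e\<leftarrow>B. exp (- \<eta> * L (expert e) w ?t1)) / real (length B)"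
    using e by (intro divide_right_mono mult_left_mono member_le_sum_list) auto
  also have "\<dots> = bucket_potential i w h"
  proof -
    have "\<not> ?t1 \<le> w" using w1 by (simp only: not_le)
    then show ?thesis
      by (simp only: bucket_potential_def Let_def B_def[symmetric] \<eta>_def[symmetric] len if_False)
  qed
  finally show "real T powr c \<le> bucket_potential i w h" .
qed

text \<open>Here \<open>\<mu>\<^sup>2 * P i = 2\<close>, so the variance term is at most 1, and
  \<open>ln 2\<close> for the two options is at most 1 as well; together they are the constant
  2.\<close>

lemma prob_mix_failure:
  assumes w: "w < T" "P i dvd w" "i < k" and i: "0 < i" and c: "0 \<le> c"
    and R: "2 + c * ln (real T) \<le> R"
  shows "measure_pmf.prob (hrun p l T) {h. mix_failure R i w h} \<le> real T powr (- c)"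
proof (rule window_failure_bound[OF w, where \<Phi> = "mix_potential i w"])
  let ?t1 = "min (w + P i) T"
  have P: "0 < P i" using period_pos w by simp
  have w1: "w < ?t1" using w P by simp
  show "mix_potential i w h = 1" if "length h = w" for h
    using that by (simp add: mix_potential_def)
  show "(\<integral>\<^sup>+ r. ennreal (mix_potential i w (h @ [r])) \<partial>record_day p t (current p l h)) \<le> ennreal (mix_potential i w h)"
    if "h \<in> set_pmf (hrun p l t)" "w \<le> t" "t < w + P i" "t < T" for h t
    using that w i by (intro mix_potential_step) auto
  show "mix_failure R i w h \<longleftrightarrow> mix_failure R i w (take ?t1 h)" for h
  proof -
    have "(\<Sum>t\<in>window i w. l t (drawn (take ?t1 h) i t)) = (\<Sum>t\<in>window i w. l t (drawn h i t))"
      "(\<Sum>t\<in>window i w. l t (chosen (take ?t1 h) j t)) = (\<Sum>t\<in>window i w. l t (chosen h j t))" for j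
      unfolding window_eq by (intro sum.cong refl; simp add: take_eqs)+
    then show ?thesis unfolding mix_failure_def by simp
  qed
  fix h assume "h \<in> set_pmf (hrun p l ?t1)" and fail: "mix_failure R i w h"
  then have len: "length h = ?t1" using set_pmf_hrun by auto
  define \<mu> where "\<mu> = mix_rate p i"
  have lnT: "0 \<le> ln (real T)" using T2 by simp
  let ?S = "\<Sum>\<tau>=w..<?t1. l \<tau> (chosen h i \<tau>)"
  let ?a = "\<Sum>\<tau>=w..<?t1. l \<tau> (drawn h i \<tau>)" and ?b = "\<Sum>\<tau>=w..<?t1. l \<tau> (chosen h (i - 1) \<tau>)"
  obtain y where y: "y = ?a \<or> y = ?b" and S: "y + R * sqrt (real (P i)) < ?S"
    using fail by (auto simp: mix_failure_def window_eq)
  have muP: "\<mu> * sqrt (real (P i)) = sqrt 2" "\<mu>\<^sup>2 * real (P i) = 2" and mu: "0 \<le> \<mu>"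
    using P by (auto simp: \<mu>_def mix_rate_def real_sqrt_divide power_divide)
  have expo: "c * ln (real T) \<le> \<mu> * ?S - \<mu>\<^sup>2 * real (?t1 - w) / 2 - \<mu> * y - ln 2"
  proof -
    have "\<mu> * (y + R * sqrt (real (P i))) \<le> \<mu> * ?S"
      using S mu by (intro mult_left_mono) auto
    then have 1: "sqrt 2 * R \<le> \<mu> * ?S - \<mu> * y"
      using muP(1) by (simp add: algebra_simps)
    have "real (?t1 - w) \<le> real (P i)" by simp
    then have "\<mu>\<^sup>2 * real (?t1 - w) \<le> \<mu>\<^sup>2 * real (P i)" by (rule mult_left_mono) simp
    then have 2: "\<mu>\<^sup>2 * real (?t1 - w) / 2 \<le> 1" unfolding muP(2) by simp
    have "0 \<le> c * ln (real T)" using c lnT by simp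
    then have "1 * R \<le> sqrt 2 * R" using R by (intro mult_right_mono) auto
    moreover have "ln 2 \<le> (1::real)" using ln_le_minus_one[of "2::real"] by simp
    ultimately show ?thesis using 1 2 R by simp
  qed
  have "real T powr c = exp (c * ln (real T))" using T2 by (simp add: powr_def)
  also have "\<dots> \<le> exp (\<mu> * ?S - \<mu>\<^sup>2 * real (?t1 - w) / 2 - \<mu> * y - ln 2)"
    using expo by simp
  also have "\<dots> = exp (\<mu> * ?S - \<mu>\<^sup>2 * real (?t1 - w) / 2) * exp (- \<mu> * y) / 2"
  proof -
    have "exp (a - v - ln 2) = exp a * exp (- v) / 2" for a v :: real
      by (simp only: exp_diff exp_ln zero_less_numeral) (simp add: exp_minus inverse_eq_divide)
    then show ?thesis by (simp only: mult_minus_left)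
  qed
  also have "\<dots> \<le> exp (\<mu> * ?S - \<mu>\<^sup>2 * real (?t1 - w) / 2) * (exp (- \<mu> * ?a) + exp (- \<mu> * ?b)) / 2"
    using y by (intro divide_right_mono mult_left_mono) auto
  also have "\<dots> = mix_potential i w h"
    using len by (simp add: mix_potential_def \<mu>_def)
  finally show "real T powr c \<le> mix_potential i w h" .
qed

text \<open>Passes from the fate of a single bucket to the combinatorial notion: survival puts the
  expert into bucket \<open>i\<close> throughout, and forwarding puts it into every higher bucket
  updated meanwhile.\<close>

lemma covers_of_covered:
  assumes h: "is_history p l h" "length h = T" and i: "i < k" and u: "P i dvd u" "u < T"
    and cov: "covered i u (post h i u)"
  shows "\<exists>s x. covering.covers p T (\<lambda>j w. fst ` post h j w) l best (eps p) i u s x"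
proof -
  interpret covering p T "\<lambda>j w. fst ` post h j w" l best "eps p" by unfold_locales
  obtain s y where s: "u < s" "s \<le> T" "eligible i u s" and y: "y \<in> remains i (Suc u) (post h i u) s"
    and le: "L (fst y) u s \<le> (1 + eps p) * L best u s"
    using cov by (auto simp: covered_def)
  have "covers i u s (fst y)"
    unfolding covers_def
  proof (intro conjI allI impI)
    show "s = T \<or> P i dvd s \<and> epoch_start p s \<le> u" using s(3) by (simp add: eligible_def)
    show "fst y \<in> fst ` post h i w" if "u \<le> w \<and> w < s \<and> P i dvd w" for w
      using remains_subset_post[OF h(1) i, of u w s] that s(2) h(2) y by auto
    show "fst y \<in> fst ` post h j w" if "i < j \<and> j < k \<and> u < w \<and> w < s \<and> P j dvd w" for j w
      using that s h y by (intro remains_forwarded[of h s i j u w y]) auto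
    show "(\<Sum>t=u..<s. l t (fst y)) \<le> (1 + eps p) * (\<Sum>t=u..<s. l t best)"
      using le by (simp add: L_def)
  qed (use s in auto)
  then show ?thesis by blast
qed

definition good :: "real \<Rightarrow> nat \<Rightarrow> history \<Rightarrow> bool" where
  "good R N h \<longleftrightarrow> (\<forall>i<k. num_uncovered i h < N) \<and>
     (\<forall>i<k. \<forall>w<T. P i dvd w \<longrightarrow> \<not> bucket_failure R i w h \<and> (0 < i \<longrightarrow> \<not> mix_failure R i w h))"

lemma good_loss_le:
  assumes h: "h \<in> set_pmf (hrun p l T)" and g: "good R N h" and R: "0 \<le> R"
    and B: "\<And>j. Suc j < k \<Longrightarrow> P (Suc j) \<le> B * P j"
  shows "(\<Sum>t<T. l t (chosen h (k - 1) t)) \<le> (1 + eps p) * (\<Sum>t<T. l t best) + real N +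
    2 * R * (\<Sum>j<k - 1. sqrt (real (P j)) * (real B * real N)) +
    2 * R * (sqrt (real (P (k - 1))) * (real T / real (P (k - 1)) + 1))"
proof -
  have len: "length h = T" and hist: "is_history p l h" using set_pmf_hrun[OF h] by auto
  interpret covering p T "\<lambda>j w. fst ` post h j w" l best "eps p" by unfold_locales
  have chosen_0: "chosen h 0 t = drawn h 0 t" for t by (simp add: chosen_def choice_def drawn_def)
  show ?thesis
  proof (rule sum_choice_total_le[where Y = "\<lambda>j t. l t (chosen h j t)"])
    show "0 \<le> eps p" by (rule eps_nonneg)
    show "0 \<le> l t best" if "t < T" for t using loss_bounds[OF that best] by simp
    \<comment> \<open>The width is doubled because comparing \<open>y\<^sub>j\<close> with an expert
      of bucket \<open>j\<close> uses two bounds: first \<open>y\<^sub>j\<close> against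
      \<open>e\<^sub>j\<close>, then \<open>e\<^sub>j\<close> against the expert.\<close>
    show "0 \<le> 2 * R" using R by simp
    show "0 < T" using T2 by simp
    show "l t (chosen h j t) \<le> 1" if "j < k" "t < T" for j t
      using loss_bounds[OF that(2) drawn_mem(3)[OF hist _ that(1)]] that len by simp
    show "P (Suc j) \<le> B * P j" if "Suc j < k" for j by (rule B[OF that])
    show "real (card {u. u < T \<and> P j dvd u \<and> uncovered j u}) \<le> real N" if j: "j < k" for j
    proof -
      have "card {u. u < T \<and> P j dvd u \<and> uncovered j u} \<le> num_uncovered j h"
        unfolding num_uncovered_def
        using covers_of_covered[OF hist len j] by (intro card_mono) (auto simp: len uncovered_def)
      also have "\<dots> \<le> N" using g j by (auto simp: good_def)
      finally show ?thesis by simp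
    qed
  next
    fix j w x assume jw: "j < k" "w < T" "P j dvd w" and x: "x \<in> fst ` post h j w"
    have 1: "(\<Sum>t\<in>window j w. l t (drawn h j t)) \<le> (\<Sum>t\<in>window j w. l t x) + R * sqrt (real (P j))"
      using g jw x by (auto simp: good_def bucket_failure_def not_less)
    have 2: "(\<Sum>t\<in>window j w. l t (chosen h j t)) \<le> (\<Sum>t\<in>window j w. l t (drawn h j t)) + R * sqrt (real (P j))"
    proof (cases "j = 0")
      case True
      then show ?thesis using R by (simp add: chosen_0)
    next
      case False
      then show ?thesis using g jw by (auto simp: good_def mix_failure_def not_less)
    qed
    show "(\<Sum>t\<in>window j w. l t (chosen h j t)) \<le> (\<Sum>t\<in>window j w. l t x) + 2 * R * sqrt (real (P j))"
      using 1 2 by simp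
  next
    fix j w assume jw: "Suc j < k" "w < T" "P (Suc j) dvd w"
    have "(\<Sum>t\<in>window (Suc j) w. l t (chosen h (Suc j) t)) \<le>
        (\<Sum>t\<in>window (Suc j) w. l t (chosen h j t)) + R * sqrt (real (P (Suc j)))"
      using g jw by (auto simp: good_def mix_failure_def not_less)
    moreover have "0 \<le> R * sqrt (real (P (Suc j)))" using R by simp
    ultimately show "(\<Sum>t\<in>window (Suc j) w. l t (chosen h (Suc j) t)) \<le>
        (\<Sum>t\<in>window (Suc j) w. l t (chosen h j t)) + 2 * R * sqrt (real (P (Suc j)))" by simp
  qed
qed

text \<open>Union bound over the levels for the counts, and over at most \<open>k * T\<close>
  windows with two kinds of failure each.\<close>

lemma prob_not_good:
  assumes c: "0 \<le> c" and R: "2 + 3/2 * sqrt bucket_log + 2 * c * ln (real T) \<le> R"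
  shows "measure_pmf.prob (hrun p l T) {h. \<not> good R N h} \<le>
    real k * (real n / real (n + m)) ^ N + 2 * real k * real T * real T powr (- c)"
proof -
  let ?M = "measure_pmf (hrun p l T)"
  have lnT: "0 \<le> c * ln (real T)" using T2 c by simp
  have log: "0 \<le> bucket_log"
  proof -
    have "1 \<le> m * T ^ k" using space T2 by (simp add: Suc_le_eq)
    then have "1 \<le> real (m * T ^ k)" by (simp only: real_of_nat_ge_one_iff)
    then show ?thesis unfolding bucket_log_def by (intro ln_ge_zero) simp
  qed
  have "0 \<le> sqrt bucket_log" using log by simp
  have R1: "3/2 * sqrt bucket_log + 2 * c * ln (real T) \<le> R" using R by simp
  have R2: "2 + c * ln (real T) \<le> R" using R lnT \<open>0 \<le> sqrt bucket_log\<close> by linarith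
  let ?U = "\<lambda>i. {h. N \<le> num_uncovered i h}"
  let ?B = "\<lambda>i w. {h. P i dvd w \<and> bucket_failure R i w h}"
  let ?X = "\<lambda>i w. {h. P i dvd w \<and> 0 < i \<and> mix_failure R i w h}"
  have "measure_pmf.prob (hrun p l T) {h. \<not> good R N h} \<le>
      measure_pmf.prob (hrun p l T) ((\<Union>i<k. ?U i) \<union> (\<Union>z\<in>{..<k} \<times> {..<T}. ?B (fst z) (snd z) \<union> ?X (fst z) (snd z)))"
    by (intro measure_pmf.finite_measure_mono) (auto simp: good_def not_less)
  also have "\<dots> \<le> measure_pmf.prob (hrun p l T) (\<Union>i<k. ?U i) +
      measure_pmf.prob (hrun p l T) (\<Union>z\<in>{..<k} \<times> {..<T}. ?B (fst z) (snd z) \<union> ?X (fst z) (snd z))"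
    by (intro measure_Un_le) auto
  also have "\<dots> \<le> (\<Sum>i<k. measure_pmf.prob (hrun p l T) (?U i)) +
      (\<Sum>z\<in>{..<k} \<times> {..<T}. measure_pmf.prob (hrun p l T) (?B (fst z) (snd z) \<union> ?X (fst z) (snd z)))"
    by (intro add_mono measure_pmf.finite_measure_subadditive_finite) auto
  also have "\<dots> \<le> (\<Sum>i<k. (real n / real (n + m)) ^ N) +
      (\<Sum>z\<in>{..<k} \<times> {..<T}. real T powr (- c) + real T powr (- c))"
  proof (intro add_mono sum_mono)
    fix i assume "i \<in> {..<k}"
    then show "measure_pmf.prob (hrun p l T) (?U i) \<le> (real n / real (n + m)) ^ N"
      by (intro prob_num_uncovered_ge) simp
  next
    fix z assume "z \<in> {..<k} \<times> {..<T}"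
    then obtain i w where z: "z = (i, w)" "i < k" "w < T" by auto
    have 1: "measure_pmf.prob (hrun p l T) (?B i w) \<le> real T powr (- c)"
      using prob_bucket_failure[OF z(3) _ z(2) c R1] by (cases "P i dvd w") simp_all
    have 2: "measure_pmf.prob (hrun p l T) (?X i w) \<le> real T powr (- c)"
      using prob_mix_failure[OF z(3) _ z(2) _ c R2] by (cases "P i dvd w \<and> 0 < i") auto
    have "measure_pmf.prob (hrun p l T) (?B i w \<union> ?X i w) \<le>
        measure_pmf.prob (hrun p l T) (?B i w) + measure_pmf.prob (hrun p l T) (?X i w)"
      by (intro measure_Un_le) auto
    then show "measure_pmf.prob (hrun p l T) (?B (fst z) (snd z) \<union> ?X (fst z) (snd z)) \<le>
        real T powr (- c) + real T powr (- c)" using 1 2 z by simp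
  qed
  also have "\<dots> = real k * (real n / real (n + m)) ^ N + 2 * real k * real T * real T powr (- c)"
    by (simp add: algebra_simps)
  finally show ?thesis .
qed

end

subsection \<open>Total regret\<close>

text \<open>A proper multiple is at least twice as large, so the number of levels is
  logarithmic.\<close>

lemma (in period_chain) levels_le_log: "real k * ln 2 \<le> ln (real (P k))"
proof -
  have "2 ^ i \<le> P i" if "i \<le> k" for i
    using that
  proof (induction i)
    case (Suc i)
    then have lt: "P i < P (Suc i)" "P i dvd P (Suc i)" using valid_periods by (auto simp: valid_periods_def)
    then obtain r where r: "P (Suc i) = P i * r" by auto
    then have "1 < r" using lt(1) by (cases "r = 0"; cases "r = 1") auto
    then have "P i * 2 \<le> P (Suc i)" unfolding r by (intro mult_le_mono2) simp
    then show ?case using Suc by simp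
  qed (simp add: period_0)
  then have "real (2 ^ k) \<le> real (P k)" by (simp only: of_nat_le_iff)
  then have "ln (2 ^ k) \<le> ln (real (P k))" by (intro ln_mono) auto
  then show ?thesis by (simp add: ln_realpow)
qed

text \<open>With \<open>x = m / n \<le> 1\<close> one has
  \<open>1 / (1 + x) \<le> 1 - x / 2 \<le> exp (- x / 2)\<close>, hence the factor 2 in the
  condition on \<open>N\<close>.\<close>

lemma shrink_power_le:
  fixes n m T N :: nat and c :: real
  assumes n: "0 < m" "m \<le> n" and T: "2 \<le> T" and N: "2 * (real n / real m) * c * ln (real T) \<le> real N"
  shows "(real n / real (n + m)) ^ N \<le> real T powr (- c)"
proof -
  define x where "x = real m / real n"
  have x: "0 < x" "x \<le> 1" using n by (auto simp: x_def)
  have "real n / real (n + m) = 1 / (1 + x)" using n by (simp add: x_def field_simps)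
  also have "\<dots> \<le> 1 - x / 2"
  proof -
    have "0 \<le> x * (1 - x)" using x by simp
    then have "1 \<le> (1 - x / 2) * (1 + x)" by (simp add: algebra_simps)
    then show ?thesis using x by (simp add: field_simps)
  qed
  also have "\<dots> \<le> exp (- (x / 2))" using exp_ge_add_one_self[of "- (x / 2)"] by simp
  finally have "(real n / real (n + m)) ^ N \<le> exp (- (x / 2)) ^ N" by (intro power_mono) auto
  also have "\<dots> = exp (- (real N * x / 2))" by (simp add: exp_of_nat_mult[symmetric])
  also have "\<dots> \<le> exp (- (c * ln (real T)))"
  proof -
    have "2 * (real n / real m) * c * ln (real T) * x \<le> real N * x" using N x by (intro mult_right_mono) auto
    moreover have "2 * (real n / real m) * c * ln (real T) * x = 2 * (c * ln (real T))"
      using n by (simp add: x_def)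
    ultimately show ?thesis by simp
  qed
  also have "\<dots> = real T powr (- c)" using T by (simp add: powr_def)
  finally show ?thesis .
qed

text \<open>
  \<open>Q\<close> is the period of the top bucket and \<open>q = n / m\<close>; the balance \<open>q Q \<approx> T\<close> makes both the
  regret \<open>T / sqrt Q\<close> of the top bucket and the cost \<open>q sqrt Q\<close> of its uncovered windows of the order
  of \<open>sqrt (T q)\<close>.
\<close>

lemma regret_terms_le:
  fixes T q m Q Lt B N R ep S k \<kappa> r :: real
  assumes q: "1 \<le> q" "q \<le> T" and Q: "0 < Q" "Q * q \<le> T" "T \<le> B * q * Q" and B: "1 \<le> B"
    and Lt: "1/2 \<le> Lt" and N: "0 \<le> N" "N \<le> q * Lt * \<kappa>" and R: "0 \<le> R" "R \<le> r * Lt\<^sup>2"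
    and ep: "ep \<le> 2 * Lt / m" and m: "0 < m" and k: "0 \<le> k" "k \<le> 3 * Lt" and S: "S \<le> k * (sqrt Q * (B * N))"
  shows "ep * T + N + 2 * R * S + 2 * R * (sqrt Q * (T / Q + 1))
    \<le> (16 + 8 * \<kappa> + 6 * B * \<kappa> * r + 8 * (B + 1) * r) * Lt ^ 4 * (T / m + sqrt (T * q))"
proof -
  define Z where "Z = sqrt (T * q)"
  have T: "0 < T" using q by simp
  have Z: "0 \<le> Z" using T q by (simp add: Z_def)
  have r0: "0 \<le> r * Lt\<^sup>2" using R by simp
  then have r: "0 \<le> r" using Lt by (simp add: zero_le_mult_iff)
  have qLt: "0 < q * Lt" using q Lt by simp
  have "0 \<le> q * Lt * \<kappa>" using N by simp
  then have kap: "0 \<le> \<kappa>" using qLt by (simp add: zero_le_mult_iff)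
  \<comment> \<open>Lower powers of the logarithm are raised to the fourth at the price of
    constants, using \<open>Lt \<ge> 1/2\<close>.\<close>
  have p1: "Lt \<le> 8 * Lt ^ 4" "Lt\<^sup>2 \<le> 4 * Lt ^ 4"
  proof -
    have "1/4 \<le> Lt\<^sup>2" using mult_mono[OF Lt Lt] Lt by (simp add: power2_eq_square)
    then have a: "1/4 * Lt\<^sup>2 \<le> Lt\<^sup>2 * Lt\<^sup>2" by (intro mult_right_mono) auto
    moreover have "Lt\<^sup>2 * Lt\<^sup>2 = Lt ^ 4" by (simp flip: power_add)
    ultimately show "Lt\<^sup>2 \<le> 4 * Lt ^ 4" by simp
    moreover have "1/2 * Lt \<le> Lt * Lt" using Lt by (intro mult_right_mono) auto
    ultimately show "Lt \<le> 8 * Lt ^ 4" by (simp add: power2_eq_square)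
  qed
  have L4: "0 \<le> Lt ^ 4" by simp
  have qZ: "q \<le> Z"
    unfolding Z_def using q by (intro real_le_rsqrt) (simp add: power2_eq_square mult_right_mono)
  have sQ: "sqrt Q * q \<le> Z"
  proof -
    have "sqrt Q * q = sqrt (Q * q * q)" using q Q by (simp add: real_sqrt_mult)
    also have "\<dots> \<le> Z" unfolding Z_def using Q q by (intro real_sqrt_le_mono mult_right_mono) auto
    finally show ?thesis .
  qed
  have "sqrt Q * 1 \<le> sqrt Q * q" using q Q by (intro mult_left_mono) auto
  then have sQ': "sqrt Q \<le> Z" using sQ by linarith
  \<comment> \<open>Here the lower bound on the top period, \<open>T \<le> B * q * Q\<close>, is
    used; the upper bound \<open>Q * q \<le> T\<close> served the uncovered windows.\<close>
  have TQ: "sqrt Q * (T / Q) \<le> B * Z"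
  proof -
    have "T * T \<le> T * (B * q * Q)" using Q T by (intro mult_left_mono) auto
    also have "\<dots> = B * (T * q) * Q" by simp
    also have "\<dots> \<le> (B * B) * (T * q) * Q" using B Q T q by (intro mult_right_mono) (auto simp: mult_le_cancel_left1)
    finally have le: "T\<^sup>2 \<le> (B * Z)\<^sup>2 * Q"
      using T q by (simp add: Z_def power_mult_distrib) (simp add: power2_eq_square algebra_simps)
    have "(sqrt Q * (T / Q))\<^sup>2 = T\<^sup>2 / Q" using Q by (simp add: power_mult_distrib power_divide) (simp add: power2_eq_square)
    also have "\<dots> \<le> (B * Z)\<^sup>2" using le Q by (simp add: field_simps)
    finally show ?thesis by (rule power2_le_imp_le) (use B Z in simp)
  qed
  have "ep * T \<le> 2 * Lt / m * T" using ep T by (intro mult_right_mono) auto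
  also have "\<dots> = Lt * (2 * (T / m))" by simp
  also have "\<dots> \<le> 8 * Lt ^ 4 * (2 * (T / m))" using p1 T m by (intro mult_right_mono) auto
  finally have 1: "ep * T \<le> 16 * Lt ^ 4 * (T / m)" by simp
  have "N \<le> Lt * (q * \<kappa>)" using N by (simp add: algebra_simps)
  also have "\<dots> \<le> (8 * Lt ^ 4) * (Z * \<kappa>)" using p1 qZ kap q Lt by (intro mult_mono) auto
  finally have 2: "N \<le> 8 * \<kappa> * Lt ^ 4 * Z" by (simp add: algebra_simps)
  have "S \<le> 3 * Lt * (sqrt Q * (B * (q * Lt * \<kappa>)))"
    using k N B Q by (intro order_trans[OF S] mult_mono) auto
  also have "\<dots> = 3 * B * \<kappa> * Lt\<^sup>2 * (sqrt Q * q)" by (simp add: power2_eq_square)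
  also have "\<dots> \<le> 3 * B * \<kappa> * Lt\<^sup>2 * Z" using sQ B kap by (intro mult_left_mono) auto
  finally have S': "S \<le> 3 * B * \<kappa> * Lt\<^sup>2 * Z" .
  have "R * S \<le> R * (3 * B * \<kappa> * Lt\<^sup>2 * Z)" using S' R by (intro mult_left_mono) auto
  also have "\<dots> \<le> r * Lt\<^sup>2 * (3 * B * \<kappa> * Lt\<^sup>2 * Z)" using R B kap Z by (intro mult_right_mono) auto
  also have "\<dots> = 3 * B * \<kappa> * r * (Lt\<^sup>2 * Lt\<^sup>2) * Z" by simp
  also have "Lt\<^sup>2 * Lt\<^sup>2 = Lt ^ 4" by (simp flip: power_add)
  finally have 3: "2 * R * S \<le> 6 * B * \<kappa> * r * Lt ^ 4 * Z" by (simp add: algebra_simps)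
  have "sqrt Q * (T / Q + 1) \<le> (B + 1) * Z" using TQ sQ' by (simp add: algebra_simps)
  then have "R * (sqrt Q * (T / Q + 1)) \<le> (r * Lt\<^sup>2) * ((B + 1) * Z)"
    by (rule mult_mono[OF R(2)]) (use r0 Q T in auto)
  also have "\<dots> = Lt\<^sup>2 * (r * ((B + 1) * Z))" by simp
  also have "\<dots> \<le> (4 * Lt ^ 4) * (r * ((B + 1) * Z))" using p1 r B Z by (intro mult_right_mono) auto
  finally have "2 * (R * (sqrt Q * (T / Q + 1))) \<le> 2 * ((4 * Lt ^ 4) * (r * ((B + 1) * Z)))"
    by (intro mult_left_mono) auto
  also have "\<dots> = 8 * (B + 1) * r * Lt ^ 4 * Z" by simp
  finally have 4: "2 * R * (sqrt Q * (T / Q + 1)) \<le> 8 * (B + 1) * r * Lt ^ 4 * Z"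
    by (simp only: mult.assoc)
  define A where "A = 8 * \<kappa> + 6 * B * \<kappa> * r + 8 * (B + 1) * r"
  have A: "0 \<le> A" unfolding A_def using kap B r by (intro add_nonneg_nonneg mult_nonneg_nonneg) auto
  have "ep * T + N + 2 * R * S + 2 * R * (sqrt Q * (T / Q + 1)) \<le> 16 * Lt ^ 4 * (T / m) + A * Lt ^ 4 * Z"
    using 1 2 3 4 by (simp add: A_def algebra_simps)
  also have "\<dots> \<le> (16 + A) * Lt ^ 4 * (T / m) + (16 + A) * Lt ^ 4 * Z"
    using A L4 T m Z by (intro add_mono mult_right_mono) auto
  also have "\<dots> = (16 + A) * Lt ^ 4 * (T / m + Z)" by (simp only: distrib_left)
  finally show ?thesis by (simp only: Z_def A_def add.assoc)
qed

context algorithm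
begin

lemma bucket_log_le:
  assumes "real m \<le> real T ^ d" "real k \<le> 3 * ln (real T)"
  shows "bucket_log \<le> real d * ln (real T) + 3 * (ln (real T))\<^sup>2"
proof -
  have T: "0 < real T" "0 \<le> ln (real T)" using T2 by auto
  have m: "0 < real m" using space by simp
  have "bucket_log = ln (real m) + real k * ln (real T)"
    unfolding bucket_log_def using m T by (simp add: ln_mult ln_realpow)
  also have "ln (real m) \<le> ln (real T ^ d)" using assms(1) m by (intro ln_mono) auto
  also have "\<dots> = real d * ln (real T)" using T by (simp add: ln_realpow)
  also have "real k * ln (real T) \<le> 3 * ln (real T) * ln (real T)"
    using assms(2) T by (intro mult_right_mono) auto
  finally show ?thesis by (simp add: power2_eq_square)
qed

lemma prob_regret:
  fixes B d :: nat and c :: real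
  assumes m: "m \<le> n" "real m \<le> real T ^ d" and nT: "real n / real m \<le> real T"
    and H: "P k < 2 * T" and B: "1 \<le> B" "\<And>j. Suc j < k \<Longrightarrow> P (Suc j) \<le> B * P j"
    and Q: "P (k - 1) * n \<le> T * m" "T * m \<le> B * n * P (k - 1)" and c: "0 < c"
    and min: "(\<Sum>t<T. l t best) = Min ((\<lambda>i. \<Sum>t<T. l t i) ` {..<n})"
  defines "\<kappa> \<equiv> 2 * (c + 5) + 2" and "r \<equiv> 15 + 3 * real d + 4 * (c + 5)"
  shows "measure_pmf.prob (plays p l T) {is. regret T n l is \<le>
      (16 + 8 * \<kappa> + 6 * real B * \<kappa> * r + 8 * (real B + 1) * r) * ln (real T) ^ 4 *
      (real T / real m + sqrt (real T * real n / real m))} \<ge> 1 - real T powr (- c)"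
proof -
  \<comment> \<open>The extra 5 in the exponent absorbs the number of events in the union bound,
    which is at most \<open>T ^ 5\<close>.\<close>
  let ?c = "c + 5" and ?Lt = "ln (real T)" and ?q = "real n / real m" and ?Q = "real (P (k - 1))"
  define N where "N = nat \<lceil>2 * ?q * ?c * ?Lt\<rceil>"
  define R where "R = 2 + 3/2 * sqrt bucket_log + 2 * ?c * ?Lt"
  define S where "S = (\<Sum>j<k - 1. sqrt (real (P j)) * (real B * real N))"
  let ?A = "16 + 8 * \<kappa> + 6 * real B * \<kappa> * r + 8 * (real B + 1) * r"
  let ?bound = "?A * ?Lt ^ 4 * (real T / real m + sqrt (real T * real n / real m))"
  have mpos: "0 < real m" using space by simp
  have q1: "1 \<le> ?q" using m(1) mpos by simp
  have "ln 2 \<le> ?Lt" using T2 by (intro ln_mono) auto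
  then have Lt: "2/3 \<le> ?Lt" using ln2_ge_two_thirds by simp
  have Hpos: "0 < real (P k)" using period_pos[of k] by simp
  have "ln (real (P k)) \<le> ln (2 * real T)" using H Hpos by (intro ln_mono) auto
  also have "\<dots> = ln 2 + ?Lt" using T2 by (simp add: ln_mult)
  finally have lnH: "ln (real (P k)) \<le> 2 * ?Lt" using \<open>ln 2 \<le> ?Lt\<close> by simp
  have "real k * (2/3) \<le> real k * ln 2" using ln2_ge_two_thirds by (intro mult_left_mono) auto
  then have k: "real k \<le> 3 * ?Lt" using levels_le_log lnH by linarith
  have kT: "real k \<le> 3 * real T"
    using k ln_le_minus_one[of "real T"] T2 by simp
  have log0: "0 \<le> bucket_log"
    unfolding bucket_log_def using space T2 by (intro ln_ge_zero) (simp add: mult_ge1_I)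
  have R0: "0 \<le> R" unfolding R_def using log0 c Lt by (intro add_nonneg_nonneg mult_nonneg_nonneg) auto
  have Lt1: "1 \<le> 3 * ?Lt\<^sup>2" "?Lt \<le> 2 * ?Lt\<^sup>2"
    using mult_mono[OF Lt Lt] mult_right_mono[OF Lt, of ?Lt] Lt by (simp_all add: power2_eq_square)
  have R_le: "R \<le> r * ?Lt\<^sup>2"
  proof -
    \<comment> \<open>The coarse inequality \<open>sqrt x \<le> 1 + x\<close> costs one
      logarithm.\<close>
    have "sqrt bucket_log \<le> sqrt ((1 + bucket_log)\<^sup>2)"
      using log0 by (intro real_sqrt_le_mono) (simp add: power2_eq_square algebra_simps)
    then have "sqrt bucket_log \<le> 1 + bucket_log" using log0 by simp
    also have "\<dots> \<le> 1 + (real d * ?Lt + 3 * ?Lt\<^sup>2)" using bucket_log_le[OF m(2) k] by simp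
    finally have sq: "sqrt bucket_log \<le> 1 + (real d * ?Lt + 3 * ?Lt\<^sup>2)" .
    define u v where "u = real d * (2 * ?Lt\<^sup>2)" and "v = ?c * (2 * ?Lt\<^sup>2)"
    have d_le: "real d * ?Lt \<le> u" unfolding u_def using Lt1(2) by (intro mult_left_mono) auto
    define y where "y = ?c * ?Lt"
    have "y \<le> v" unfolding y_def v_def using Lt1(2) c by (intro mult_left_mono) auto
    moreover have "R = 2 + 3/2 * sqrt bucket_log + 2 * y" by (simp add: R_def y_def)
    \<comment> \<open>The constant \<open>2 + 3/2 = 7/2\<close> is absorbed by
      \<open>1 \<le> 3 * Lt\<^sup>2\<close>; adding up coefficients gives \<open>r\<close>, with
      \<open>7/2 * 3 + 3/2 * 3 = 15\<close>.\<close>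
    ultimately have "R \<le> 7/2 * (3 * ?Lt\<^sup>2) + 3/2 * (u + 3 * ?Lt\<^sup>2) + 2 * v"
      using sq Lt1(1) d_le by (simp add: field_simps)
    also have "\<dots> = 7/2 * (3 * ?Lt\<^sup>2) + 3/2 * (real d * (2 * ?Lt\<^sup>2) + 3 * ?Lt\<^sup>2) + 2 * (?c * (2 * ?Lt\<^sup>2))"
      by (simp only: u_def v_def)
    also have "\<dots> = r * ?Lt\<^sup>2" by (simp add: r_def algebra_simps)
    finally show ?thesis .
  qed
  have "2 * ?q * ?c * ?Lt \<le> real N" unfolding N_def by linarith
  have "0 \<le> 2 * ?q * ?c * ?Lt" using q1 c Lt by (intro mult_nonneg_nonneg) auto
  then have "real N \<le> 2 * ?q * ?c * ?Lt + 1" unfolding N_def by linarith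
  also have "1 \<le> 2 * (?q * ?Lt)" using mult_mono[OF q1 Lt] q1 by simp
  also have "2 * ?q * ?c * ?Lt + 2 * (?q * ?Lt) = ?q * ?Lt * \<kappa>"
  proof -
    have "2 * x * z * y + 2 * (x * y) = x * y * (2 * z + 2)" for x y z :: real by (simp add: algebra_simps)
    then show ?thesis unfolding \<kappa>_def .
  qed
  finally have N_le: "real N \<le> ?q * ?Lt * \<kappa>" by simp
  have bound: "eps p * real T + real N + 2 * R * S + 2 * R * (sqrt ?Q * (real T / ?Q + 1)) \<le> ?bound"
  proof -
    have "eps p * real T + real N + 2 * R * S + 2 * R * (sqrt ?Q * (real T / ?Q + 1)) \<le>
        ?A * ?Lt ^ 4 * (real T / real m + sqrt (real T * ?q))"
    proof (rule regret_terms_le[OF q1 nT, where k = "real k"])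
      show "0 < ?Q" using period_pos[of "k - 1"] by simp
      have "?Q * real n \<le> real T * real m" using Q(1) by (simp only: of_nat_mult[symmetric] of_nat_le_iff)
      then show "?Q * ?q \<le> real T" using mpos by (simp add: field_simps)
      have "real T * real m \<le> real B * real n * ?Q" using Q(2) by (simp only: of_nat_mult[symmetric] of_nat_le_iff)
      then show "real T \<le> real B * ?q * ?Q" using mpos by (simp add: field_simps)
      show "eps p \<le> 2 * ?Lt / real m" unfolding eps_def using lnH mpos by (intro divide_right_mono) auto
      have "S \<le> (\<Sum>j<k - 1. sqrt ?Q * (real B * real N))"
        unfolding S_def
      proof (intro sum_mono mult_right_mono real_sqrt_le_mono)
        fix j assume "j \<in> {..<k - 1}"
        then have "P j dvd P (k - 1)" "0 < P (k - 1)" using period_dvd_mono[of j "k - 1"] period_pos[of "k - 1"] by auto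
        then show "real (P j) \<le> ?Q" by (simp add: dvd_imp_le)
      qed auto
      also have "\<dots> \<le> real k * (sqrt ?Q * (real B * real N))" by (simp add: mult_right_mono)
      finally show "S \<le> real k * (sqrt ?Q * (real B * real N))" .
    qed (use B(1) Lt N_le R0 R_le mpos k in auto)
    then show ?thesis by simp
  qed
  have loss_best: "(\<Sum>t<T. l t best) \<le> real T"
    using sum_bounded_above[of "{..<T}" "\<lambda>t. l t best" 1] loss_bounds[OF _ best] by simp
  have reg: "regret T n l (map (choice (k - 1)) h) \<le> ?bound"
    if h: "h \<in> set_pmf (hrun p l T)" and g: "good R N h" for h
  proof -
    have len: "length h = T" using set_pmf_hrun[OF h] by simp
    have "regret T n l (map (choice (k - 1)) h) = (\<Sum>t<T. l t (chosen h (k - 1) t)) - (\<Sum>t<T. l t best)"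
      unfolding regret_def min by (simp add: chosen_def len)
    also have "\<dots> \<le> eps p * (\<Sum>t<T. l t best) + real N + 2 * R * S + 2 * R * (sqrt ?Q * (real T / ?Q + 1))"
      using good_loss_le[OF h g R0 B(2)] by (simp add: S_def algebra_simps)
    \<comment> \<open>The multiplicative slack is the source of the term \<open>T / m\<close>, since
      \<open>eps p\<close> is at most \<open>2 * ln T / m\<close>.\<close>
    also have "eps p * (\<Sum>t<T. l t best) \<le> eps p * real T" using loss_best eps_nonneg by (intro mult_left_mono)
    finally show ?thesis using bound by simp
  qed
  have "measure_pmf.prob (hrun p l T) {h. \<not> good R N h} \<le>
      real k * (real n / real (n + m)) ^ N + 2 * real k * real T * real T powr (- ?c)"
    using c by (intro prob_not_good) (auto simp: R_def)
  also have "\<dots> \<le> (3 * real T) * real T powr (- ?c) + 2 * (3 * real T) * real T * real T powr (- ?c)"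
  proof (intro add_mono mult_mono kT)
    show "(real n / real (n + m)) ^ N \<le> real T powr (- ?c)"
      using space m(1) T2 \<open>2 * ?q * ?c * ?Lt \<le> real N\<close> by (intro shrink_power_le) auto
  qed auto
  also have "\<dots> = (3 * real T + 6 * (real T * real T)) * real T powr (- ?c)" by (simp add: algebra_simps)
  also have "\<dots> \<le> real T ^ 5 * real T powr (- ?c)"
  proof (rule mult_right_mono)
    have "(2::real) ^ 3 \<le> real T ^ 3" using T2 by (intro power_mono) auto
    then have "real T * real T * 8 \<le> real T * real T * real T ^ 3" by (intro mult_left_mono) auto
    moreover have "2 * real T \<le> real T * real T" using T2 by (intro mult_right_mono) auto
    moreover have "real T * real T * real T ^ 3 = real T ^ 5" by (simp add: power_numeral_reduce)
    ultimately show "3 * real T + 6 * (real T * real T) \<le> real T ^ 5" by linarith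
  qed simp
  also have "\<dots> = real T powr (- c)"
  proof -
    have "real T ^ 5 = real T powr 5" using T2 by simp
    then have "real T ^ 5 * real T powr (- ?c) = real T powr (5 + - ?c)" by (simp only: powr_add)
    then show ?thesis by simp
  qed
  finally have fail: "measure_pmf.prob (hrun p l T) {h. \<not> good R N h} \<le> real T powr (- c)" .
  have "1 - real T powr (- c) \<le> 1 - measure_pmf.prob (hrun p l T) {h. \<not> good R N h}" using fail by simp
  also have "\<dots> = measure_pmf.prob (hrun p l T) {h. good R N h}"
    using measure_pmf.prob_compl[of "{h. \<not> good R N h}" "hrun p l T"] by (simp add: Collect_neg_eq Compl_eq_Diff_UNIV[symmetric])
  also have "\<dots> \<le> measure_pmf.prob (hrun p l T) {h. regret T n l (map (choice (k - 1)) h) \<le> ?bound}"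
    using reg by (intro measure_pmf.finite_measure_mono_AE) (auto simp: AE_measure_pmf_iff)
  also have "\<dots> = measure_pmf.prob (plays p l T) {is. regret T n l is \<le> ?bound}"
    by (simp add: plays_def run_conv_hrun pmf.map_comp o_def vimage_def)
  finally show ?thesis .
qed

end

theorem theorem5p7:
  fixes d b :: nat
  shows "\<exists>(C :: real) (k :: nat \<Rightarrow> nat \<Rightarrow> nat \<Rightarrow> nat) (Ts :: nat \<Rightarrow> nat \<Rightarrow> nat \<Rightarrow> nat \<Rightarrow> nat).
    C > 0 \<and>
    (\<forall>T n m. admissible d C T n m \<longrightarrow>
       valid_periods (k T n m) (Ts T n m) \<and> horizon_for b T (Ts T n m (k T n m))) \<and>
    (\<forall>c > 0. \<exists>(A :: real) (a :: nat). \<forall>T n m fslot sslot l.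
       admissible d C T n m \<and> valid_slots fslot \<and> valid_slots sslot \<and> loss_sequence T n l \<longrightarrow>
       measure_pmf.prob
         (plays \<lparr>levels = k T n m, period = Ts T n m, num_experts = n, space_param = m,
                 fwd_slot = fslot, smp_slot = sslot\<rparr> l T)
         {is. regret T n l is \<le>
              A * ln (real T) ^ a * (real T / real m + sqrt (real T * real n / real m))}
       \<ge> 1 - real T powr (- c))"
proof -
  define OK where "OK = (\<lambda>T n m k Ts. valid_periods k Ts \<and> Ts 0 = 1 \<and> horizon_for b T (Ts k) \<and>
      (\<forall>i. Suc i < k \<longrightarrow> Ts (Suc i) \<le> max b 2 * Ts i) \<and>
      Ts (k - 1) * n \<le> T * m \<and> T * m \<le> max b 2 * n * Ts (k - 1))"
  \<comment> \<open>The choice \<open>C = 2\<close> with \<open>m \<le> n\<close> forces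
    \<open>T \<ge> 2\<close> and \<open>n / m \<le> T\<close>, which is all that the construction of
    the periods asks for.\<close>
  have adm: "2 \<le> T \<and> n \<le> T * m \<and> real n / real m \<le> real T \<and> 1 \<le> m \<and> m \<le> n"
    if "admissible d 2 T n m" for T n m
  proof -
    have a: "1 \<le> m" "m \<le> n" "2 * (real n / real m) \<le> real T" using that by (auto simp: admissible_def)
    have q: "1 \<le> real n / real m" using a by simp
    then have "2 \<le> real T" "real n / real m \<le> real T" using a by linarith+
    moreover from this(2) have "real n \<le> real T * real m" using a by (simp add: field_simps)
    then have "n \<le> T * m" by (simp only: of_nat_mult[symmetric] of_nat_le_iff)
    ultimately show ?thesis using a by simp
  qed
  \<comment> \<open>The levels and periods are fixed from \<open>T\<close>, \<open>n\<close> and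
    \<open>m\<close> alone, before the confidence exponent, the slot rules and the losses are
    given.\<close>
  define par where "par = (\<lambda>T n m. SOME z. OK T n m (fst z) (snd z))"
  have par: "OK T n m (fst (par T n m)) (snd (par T n m))" if "admissible d 2 T n m" for T n m
  proof -
    have "\<exists>k Ts. OK T n m k Ts" unfolding OK_def using adm[OF that] by (intro ex_periods) auto
    then have "\<exists>z. OK T n m (fst z) (snd z)" by auto
    then show ?thesis unfolding par_def by (rule someI_ex)
  qed
  let ?k = "\<lambda>T n m. fst (par T n m)" and ?Ts = "\<lambda>T n m. snd (par T n m)"
  have "\<exists>(A :: real) (a :: nat). \<forall>T n m fslot sslot l.
       admissible d 2 T n m \<and> valid_slots fslot \<and> valid_slots sslot \<and> loss_sequence T n l \<longrightarrow>
       measure_pmf.prob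
         (plays \<lparr>levels = ?k T n m, period = ?Ts T n m, num_experts = n, space_param = m,
                 fwd_slot = fslot, smp_slot = sslot\<rparr> l T)
         {is. regret T n l is \<le>
              A * ln (real T) ^ a * (real T / real m + sqrt (real T * real n / real m))}
       \<ge> 1 - real T powr (- c)" if c: "0 < c" for c :: real
  proof (intro exI allI impI)
    fix T n m fslot sslot l
    assume *: "admissible d 2 T n m \<and> valid_slots fslot \<and> valid_slots sslot \<and> loss_sequence T n l"
    then have a: "2 \<le> T" "n \<le> T * m" "real n / real m \<le> real T" "1 \<le> m" "m \<le> n" using adm by auto
    define p where "p = \<lparr>levels = ?k T n m, period = ?Ts T n m, num_experts = n, space_param = m,
      fwd_slot = fslot, smp_slot = sslot\<rparr>"
    have ok: "valid_periods (levels p) (period p)" "period p 0 = 1" "horizon_for b T (period p (levels p))"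
      "\<And>i. Suc i < levels p \<Longrightarrow> period p (Suc i) \<le> max b 2 * period p i"
      "period p (levels p - 1) * n \<le> T * m" "T * m \<le> max b 2 * n * period p (levels p - 1)"
      using par[of T n m] * by (auto simp: OK_def p_def)
    let ?L = "\<lambda>i. \<Sum>t<T. l t i"
    have "{..<n} \<noteq> {}" using a by (simp add: lessThan_empty_iff)
    then have "Min (?L ` {..<n}) \<in> ?L ` {..<n}" by (intro Min_in) auto
    then obtain best where best_less: "best < n" and best_min: "?L best = Min (?L ` {..<n})" by auto
    interpret algorithm p T l best
      by unfold_locales (use ok * a best_less in \<open>auto simp: p_def horizon_for_def\<close>)
    have "n \<le> T ^ d" using * by (simp add: admissible_def)
    then have "m \<le> T ^ d" using a by simp
    then have mT: "real m \<le> real T ^ d" by (simp only: of_nat_power[symmetric] of_nat_le_iff)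
    show "measure_pmf.prob
         (plays \<lparr>levels = ?k T n m, period = ?Ts T n m, num_experts = n, space_param = m,
                 fwd_slot = fslot, smp_slot = sslot\<rparr> l T)
         {is. regret T n l is \<le>
              (16 + 8 * (2 * (c + 5) + 2) +
               6 * real (max b 2) * (2 * (c + 5) + 2) * (15 + 3 * real d + 4 * (c + 5)) +
               8 * (real (max b 2) + 1) * (15 + 3 * real d + 4 * (c + 5))) * ln (real T) ^ 4 *
              (real T / real m + sqrt (real T * real n / real m))}
       \<ge> 1 - real T powr (- c)"
      unfolding p_def[symmetric]
      using prob_regret[of d "max b 2" c] ok(3-6) a mT c best_min
      by (simp add: p_def horizon_for_def le_max_iff_disj)
  qed
  then show ?thesis
    using par by (intro exI[of _ 2] exI[of _ ?k] exI[of _ ?Ts]) (auto simp: OK_def)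
qed

end
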